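(* Let $F$ be a field of characteristic zero and $k\ge2$. The $T_U$-ideal $\operatorname{Id}^U(M_k(F))$ of $U$-identities of $M_k(F)$ is generated, as a $T_U$-ideal, by the following $U$-polynomials: (1) $x^{e_{12}e_{12}}y^{e_{12}e_{12}}$ if $k=2$, or $x^{e_{12}e_{12}}y^{e_{12}e_{31}}$ if $k\ge3$; (2) $x^{e_{12}e_{12}}y^{e_{12}e_{21}}-y^{e_{12}e_{12}}x^{e_{12}e_{21}}$; (3) $[x^{gg},y^{gg}]$; (4) $[x^{gg},y^{e_{12}e_{12}}]$.
   Context: $L=\operatorname{Der}(M_k(F))$, identified with $\mathrm{sl}_k(F)$ via $c\mapsto\operatorname{ad}_c$, $\operatorname{ad}_c(x)=cx-xc$; $\phi:U(L)\to\operatorname{End}_F(M_k(F))$ is the unital algebra homomorphism from the universal enveloping algebra extending this action, and $U:=\phi(U(L))$. $e_{ij}$ are matrix units, $h_i:=e_{ii}-e_{i+1,i+1}$ ($1\le i<k$), $g:=I_k$, $\mathcal S:=\{e_{ij}\mid i\neq j\}\cup\{h_1,\dots,h_{k-1}\}$, $\mathcal M:=\mathcal S\cup\{g\}$ (a basis of $M_k(F)$). For $a,b\in\mathcal M$, $\varphi_{ab}$ is the linear endomorphism of $M_k(F)$ sending $a$ to $b$ and the other elements of $\mathcal M$ to $0$; $\{\varphi_{ab}\}_{a,b\in\mathcal S}\cup\{\varphi_{gg}\}$ is a basis of $U$. $F\langle X|U\rangle$ (elements: $U$-polynomials) is the nonunital associative algebra generated by symbols $x_i^u$ ($i\ge1$,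 $u\in U$), linear in $u$, with $x_i^1=x_i$; it is free on $\{x_i^{w}\}$ for $w$ in a basis of $U$. One writes $x^{ab}:=x^{\varphi_{ab}}$. $L$ acts on it by derivations: $\delta\in L$ acts as the derivation sending $x_i^u\mapsto x_i^{\phi(\delta)\circ u}$. A $T_U$-ideal is a two-sided ideal invariant under this $L$-action and under all algebra endomorphisms of $F\langle X|U\rangle$ commuting with the $L$-action. $\operatorname{Id}^U(M_k(F))$ is the set of $f\in F\langle X|U\rangle$ vanishing under all evaluations $x_i\mapsto m_i\in M_k(F)$, $x_i^u\mapsto u(m_i)$. $x,y$ denote distinct variables of $X=\{x_1,x_2,\dots\}$ and $[f,h]=fh-hf$. *)

theory Defs
  imports "HOL-Analysis.Analysis" "HOL-Library.Poly_Mapping"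
begin

text \<open>
  The algebra of $k \times k$ matrices is \<open>'f^'n^'n\<close> with \<open>k = CARD('n)\<close>.  Its product is \<open>**\<close>;
  note that \<open>*\<close> on this type would be the entrywise product.
\<close>

type_synonym ('f, 'n) sqmat = "'f^'n^'n"

definition mscale :: "'f::field \<Rightarrow> ('f, 'n::finite) sqmat \<Rightarrow> ('f, 'n) sqmat" where
  "mscale c A = (\<chi> i j. c * A $ i $ j)"

lemma mscale_nth [simp]: "mscale c A $ i $ j = c * A $ i $ j"
  by (simp add: mscale_def)

lemma vector_space_mscale: "vector_space (mscale :: 'f::field \<Rightarrow> ('f, 'n::finite) sqmat \<Rightarrow> _)"
  by unfold_locales (simp_all add: vec_eq_iff algebra_simps)

abbreviation mlinear :: "(('f::field, 'n::finite) sqmat \<Rightarrow> ('f, 'n) sqmat) \<Rightarrow> bool" where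
  "mlinear \<equiv> Vector_Spaces.linear mscale mscale"

lemma mlinear_iff:
  "mlinear D \<longleftrightarrow> (\<forall>x y. D (x + y) = D x + D y) \<and> (\<forall>c x. D (mscale c x) = mscale c (D x))"
  unfolding linear_iff_module_hom module_hom_iff
  using vector_space_mscale[unfolded vector_space_def] by (auto simp: module_def)

lemma mscale_mult_left: "mscale c A ** B = mscale c (A ** B)"
  by (simp add: vec_eq_iff matrix_matrix_mult_def sum_distrib_left mult.assoc)

lemma mscale_mult_right: "A ** mscale c B = mscale c (A ** B)"
  by (simp add: vec_eq_iff matrix_matrix_mult_def sum_distrib_left mult.left_commute)

definition mat_derivation :: "(('f::field, 'n::finite) sqmat \<Rightarrow> ('f, 'n) sqmat) \<Rightarrow> bool" where
  "mat_derivation D \<longleftrightarrow> mlinear D \<and> (\<forall>x y. D (x ** y) = D x ** y + x ** D y)"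

typedef (overloaded) ('f::field, 'n::finite) der =
  "{D :: ('f, 'n) sqmat \<Rightarrow> ('f, 'n) sqmat. mat_derivation D}"
  morphisms der_apply Abs_der
  by (rule exI[of _ "\<lambda>x. 0"]) (simp add: mat_derivation_def mlinear_iff vec_eq_iff)

setup_lifting type_definition_der

lift_definition der_add :: "('f::field, 'n::finite) der \<Rightarrow> ('f, 'n) der \<Rightarrow> ('f, 'n) der"
  is "\<lambda>D E x. D x + E x"
  by (auto simp: mat_derivation_def mlinear_iff matrix_matrix_mult_def vec_eq_iff algebra_simps
      sum.distrib)

lift_definition der_scale :: "'f::field \<Rightarrow> ('f, 'n::finite) der \<Rightarrow> ('f, 'n) der"
  is "\<lambda>c D x. mscale c (D x)"
  by (auto simp: mat_derivation_def mlinear_iff mscale_mult_left mscale_mult_right)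
    (auto simp: vec_eq_iff algebra_simps)

lift_definition der_bracket :: "('f::field, 'n::finite) der \<Rightarrow> ('f, 'n) der \<Rightarrow> ('f, 'n) der"
  is "\<lambda>D E x. D (E x) - E (D x)"
proof -
  fix D E :: "('f, 'n) sqmat \<Rightarrow> ('f, 'n) sqmat"
  assume *: "mat_derivation D" "mat_derivation E"
  have sub: "mscale c a - mscale c b = mscale c (a - b)" for c :: 'f and a b :: "('f, 'n) sqmat"
    by (simp add: vec_eq_iff algebra_simps)
  have l: "(a - b) ** c = a ** c - b ** c" and r: "c ** (a - b) = c ** a - c ** b"
    for a b c :: "('f, 'n) sqmat"
    by (simp_all add: vec_eq_iff matrix_matrix_mult_def algebra_simps sum_subtractf)
  show "mat_derivation (\<lambda>x. D (E x) - E (D x))"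
    using * by (auto simp: mat_derivation_def mlinear_iff sub l r)
qed

lifting_forget der.lifting

text \<open>
  \<open>'a fmon\<close> is the free monoid, written additively because the product of the type of finitely
  supported functions is convolution with respect to \<open>+\<close>.  Hence \<open>'a fmon \<Rightarrow>\<^sub>0 'f\<close> is the free
  unital associative \<open>'f\<close>-algebra on \<open>'a\<close>, in which the scalar \<open>c\<close> is \<open>single 0 c\<close>.
\<close>

datatype 'a fmon = Word (letters: "'a list")

instantiation fmon :: (type) monoid_add
begin
definition zero_fmon :: "'a fmon" where "0 = Word []"
definition plus_fmon :: "'a fmon \<Rightarrow> 'a fmon \<Rightarrow> 'a fmon" where
  "v + w = Word (letters v @ letters w)"
instance by standard (auto simp: zero_fmon_def plus_fmon_def)
end

type_synonym ('a, 'f) free_alg = "'a fmon \<Rightarrow>\<^sub>0 'f"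

definition letter :: "'a \<Rightarrow> ('a, 'f::field) free_alg" where
  "letter a = Poly_Mapping.single (Word [a]) 1"

definition fscale :: "'f::field \<Rightarrow> ('a, 'f) free_alg \<Rightarrow> ('a, 'f) free_alg" where
  "fscale c p = Poly_Mapping.single 0 c * p"

text \<open>
  The linear extension of \<open>h\<close>, where \<open>s\<close> is the scalar multiplication of the codomain.
\<close>

definition linext ::
    "('f \<Rightarrow> 'b \<Rightarrow> 'b) \<Rightarrow> ('a fmon \<Rightarrow> 'b) \<Rightarrow> ('a, 'f::field) free_alg \<Rightarrow> 'b::ab_group_add" where
  "linext s h p = (\<Sum>w\<in>Poly_Mapping.keys p. s (Poly_Mapping.lookup p w) (h w))"

inductive_set ideal_gen :: "'a::ring_1 set \<Rightarrow> 'a set" for R where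
  zero: "0 \<in> ideal_gen R"
| base: "r \<in> R \<Longrightarrow> r \<in> ideal_gen R"
| add: "p \<in> ideal_gen R \<Longrightarrow> q \<in> ideal_gen R \<Longrightarrow> p + q \<in> ideal_gen R"
| left: "p \<in> ideal_gen R \<Longrightarrow> a * p \<in> ideal_gen R"
| right: "p \<in> ideal_gen R \<Longrightarrow> p * a \<in> ideal_gen R"

lemma ideal_gen_minus: "p \<in> ideal_gen R \<Longrightarrow> - p \<in> ideal_gen R"
  using ideal_gen.left[of p R "-1"] by simp

lemma ideal_gen_diff: "p \<in> ideal_gen R \<Longrightarrow> q \<in> ideal_gen R \<Longrightarrow> p - q \<in> ideal_gen R"
  using ideal_gen.add[of p R "-q"] ideal_gen_minus[of q R] by simp

lemma ideal_gen_sym: "p - q \<in> ideal_gen R \<Longrightarrow> q - p \<in> ideal_gen R"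
  using ideal_gen_minus[of "p - q" R] by simp

lemma ideal_gen_trans: "p - q \<in> ideal_gen R \<Longrightarrow> q - r \<in> ideal_gen R \<Longrightarrow> p - r \<in> ideal_gen R"
  using ideal_gen.add[of "p - q" R "q - r"] by simp

lemma ideal_gen_add_cong:
  assumes "p - p' \<in> ideal_gen R" "q - q' \<in> ideal_gen R"
  shows "(p + q) - (p' + q') \<in> ideal_gen R"
  using ideal_gen.add[OF assms] by (simp add: algebra_simps)

lemma ideal_gen_diff_cong:
  assumes "p - p' \<in> ideal_gen R" "q - q' \<in> ideal_gen R"
  shows "(p - q) - (p' - q') \<in> ideal_gen R"
  using ideal_gen_diff[OF assms] by (simp add: algebra_simps)

lemma ideal_gen_mult_cong:
  assumes "p - p' \<in> ideal_gen R" "q - q' \<in> ideal_gen R"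
  shows "p * q - p' * q' \<in> ideal_gen R"
proof -
  have "(p - p') * q + p' * (q - q') \<in> ideal_gen R"
    by (intro ideal_gen.add ideal_gen.right ideal_gen.left assms)
  then show ?thesis by (simp add: algebra_simps)
qed

lemma equivp_ideal_gen: "equivp (\<lambda>p q. p - q \<in> ideal_gen R)"
  by (rule equivpI)
    (auto intro!: reflpI sympI transpI intro: ideal_gen.zero ideal_gen_sym ideal_gen_trans)

lemma free_alg_induct [case_names single add]:
  fixes p :: "('a, 'f::field) free_alg"
  assumes s: "\<And>w c. P (Poly_Mapping.single w c)" and a: "\<And>p q. P p \<Longrightarrow> P q \<Longrightarrow> P (p + q)"
  shows "P p"
proof -
  have "P (\<Sum>w\<in>A. Poly_Mapping.single w (Poly_Mapping.lookup p w))" if "finite A" for A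
    using that by induction (use s[of 0 0] s a in auto)
  moreover have "p = (\<Sum>w\<in>Poly_Mapping.keys p. Poly_Mapping.single w (Poly_Mapping.lookup p w))"
    by (rule poly_mapping_eqI) (simp add: lookup_sum lookup_single when_def in_keys_iff)
  ultimately show ?thesis by (metis finite_keys)
qed

lemma single_0_commute: "Poly_Mapping.single 0 c * p = p * Poly_Mapping.single 0 c"
  for p :: "('a, 'f::field) free_alg"
  by (induction p rule: free_alg_induct) (simp_all add: mult_single algebra_simps)

lemma fscale_mult_left: "fscale c p * q = fscale c (p * q)"
  by (simp add: fscale_def mult.assoc)

lemma fscale_mult_right: "p * fscale c q = fscale c (p * q)"
  by (metis fscale_def mult.assoc single_0_commute)

lemma module_fscale: "module (fscale :: 'f::field \<Rightarrow> ('a, 'f) free_alg \<Rightarrow> _)"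
proof
  show "fscale a (fscale b x) = fscale (a * b) x" for a b and x :: "('a, 'f) free_alg"
    by (simp add: fscale_def mult.assoc[symmetric] mult_single)
qed (simp_all add: fscale_def algebra_simps single_add)

lemma linext_superset:
  assumes "module s" "finite A" "Poly_Mapping.keys p \<subseteq> A"
  shows "linext s h p = (\<Sum>w\<in>A. s (Poly_Mapping.lookup p w) (h w))"
  unfolding linext_def using assms
  by (intro sum.mono_neutral_left) (auto simp: in_keys_iff module.scale_zero_left)

lemma linext_add:
  assumes "module s"
  shows "linext s h (p + q) = linext s h p + linext s h q"
proof -
  have *: "Poly_Mapping.keys (p + q) \<subseteq> Poly_Mapping.keys p \<union> Poly_Mapping.keys q"
    by (auto simp: Poly_Mapping.keys_add)
  show ?thesis
    using *
    by (simp add: linext_superset[OF assms, where A = "Poly_Mapping.keys p \<union> Poly_Mapping.keys q"] lookup_add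
        module.scale_left_distrib[OF assms] sum.distrib)
qed

lemma linext_single:
  assumes "module s"
  shows "linext s h (Poly_Mapping.single w c) = s c (h w)"
  using linext_superset[OF assms, where A = "{w}"] by simp

lemma linext_diff:
  assumes "module s"
  shows "linext s h (p - q) = linext s h p - linext s h q"
  using linext_add[OF assms, of h "p - q" q] by simp

lemma linext_zero: "linext s h 0 = 0"
  by (simp add: linext_def)

lemma linext_fscale:
  assumes "module s"
  shows "linext s h (fscale c p) = s c (linext s h p)"
  by (induction p rule: free_alg_induct)
    (simp_all add: fscale_def mult_single algebra_simps linext_add[OF assms] linext_single[OF assms]
      module.scale_scale[OF assms] module.scale_right_distrib[OF assms])

lemma module_mscale: "module (mscale :: 'f::field \<Rightarrow> ('f, 'n::finite) sqmat \<Rightarrow> _)"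
  using vector_space_mscale by (simp add: module_iff_vector_space)

definition uea_rels :: "(('f::field, 'n::finite) der, 'f) free_alg set" where
  "uea_rels =
     {letter (der_add \<delta> \<epsilon>) - letter \<delta> - letter \<epsilon> | \<delta> \<epsilon>. True} \<union>
     {letter (der_scale c \<delta>) - fscale c (letter \<delta>) | c \<delta>. True} \<union>
     {letter \<delta> * letter \<epsilon> - letter \<epsilon> * letter \<delta> - letter (der_bracket \<delta> \<epsilon>) | \<delta> \<epsilon>. True}"

quotient_type (overloaded) ('f, 'n) uea = "(('f::field, 'n::finite) der, 'f) free_alg" /
  "\<lambda>p q. p - q \<in> ideal_gen uea_rels"
  by (rule equivp_ideal_gen)

fun der_word :: "('f::field, 'n::finite) der list \<Rightarrow> ('f, 'n) sqmat \<Rightarrow> ('f, 'n) sqmat" where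
  "der_word [] x = x"
| "der_word (\<delta> # ds) x = der_apply \<delta> (der_word ds x)"

definition free_der_action ::
  "(('f::field, 'n::finite) der, 'f) free_alg \<Rightarrow> ('f, 'n) sqmat \<Rightarrow> ('f, 'n) sqmat" where
  "free_der_action p x = linext mscale (\<lambda>w. der_word (letters w) x) p"

lemma der_apply_derivation: "mat_derivation (der_apply \<delta>)"
  using der_apply[of \<delta>] by simp

lemma der_apply_linear:
  "der_apply \<delta> (x + y) = der_apply \<delta> x + der_apply \<delta> y"
  "der_apply \<delta> (mscale c x) = mscale c (der_apply \<delta> x)"
  using der_apply_derivation[of \<delta>] by (auto simp: mat_derivation_def mlinear_iff)

lemma der_word_linear:
  "der_word ds (x + y) = der_word ds x + der_word ds y"
  "der_word ds (mscale c x) = mscale c (der_word ds x)"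
  by (induction ds) (simp_all add: der_apply_linear)

lemma der_word_append: "der_word (ds @ es) x = der_word ds (der_word es x)"
  by (induction ds) simp_all

lemma free_der_action_simps:
  "free_der_action (Poly_Mapping.single w c) x = mscale c (der_word (letters w) x)"
  "free_der_action (p + q) x = free_der_action p x + free_der_action q x"
  "free_der_action (p - q) x = free_der_action p x - free_der_action q x"
  "free_der_action (fscale c p) x = mscale c (free_der_action p x)"
  "free_der_action 0 x = 0"
  by (simp_all add: free_der_action_def linext_zero linext_single linext_add linext_diff
      linext_fscale module_mscale)

lemma free_der_action_letter: "free_der_action (letter \<delta>) = der_apply \<delta>"
  by (rule ext) (simp add: letter_def free_der_action_simps vec_eq_iff)

lemma free_der_action_one: "free_der_action 1 x = x"
proof -
  have "free_der_action (Poly_Mapping.single 0 1) x = x"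
    by (simp only: free_der_action_simps) (simp add: zero_fmon_def vec_eq_iff)
  then show ?thesis by simp
qed

lemma free_der_action_linear:
  "free_der_action p (x + y) = free_der_action p x + free_der_action p y"
  "free_der_action p (mscale c x) = mscale c (free_der_action p x)"
  by (induction p rule: free_alg_induct)
    (simp_all add: free_der_action_simps der_word_linear vec_eq_iff algebra_simps)

lemma free_der_action_mult:
  "free_der_action (p * q) x = free_der_action p (free_der_action q x)"
proof (induction p rule: free_alg_induct)
  case (single w c)
  show ?case
    by (induction q rule: free_alg_induct)
      (simp_all add: mult_single free_der_action_simps der_word_linear der_word_append plus_fmon_def
        distrib_left vec_eq_iff algebra_simps)
qed (simp add: distrib_right free_der_action_simps)

lemma free_der_action_zero: "free_der_action p 0 = 0"
  using free_der_action_linear(1)[of p 0 0] by simp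

lemma free_der_action_ideal: "p \<in> ideal_gen uea_rels \<Longrightarrow> free_der_action p x = 0"
proof (induction arbitrary: x rule: ideal_gen.induct)
  case (base r)
  then show ?case
    by (auto simp: uea_rels_def free_der_action_simps free_der_action_letter free_der_action_mult
        der_add.rep_eq der_scale.rep_eq der_bracket.rep_eq)
qed (simp_all add: free_der_action_simps free_der_action_mult free_der_action_zero)

instantiation uea :: (field, finite) ring_1
begin
lift_definition zero_uea :: "('a, 'b) uea" is 0 .
lift_definition one_uea :: "('a, 'b) uea" is 1 .
lift_definition plus_uea :: "('a, 'b) uea \<Rightarrow> ('a, 'b) uea \<Rightarrow> ('a, 'b) uea" is "(+)"
  by (rule ideal_gen_add_cong)
lift_definition minus_uea :: "('a, 'b) uea \<Rightarrow> ('a, 'b) uea \<Rightarrow> ('a, 'b) uea" is "(-)"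
  by (rule ideal_gen_diff_cong)
lift_definition uminus_uea :: "('a, 'b) uea \<Rightarrow> ('a, 'b) uea" is uminus
  using ideal_gen_sym by fastforce
lift_definition times_uea :: "('a, 'b) uea \<Rightarrow> ('a, 'b) uea \<Rightarrow> ('a, 'b) uea" is "(*)"
  by (rule ideal_gen_mult_cong)
instance proof
  show "(0::('a, 'b) uea) \<noteq> 1"
  proof
    assume "(0::('a, 'b) uea) = 1"
    then have "(0::(('a, 'b) der, 'a) free_alg) - 1 \<in> ideal_gen uea_rels"
      by transfer
    from free_der_action_ideal[OF ideal_gen_sym[OF this], of "mat 1"] have "mat 1 = (0 :: ('a, 'b) sqmat)"
      by (simp add: free_der_action_simps free_der_action_one)
    then show False
      by (simp add: vec_eq_iff mat_def) (metis zero_neq_one)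
  qed
qed (transfer; simp add: algebra_simps ideal_gen.zero)+
end

lift_definition uea_hom :: "('f::field, 'n::finite) uea \<Rightarrow> ('f, 'n) sqmat \<Rightarrow> ('f, 'n) sqmat"
  is free_der_action
  by (rule ext) (metis eq_iff_diff_eq_0 free_der_action_ideal free_der_action_simps(3))

lift_definition uea_of_der :: "('f::field, 'n::finite) der \<Rightarrow> ('f, 'n) uea" is letter .

lift_definition uea_scale :: "'f::field \<Rightarrow> ('f, 'n::finite) uea \<Rightarrow> ('f, 'n) uea" is fscale
  unfolding fscale_def by (metis ideal_gen.left right_diff_distrib)

text \<open>
  \<open>uea_hom\<close> is the unital algebra homomorphism into the linear endomorphisms that extends the
  tautological action of the derivations.
\<close>

lemma uea_hom_of_der: "uea_hom (uea_of_der \<delta>) = der_apply \<delta>"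
  by transfer (rule free_der_action_letter)

lemma uea_hom_one: "uea_hom 1 = id"
  by transfer (simp add: fun_eq_iff free_der_action_one)

lemma uea_hom_mult: "uea_hom (p * q) = uea_hom p \<circ> uea_hom q"
  by transfer (simp add: fun_eq_iff free_der_action_mult)

lemma uea_hom_add: "uea_hom (p + q) = (\<lambda>x. uea_hom p x + uea_hom q x)"
  by transfer (simp add: fun_eq_iff free_der_action_simps)

lemma uea_hom_scale: "uea_hom (uea_scale c p) = (\<lambda>x. mscale c (uea_hom p x))"
  by transfer (simp add: fun_eq_iff free_der_action_simps)

lemma mlinear_uea_hom: "mlinear (uea_hom p)"
  unfolding mlinear_iff by transfer (simp add: free_der_action_linear)

typedef (overloaded) ('f::field, 'n::finite) uop =
  "range (uea_hom :: ('f, 'n) uea \<Rightarrow> ('f, 'n) sqmat \<Rightarrow> ('f, 'n) sqmat)"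
  morphisms uop_apply Abs_uop
  by blast

setup_lifting type_definition_uop

lift_definition uop_add :: "('f::field, 'n::finite) uop \<Rightarrow> ('f, 'n) uop \<Rightarrow> ('f, 'n) uop"
  is "\<lambda>u v x. u x + v x"
  by (auto simp flip: uea_hom_add)

lift_definition uop_scale :: "'f::field \<Rightarrow> ('f, 'n::finite) uop \<Rightarrow> ('f, 'n) uop"
  is "\<lambda>c u x. mscale c (u x)"
  by (auto simp flip: uea_hom_scale)

lift_definition uop_der_comp :: "('f::field, 'n::finite) der \<Rightarrow> ('f, 'n) uop \<Rightarrow> ('f, 'n) uop"
  is "\<lambda>\<delta> u. der_apply \<delta> \<circ> u"
  by (auto simp flip: uea_hom_mult uea_hom_of_der)

lifting_forget uop.lifting

text \<open>
  The symbol $x_i^u$ is the letter \<open>(i, u)\<close>, with the countably many variables numbered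
  from \<open>0\<close>.  The nonunital free algebra on these symbols is the augmentation ideal of the
  unital one, that is, the elements without constant term; the linearity
  relations have no constant term, so they generate the same ideal in both algebras.
\<close>

definition upoly_rels :: "(nat \<times> ('f::field, 'n::finite) uop, 'f) free_alg set" where
  "upoly_rels =
     {letter (i, uop_add u v) - letter (i, u) - letter (i, v) | i u v. True} \<union>
     {letter (i, uop_scale c u) - fscale c (letter (i, u)) | c i u. True}"

lemma upoly_rels_add: "letter (i, uop_add u v) - letter (i, u) - letter (i, v) \<in> upoly_rels"
  by (auto simp: upoly_rels_def)

lemma upoly_rels_scale: "letter (i, uop_scale c u) - fscale c (letter (i, u)) \<in> upoly_rels"
  unfolding upoly_rels_def by blast

definition upoly_rel :: "(nat \<times> ('f::field, 'n::finite) uop, 'f) free_alg \<Rightarrow>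
    (nat \<times> ('f, 'n) uop, 'f) free_alg \<Rightarrow> bool" where
  "upoly_rel p q \<longleftrightarrow>
     Poly_Mapping.lookup p 0 = 0 \<and> Poly_Mapping.lookup q 0 = 0 \<and> p - q \<in> ideal_gen upoly_rels"

quotient_type (overloaded) ('f, 'n) upoly =
  "(nat \<times> ('f::field, 'n::finite) uop, 'f) free_alg" / partial: upoly_rel
proof (rule part_equivpI)
  show "\<exists>p. upoly_rel p p"
    by (rule exI[of _ 0]) (simp add: upoly_rel_def ideal_gen.zero)
  show "symp upoly_rel"
    by (auto intro!: sympI simp: upoly_rel_def intro: ideal_gen_sym)
  show "transp upoly_rel"
    by (auto intro!: transpI simp: upoly_rel_def intro: ideal_gen_trans)
qed

lemma free_alg_lookup_mult_0:
  "Poly_Mapping.lookup (p * q) 0 = Poly_Mapping.lookup p 0 * Poly_Mapping.lookup q 0"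
  for p q :: "('a, 'f::field) free_alg"
proof (induction p rule: free_alg_induct)
  case (single v c)
  show ?case
    by (induction q rule: free_alg_induct)
      (cases v; auto simp: mult_single lookup_single when_def plus_fmon_def zero_fmon_def
        distrib_left lookup_add split: fmon.splits; (metis fmon.collapse fmon.sel)?)+
qed (simp add: distrib_right lookup_add)

instantiation upoly :: (field, finite) ring
begin
lift_definition zero_upoly :: "('a, 'b) upoly" is 0
  by (simp add: upoly_rel_def ideal_gen.zero)
lift_definition plus_upoly :: "('a, 'b) upoly \<Rightarrow> ('a, 'b) upoly \<Rightarrow> ('a, 'b) upoly" is "(+)"
  using ideal_gen_add_cong by (auto simp: upoly_rel_def lookup_add)
lift_definition minus_upoly :: "('a, 'b) upoly \<Rightarrow> ('a, 'b) upoly \<Rightarrow> ('a, 'b) upoly" is "(-)"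
  using ideal_gen_diff_cong by (auto simp: upoly_rel_def lookup_minus)
lift_definition uminus_upoly :: "('a, 'b) upoly \<Rightarrow> ('a, 'b) upoly" is uminus
  using ideal_gen_sym by (fastforce simp: upoly_rel_def)
lift_definition times_upoly :: "('a, 'b) upoly \<Rightarrow> ('a, 'b) upoly \<Rightarrow> ('a, 'b) upoly" is "(*)"
  using ideal_gen_mult_cong by (auto simp: upoly_rel_def free_alg_lookup_mult_0)
instance
  by standard (transfer; auto simp: upoly_rel_def algebra_simps ideal_gen.zero lookup_add
      lookup_minus free_alg_lookup_mult_0)+
end

lift_definition upoly_scale :: "'f::field \<Rightarrow> ('f, 'n::finite) upoly \<Rightarrow> ('f, 'n) upoly" is fscale
  unfolding fscale_def upoly_rel_def
  by (auto simp: free_alg_lookup_mult_0 right_diff_distrib[symmetric] intro: ideal_gen.left)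

lemma fscale_module_laws:
  "fscale a (p + q) = fscale a p + fscale a q"
  "fscale (a + b) p = fscale a p + fscale b p"
  "fscale a (fscale b p) = fscale (a * b) p"
  "fscale 1 p = p"
  using module_fscale[unfolded module_def] by blast+

lemma lookup_fscale_0: "Poly_Mapping.lookup (fscale c p) 0 = c * Poly_Mapping.lookup p 0"
  by (simp add: fscale_def free_alg_lookup_mult_0)

lemma module_upoly_scale: "module (upoly_scale :: 'f::field \<Rightarrow> ('f, 'n::finite) upoly \<Rightarrow> _)"
  by (standard; transfer)
    (auto simp: upoly_rel_def fscale_module_laws lookup_fscale_0 lookup_add ideal_gen.zero)

lift_definition xvar :: "nat \<Rightarrow> ('f::field, 'n::finite) uop \<Rightarrow> ('f, 'n) upoly" is
  "\<lambda>i u. letter (i, u)"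
  by (simp add: upoly_rel_def letter_def zero_fmon_def lookup_single ideal_gen.zero)

lemma lookup_letter_0: "Poly_Mapping.lookup (letter a) 0 = 0"
  by (simp add: letter_def zero_fmon_def lookup_single)

lemma xvar_add: "xvar i (uop_add u v) = xvar i u + xvar i v"
  by transfer (simp add: upoly_rel_def lookup_letter_0 lookup_add diff_diff_add[symmetric]
      ideal_gen.base upoly_rels_add)

lemma xvar_scale: "xvar i (uop_scale c u) = upoly_scale c (xvar i u)"
  by transfer (simp add: upoly_rel_def lookup_letter_0 lookup_fscale_0 ideal_gen.base
      upoly_rels_scale)

fun lact_word :: "('f::field, 'n::finite) der \<Rightarrow> (nat \<times> ('f, 'n) uop) list \<Rightarrow>
    (nat \<times> ('f, 'n) uop, 'f) free_alg" where
  "lact_word \<delta> [] = 0"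
| "lact_word \<delta> ((i, u) # w) =
     letter (i, uop_der_comp \<delta> u) * Poly_Mapping.single (Word w) 1 + letter (i, u) * lact_word \<delta> w"

definition free_lact :: "('f::field, 'n::finite) der \<Rightarrow> (nat \<times> ('f, 'n) uop, 'f) free_alg \<Rightarrow>
    (nat \<times> ('f, 'n) uop, 'f) free_alg" where
  "free_lact \<delta> = linext fscale (\<lambda>w. lact_word \<delta> (letters w))"

lemma free_lact_simps:
  "free_lact \<delta> (Poly_Mapping.single w c) = fscale c (lact_word \<delta> (letters w))"
  "free_lact \<delta> (p + q) = free_lact \<delta> p + free_lact \<delta> q"
  "free_lact \<delta> (p - q) = free_lact \<delta> p - free_lact \<delta> q"
  "free_lact \<delta> (fscale c p) = fscale c (free_lact \<delta> p)"
  "free_lact \<delta> 0 = 0"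
  by (simp_all add: free_lact_def linext_zero linext_single linext_add linext_diff
      linext_fscale module_fscale)

lemma free_lact_letter: "free_lact \<delta> (letter (i, u)) = letter (i, uop_der_comp \<delta> u)"
  by (simp add: letter_def free_lact_simps fscale_module_laws mult_single plus_fmon_def)

lemma lact_word_append:
  "lact_word \<delta> (v @ w) =
     lact_word \<delta> v * Poly_Mapping.single (Word w) 1 + Poly_Mapping.single (Word v) 1 * lact_word \<delta> w"
  by (induction \<delta> v rule: lact_word.induct)
    (simp_all add: letter_def zero_fmon_def[symmetric] distrib_left distrib_right mult_single
      plus_fmon_def mult.assoc[symmetric] add.assoc[symmetric])

lemma single_eq_fscale: "Poly_Mapping.single w c = fscale c (Poly_Mapping.single w 1)"
  by (simp add: fscale_def mult_single)

lemma free_lact_mult: "free_lact \<delta> (p * q) = free_lact \<delta> p * q + p * free_lact \<delta> q"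
proof (induction p rule: free_alg_induct)
  case (single v c)
  show ?case
  proof (induction q rule: free_alg_induct)
    case (single w d)
    have *: "free_lact \<delta> (Poly_Mapping.single v 1 * Poly_Mapping.single w 1) =
        free_lact \<delta> (Poly_Mapping.single v 1) * Poly_Mapping.single w 1 +
        Poly_Mapping.single v 1 * free_lact \<delta> (Poly_Mapping.single w 1)"
      by (simp add: mult_single free_lact_simps(1) plus_fmon_def lact_word_append
          fscale_module_laws(4))
    show ?case
      using * by (simp only: single_eq_fscale[of v c] single_eq_fscale[of w d] fscale_mult_left
          fscale_mult_right free_lact_simps(4) fscale_module_laws(1)[symmetric])
  qed (simp add: algebra_simps free_lact_simps)
qed (simp add: algebra_simps free_lact_simps)

lemma uop_der_comp_linear:
  "uop_der_comp \<delta> (uop_add u v) = uop_add (uop_der_comp \<delta> u) (uop_der_comp \<delta> v)"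
  "uop_der_comp \<delta> (uop_scale c u) = uop_scale c (uop_der_comp \<delta> u)"
  by (simp_all add: uop_apply_inject[symmetric] uop_der_comp.rep_eq uop_add.rep_eq
      uop_scale.rep_eq der_apply_linear fun_eq_iff)

lemma free_lact_rels:
  assumes "r \<in> upoly_rels"
  shows "free_lact \<delta> r \<in> upoly_rels"
proof -
  consider (add) i u v where "r = letter (i, uop_add u v) - letter (i, u) - letter (i, v)"
    | (scale) i c u where "r = letter (i, uop_scale c u) - fscale c (letter (i, u))"
    using assms by (auto simp: upoly_rels_def)
  then show ?thesis
  proof cases
    case add
    then show ?thesis
      by (simp add: free_lact_simps free_lact_letter uop_der_comp_linear upoly_rels_add)
  next
    case scale
    then show ?thesis
      by (simp add: free_lact_simps free_lact_letter uop_der_comp_linear upoly_rels_scale)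
  qed
qed

lemma free_lact_ideal: "p \<in> ideal_gen upoly_rels \<Longrightarrow> free_lact \<delta> p \<in> ideal_gen upoly_rels"
  by (induction rule: ideal_gen.induct)
    (auto simp: free_lact_simps free_lact_mult intro: ideal_gen.intros free_lact_rels)

lemma lookup_free_lact_0: "Poly_Mapping.lookup (free_lact \<delta> p) 0 = 0"
proof (induction p rule: free_alg_induct)
  case (single w c)
  have "Poly_Mapping.lookup (lact_word \<delta> v) 0 = 0" for v
    by (induction \<delta> v rule: lact_word.induct)
      (simp_all add: lookup_add free_alg_lookup_mult_0 lookup_letter_0)
  then show ?case
    by (simp add: free_lact_simps lookup_fscale_0)
qed (simp add: free_lact_simps lookup_add)

lift_definition lact :: "('f::field, 'n::finite) der \<Rightarrow> ('f, 'n) upoly \<Rightarrow> ('f, 'n) upoly" is free_lact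
  by (auto simp: upoly_rel_def lookup_free_lact_0 free_lact_simps(3)[symmetric] free_lact_ideal)

lemma upoly_rel_refl: "Poly_Mapping.lookup p 0 = 0 \<Longrightarrow> upoly_rel p p"
  by (simp add: upoly_rel_def ideal_gen.zero)

lemma lact_xvar: "lact \<delta> (xvar i u) = xvar i (uop_der_comp \<delta> u)"
  by transfer (simp add: free_lact_letter upoly_rel_refl lookup_letter_0)

lemma lact_mult: "lact \<delta> (f * h) = lact \<delta> f * h + f * lact \<delta> h"
  by transfer (auto simp: free_lact_mult upoly_rel_def ideal_gen.zero lookup_add
      free_alg_lookup_mult_0 lookup_free_lact_0)

lemma lact_linear:
  "lact \<delta> (f + h) = lact \<delta> f + lact \<delta> h"
  "lact \<delta> (upoly_scale c f) = upoly_scale c (lact \<delta> f)"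
  by (transfer; auto simp: free_lact_simps upoly_rel_def ideal_gen.zero lookup_add
      lookup_fscale_0 lookup_free_lact_0)+

fun eval_word :: "(nat \<Rightarrow> ('f::field, 'n::finite) sqmat) \<Rightarrow> (nat \<times> ('f, 'n) uop) list \<Rightarrow>
    ('f, 'n) sqmat" where
  "eval_word m [] = mat 1"
| "eval_word m ((i, u) # w) = uop_apply u (m i) ** eval_word m w"

definition free_eval :: "(nat \<Rightarrow> ('f::field, 'n::finite) sqmat) \<Rightarrow>
    (nat \<times> ('f, 'n) uop, 'f) free_alg \<Rightarrow> ('f, 'n) sqmat" where
  "free_eval m = linext mscale (\<lambda>w. eval_word m (letters w))"

lemma free_eval_simps:
  "free_eval m (Poly_Mapping.single w c) = mscale c (eval_word m (letters w))"
  "free_eval m (p + q) = free_eval m p + free_eval m q"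
  "free_eval m (p - q) = free_eval m p - free_eval m q"
  "free_eval m (fscale c p) = mscale c (free_eval m p)"
  "free_eval m 0 = 0"
  by (simp_all add: free_eval_def linext_zero linext_single linext_add linext_diff
      linext_fscale module_mscale)

lemma free_eval_letter: "free_eval m (letter (i, u)) = uop_apply u (m i)"
  by (simp add: letter_def free_eval_simps vec_eq_iff)

lemma eval_word_append: "eval_word m (v @ w) = eval_word m v ** eval_word m w"
  by (induction m v rule: eval_word.induct) (simp_all add: matrix_mul_assoc)

lemma matrix_mult_distrib:
  fixes A B C :: "('f::field, 'n::finite) sqmat"
  shows "(A + B) ** C = A ** C + B ** C" "A ** (B + C) = A ** B + A ** C"
    "0 ** A = 0" "A ** 0 = 0"
  by (simp_all add: vec_eq_iff matrix_matrix_mult_def algebra_simps sum.distrib)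

lemma free_eval_mult: "free_eval m (p * q) = free_eval m p ** free_eval m q"
proof (induction p rule: free_alg_induct)
  case (single v c)
  show ?case
  proof (induction q rule: free_alg_induct)
    case (single w d)
    show ?case
      by (simp add: mult_single free_eval_simps plus_fmon_def eval_word_append mscale_mult_left
          mscale_mult_right) (simp add: vec_eq_iff mult.assoc)
  qed (simp add: free_eval_simps distrib_left matrix_mult_distrib)
qed (simp add: free_eval_simps distrib_right matrix_mult_distrib)

lemma free_eval_ideal: "p \<in> ideal_gen upoly_rels \<Longrightarrow> free_eval m p = 0"
proof (induction rule: ideal_gen.induct)
  case (base r)
  then show ?case
    by (auto simp: upoly_rels_def free_eval_simps free_eval_letter uop_add.rep_eq uop_scale.rep_eq)
qed (simp_all add: free_eval_simps free_eval_mult matrix_mult_distrib)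

lift_definition ueval :: "(nat \<Rightarrow> ('f::field, 'n::finite) sqmat) \<Rightarrow> ('f, 'n) upoly \<Rightarrow> ('f, 'n) sqmat"
  is free_eval
  by (metis eq_iff_diff_eq_0 free_eval_ideal free_eval_simps(3) upoly_rel_def)

lemma ueval_xvar: "ueval m (xvar i u) = uop_apply u (m i)"
  by transfer (rule free_eval_letter)

lemma ueval_mult: "ueval m (f * h) = ueval m f ** ueval m h"
  by transfer (rule free_eval_mult)

lemma ueval_linear:
  "ueval m (f + h) = ueval m f + ueval m h"
  "ueval m (upoly_scale c f) = mscale c (ueval m f)"
  by (transfer; simp add: free_eval_simps)+

definition U_identities :: "('f::field, 'n::finite) upoly set" where
  "U_identities = {f. \<forall>m. ueval m f = 0}"

definition upoly_endomorphism :: "(('f::field, 'n::finite) upoly \<Rightarrow> ('f, 'n) upoly) \<Rightarrow> bool" where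
  "upoly_endomorphism \<psi> \<longleftrightarrow>
     module_hom upoly_scale upoly_scale \<psi> \<and> (\<forall>f h. \<psi> (f * h) = \<psi> f * \<psi> h)"

definition TU_ideal :: "('f::field, 'n::finite) upoly set \<Rightarrow> bool" where
  "TU_ideal I \<longleftrightarrow>
     module.subspace upoly_scale I \<and>
     (\<forall>f\<in>I. \<forall>h. f * h \<in> I \<and> h * f \<in> I) \<and>
     (\<forall>\<delta>. lact \<delta> ` I \<subseteq> I) \<and>
     (\<forall>\<psi>. upoly_endomorphism \<psi> \<and> (\<forall>\<delta> f. \<psi> (lact \<delta> f) = lact \<delta> (\<psi> f)) \<longrightarrow> \<psi> ` I \<subseteq> I)"

text \<open>
  The bijection \<open>\<iota>\<close> from \<open>{1..k}\<close> numbers the rows and columns.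
\<close>

definition munit :: "(nat \<Rightarrow> 'n) \<Rightarrow> nat \<Rightarrow> nat \<Rightarrow> ('f::field, 'n::finite) sqmat" where
  "munit \<iota> i j = axis (\<iota> i) (axis (\<iota> j) 1)"

definition sl_basis :: "(nat \<Rightarrow> 'n) \<Rightarrow> ('f::field, 'n::finite) sqmat set" where
  "sl_basis \<iota> =
     {munit \<iota> i j | i j. i \<in> {1..CARD('n)} \<and> j \<in> {1..CARD('n)} \<and> i \<noteq> j} \<union>
     {munit \<iota> i i - munit \<iota> (i + 1) (i + 1) | i. 1 \<le> i \<and> i < CARD('n)}"

definition gl_basis :: "(nat \<Rightarrow> 'n) \<Rightarrow> ('f::field, 'n::finite) sqmat set" where
  "gl_basis \<iota> = insert (mat 1) (sl_basis \<iota>)"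

definition basis_map :: "(nat \<Rightarrow> 'n) \<Rightarrow> ('f::field, 'n::finite) sqmat \<Rightarrow> ('f, 'n) sqmat \<Rightarrow>
    ('f, 'n) sqmat \<Rightarrow> ('f, 'n) sqmat" where
  "basis_map \<iota> a b =
     (THE u. mlinear u \<and> u a = b \<and> (\<forall>c\<in>gl_basis \<iota> - {a}. u c = 0))"

text \<open>
  \<open>Abs_uop\<close> is applied below only to maps \<open>basis_map \<iota> a b\<close> with \<open>a\<close> and \<open>b\<close> both in
  \<open>sl_basis \<iota>\<close> or both equal to \<open>mat 1\<close>, which belong to \<open>U\<close>.
\<close>

definition xbasis :: "(nat \<Rightarrow> 'n) \<Rightarrow> nat \<Rightarrow> ('f::field, 'n::finite) sqmat \<Rightarrow> ('f, 'n) sqmat \<Rightarrow>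
    ('f, 'n) upoly" where
  "xbasis \<iota> i a b = xvar i (Abs_uop (basis_map \<iota> a b))"

definition commutator :: "('f::field, 'n::finite) upoly \<Rightarrow> ('f, 'n) upoly \<Rightarrow> ('f, 'n) upoly" where
  "commutator f h = f * h - h * f"

end

theory Submission
  imports Defs
begin

text \<open>
  That the four generators are identities is a computation.  Conversely, let \<open>I\<close> be a \<open>T_U\<close>-ideal
  that contains them; every identity has to be found in \<open>I\<close>.

  Letters.  The algebra \<open>U\<close> consists of maps that preserve both the traceless matrices \<open>sl\<close> and the
  scalar matrices.  It contains all maps \<open>m \<mapsto> tr(m w) b\<close> with \<open>w, b \<in> sl\<close> (\<open>rank_one_in_Uset\<close>), because
  the square of \<open>ad e\<close> for an off-diagonal matrix unit \<open>e\<close> is such a map and \<open>sl\<close> is generated by \<open>e\<close>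
  under brackets; it therefore also contains the projection to the scalar matrices.  So all symbols
  are combinations of letters \<open>xsl i w b\<close> (the symbol of \<open>x_i\<close> for \<open>m \<mapsto> tr(m w) b\<close>) and
  \<open>xscalar i\<close> (the symbol \<open>x_i^{gg}\<close>).  The substitutions \<open>x_i \<mapsto> x_j^v\<close> replace \<open>w\<close> by any other
  traceless matrix, whereas the Lie algebra acts on \<open>b\<close> only.

  Products of two letters.  For fixed \<open>i, w, j, w'\<close>, the map \<open>b \<otimes> d \<mapsto> xsl i w b * xsl j w' d\<close> modulo \<open>I\<close>
  vanishes on the Lie submodule of \<open>sl \<otimes> sl\<close> generated by \<open>e_12 \<otimes> e_12\<close> (\<open>k = 2\<close>) or
  \<open>e_12 \<otimes> e_31\<close> (\<open>k \<ge> 3\<close>), by the first generator.  This submodule is the whole kernel of the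
  matrix multiplication, so the product of the two letters depends on \<open>b d\<close> only (\<open>product_factors\<close>).  Given this, the second
  generator says that the pairs \<open>(i, w)\<close> and \<open>(j, w')\<close> may be exchanged (\<open>swap_slots\<close>).  By the two
  commutators the letters \<open>xscalar i\<close> commute with all letters.

  Longer products.  Associativity propagates this to products of more than two letters: modulo \<open>I\<close>
  they depend only on the multiset of the pairs \<open>(i, w)\<close> and on the product of the matrices \<open>b\<close>.  The
  point is that a matrix unit is a product of traceless matrices in several ways, and comparing these
  gives enough relations (\<open>associative_factor\<close>, \<open>xsl_slword\<close>).

  Conclusion.  Let \<open>w\<close> run through a basis of \<open>sl\<close>.  Modulo \<open>I\<close>, the component of a polynomial with
  a given multiset of pairs \<open>(i, w)\<close> and of scalar letters is determined by one matrix \<open>b\<close>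
  (\<open>homog_nf\<close>), and its value under an evaluation is \<open>b\<close> times the corresponding monomial in the
  coordinates of the matrices substituted for the \<open>x_i\<close>.  Distinct monomials are linearly independent
  functions over an infinite field (\<open>monomials_independent\<close>).  Hence an identity has \<open>b = 0\<close> in all
  its components, and these lie in \<open>I\<close>.
\<close>

section \<open>Matrix units and traceless matrices\<close>

definition E :: "'n::finite \<Rightarrow> 'n \<Rightarrow> ('f::field, 'n) sqmat" where
  "E p q = axis p (axis q 1)"

definition bracket :: "('f::field, 'n::finite) sqmat \<Rightarrow> ('f, 'n) sqmat \<Rightarrow> ('f, 'n) sqmat" where
  "bracket c m = c ** m - m ** c"

lemma E_nth: "E p q $ r $ s = (if r = p \<and> s = q then 1 else 0)"
  by (auto simp: E_def axis_def)

lemma mult_nth: "(A ** B) $ p $ q = (\<Sum>r\<in>UNIV. A $ p $ r * B $ r $ q)"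
  by (simp add: matrix_matrix_mult_def)

lemma E_mult_nth: "(E p q ** A) $ r $ s = (if r = p then A $ q $ s else 0)"
  by (cases "r = p")
    (simp_all add: mult_nth E_nth if_distribR sum.delta if_distrib[of "\<lambda>x. x * _"] cong: if_cong)

lemma mult_E_nth: "(A ** E p q) $ r $ s = (if s = q then A $ r $ p else 0)"
  by (cases "s = q") (simp_all add: mult_nth E_nth if_distrib[of "\<lambda>x. _ * x"] sum.delta cong: if_cong)

lemma E_mult_E: "E p q ** E r s = (if q = r then E p s else 0)"
  by (auto simp: vec_eq_iff E_mult_nth E_nth)

lemma bracket_E: "bracket (E a b) (E p q) = (if b = p then E a q else 0) - (if q = a then E p b else 0)"
  by (simp add: bracket_def E_mult_E)

interpretation mvs: vector_space "mscale :: 'f::field \<Rightarrow> ('f, 'n::finite) sqmat \<Rightarrow> _"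
  by (rule vector_space_mscale)

lemmas mscale_simps = mvs.scale_zero_left mvs.scale_one mvs.scale_zero_right mvs.scale_scale

lemmas mscale_distrib = mvs.scale_right_distrib mvs.scale_right_diff_distrib
  mvs.scale_left_distrib mvs.scale_left_diff_distrib

lemma matrix_diff_distrib:
  fixes A B C :: "('f::field, 'n::finite) sqmat"
  shows "(A - B) ** C = A ** C - B ** C" "A ** (B - C) = A ** B - A ** C"
  by (simp_all add: vec_eq_iff mult_nth algebra_simps sum_subtractf)

lemma bracket_linear:
  "bracket c (x + y) = bracket c x + bracket c y" "bracket c (x - y) = bracket c x - bracket c y"
  "bracket c (mscale t x) = mscale t (bracket c x)" "bracket c 0 = 0"
  by (simp_all add: bracket_def matrix_mult_distrib matrix_diff_distrib mscale_mult_left mscale_mult_right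
      mscale_distrib)

lemma bracket_mult: "bracket c (x ** y) = bracket c x ** y + x ** bracket c y"
  by (simp add: bracket_def matrix_mult_distrib matrix_diff_distrib matrix_mul_assoc)

lemma trace_simps:
  "trace (A + B) = trace A + trace B" "trace (A - B) = trace A - trace B"
  "trace (mscale c A) = c * trace A" "trace (0::('f::field, 'n::finite) sqmat) = 0"
  by (simp_all add: trace_def sum.distrib sum_subtractf sum_distrib_left)

lemma trace_E: "trace (E p q) = (if p = q then 1 else 0)"
  by (cases "p = q") (auto simp: trace_def E_nth intro!: sum.neutral)

lemma trace_mult_E: "trace (A ** E p q) = A $ q $ p"
  by (simp add: trace_def mult_E_nth)

text \<open>
  The trace form is invariant, so the adjoint of a bracket is a bracket up to sign.
\<close>

lemma trace_bracket: "trace (bracket c m ** w) = trace (m ** bracket w c)"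
proof -
  have "trace (c ** m ** w) = trace (m ** w ** c)"
    by (metis matrix_mul_assoc trace_mul_sym)
  then show ?thesis
    by (simp add: bracket_def matrix_diff_distrib trace_simps matrix_mul_assoc)
qed

lemma trace_bracket_0: "trace (bracket c m) = 0"
  using trace_mul_sym[of c m] by (simp add: bracket_def trace_simps)

lemma matrix_expand:
  fixes A :: "('f::field, 'n::finite) sqmat"
  shows "A = (\<Sum>(p, q)\<in>UNIV. mscale (A $ p $ q) (E p q))"
proof -
  have "(\<Sum>(p, q)\<in>UNIV. mscale (A $ p $ q) (E p q)) $ r $ s = A $ r $ s" for r s
  proof -
    have "(\<Sum>(p, q)\<in>UNIV. mscale (A $ p $ q) (E p q)) $ r $ s
        = (\<Sum>x\<in>UNIV. if x = (r, s) then A $ r $ s else 0)"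
      unfolding sum_component by (rule sum.cong) (auto simp: E_nth split: if_splits)
    then show ?thesis by simp
  qed
  then show ?thesis by (simp add: vec_eq_iff)
qed

lemma matrix_induct:
  fixes A :: "('f::field, 'n::finite) sqmat"
  assumes "mvs.subspace S" "\<And>p q. E p q \<in> S"
  shows "A \<in> S"
proof -
  have "(\<Sum>(p, q)\<in>UNIV. mscale (A $ p $ q) (E p q)) \<in> S"
    by (rule mvs.subspace_sum[OF assms(1)]) (use assms in \<open>auto simp: mvs.subspace_def\<close>)
  then show ?thesis by (simp flip: matrix_expand)
qed

definition sl :: "('f::field, 'n::finite) sqmat set" where
  "sl = {A. trace A = 0}"

text \<open>
  The matrices \<open>sl_vec w s\<close> for \<open>s \<noteq> (w, w)\<close> form a basis of \<open>sl\<close>, for any fixed index \<open>w\<close>.  It has the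
  advantage that the coordinates of a traceless matrix are its entries other than the one at \<open>(w, w)\<close>.
\<close>

definition sl_vec :: "'n \<Rightarrow> 'n \<times> 'n \<Rightarrow> ('f::field, 'n::finite) sqmat" where
  "sl_vec w s = (if fst s = snd s then E (fst s) (fst s) - E w w else E (fst s) (snd s))"

text \<open>
  Replacing \<open>E p p\<close> by \<open>E p p - E w w\<close> in the expansion of \<open>A\<close> in matrix units costs \<open>tr A\<close> times
  \<open>E w w\<close>.
\<close>

lemma sl_expand:
  fixes A :: "('f::field, 'n::finite) sqmat"
  assumes A: "A \<in> sl"
  shows "A = (\<Sum>s\<in>UNIV - {(w, w)}. mscale (A $ fst s $ snd s) (sl_vec w s))"
proof -
  have "(\<Sum>s\<in>UNIV - {(w, w)}. mscale (A $ fst s $ snd s) (sl_vec w s))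
      = (\<Sum>s\<in>UNIV. mscale (A $ fst s $ snd s) (sl_vec w s))"
    by (rule sum.mono_neutral_left) (auto simp: sl_vec_def)
  also have "\<dots> = A - (\<Sum>(p, q)\<in>UNIV. if p = q then mscale (A $ p $ p) (E w w) else 0)"
  proof -
    have "mscale (A $ fst s $ snd s) (sl_vec w s) = mscale (A $ fst s $ snd s) (E (fst s) (snd s))
        - (if fst s = snd s then mscale (A $ fst s $ fst s) (E w w) else 0)" for s
      by (simp add: sl_vec_def mscale_distrib)
    then show ?thesis
      by (simp add: case_prod_unfold sum_subtractf
          matrix_expand[unfolded case_prod_unfold, of A, symmetric])
  qed
  also have "(\<Sum>(p, q)\<in>UNIV. if p = q then mscale (A $ p $ p) (E w w) else 0)
      = (\<Sum>p\<in>UNIV. \<Sum>q\<in>UNIV. if p = q then mscale (A $ p $ p) (E w w) else 0)"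
    by (simp only: sum.cartesian_product UNIV_Times_UNIV)
  also have "\<dots> = (\<Sum>p\<in>UNIV. mscale (A $ p $ p) (E w w))"
    by simp
  also have "\<dots> = mscale (trace A) (E w w)"
    by (simp add: vec_eq_iff trace_def sum_distrib_right)
  finally show ?thesis using A by (simp add: sl_def)
qed

lemma sl_induct:
  fixes A :: "('f::field, 'n::finite) sqmat"
  assumes S: "mvs.subspace S" and E: "\<And>p q. p \<noteq> q \<Longrightarrow> E p q \<in> S"
    and H: "\<And>p q. p \<noteq> q \<Longrightarrow> E p p - E q q \<in> S" and A: "A \<in> sl"
  shows "A \<in> S"
proof -
  fix w :: 'n
  have "(\<Sum>s\<in>UNIV - {(w, w)}. mscale (A $ fst s $ snd s) (sl_vec w s)) \<in> S"
  proof (rule mvs.subspace_sum[OF S])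
    fix s :: "'n \<times> 'n" assume s: "s \<in> UNIV - {(w, w)}"
    then have "sl_vec w s \<in> S" using E H by (cases s) (auto simp: sl_vec_def)
    then show "mscale (A $ fst s $ snd s) (sl_vec w s) \<in> S" using S by (simp add: mvs.subspace_def)
  qed
  then show ?thesis using sl_expand[OF A, of w] by simp
qed

lemma subspace_sl: "mvs.subspace sl"
  by (simp add: mvs.subspace_def sl_def trace_simps)

lemma E_in_sl: "p \<noteq> q \<Longrightarrow> E p q \<in> sl" "E p p - E q q \<in> sl"
  by (simp_all add: sl_def trace_E trace_simps)

lemma bracket_in_sl: "bracket c m \<in> sl"
  by (simp add: sl_def trace_bracket_0)

lemma subspace_descale:
  assumes "mvs.subspace S" "mscale c a \<in> S" "c \<noteq> 0" shows "a \<in> S"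
proof -
  have "mscale (inverse c) (mscale c a) \<in> S"
    using assms(1,2) unfolding mvs.subspace_def by blast
  then show ?thesis using assms by simp
qed

text \<open>
  Brackets with matrix units move each of the two indices of \<open>E a b\<close> separately, as long as the result
  remains off the diagonal.  For \<open>k = 2\<close> this never gets from \<open>E a b\<close> to \<open>E b a\<close>, but the double
  bracket with \<open>E b a\<close> does.
\<close>

lemma sl_generated:
  fixes S :: "('f::field_char_0, 'n::finite) sqmat set"
  assumes S: "mvs.subspace S" and bracket: "\<And>c m. m \<in> S \<Longrightarrow> bracket c m \<in> S"
    and E: "E a b \<in> S" "a \<noteq> b"
  shows "sl \<subseteq> S"
proof -
  have row: "E r q \<in> S" if "E p q \<in> S" "r \<noteq> q" for p q r
    using bracket[OF that(1), of "E r p"] that by (simp add: bracket_E)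
  have col: "E p s \<in> S" if "E p q \<in> S" "p \<noteq> s" for p q s
  proof -
    have eq: "bracket (E q s) (E p q :: ('f, 'n) sqmat) = mscale (-1) (E p s)"
      using that by (simp add: bracket_E)
    have "mscale (-1) (E p s) \<in> S"
      using bracket[OF that(1), of "E q s"] by (simp only: eq)
    then show ?thesis
      by (rule subspace_descale[OF S]) simp
  qed
  have swap: "E b a \<in> S"
  proof -
    have "bracket (E b a) (bracket (E b a) (E a b :: ('f, 'n) sqmat)) = - E b a - E b a"
      using E(2) by (simp add: bracket_E bracket_linear)
    also have "\<dots> = mscale (-2) (E b a)" by (simp add: vec_eq_iff)
    finally have "mscale (-2) (E b a) \<in> S"
      using bracket[OF bracket[OF E(1)], of "E b a" "E b a"] by simp
    then show ?thesis
      by (rule subspace_descale[OF S]) simp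
  qed
  have off: "E p q \<in> S" if "p \<noteq> q" for p q
  proof (cases "p = b")
    case True
    then show ?thesis using col[OF swap, of q] that by blast
  next
    case False
    then show ?thesis using col[OF row[OF E(1), of p], of q] that by blast
  qed
  have "E p p - E q q \<in> S" if "p \<noteq> q" for p q
    using bracket[OF off[of q p], of "E p q"] that by (simp add: bracket_E)
  then show ?thesis
    using sl_induct[OF S off] by blast
qed

section \<open>The algebra U\<close>

definition Uset :: "(('f::field, 'n::finite) sqmat \<Rightarrow> ('f, 'n) sqmat) set" where
  "Uset = range uea_hom"

lemma derivation_bracket: "mat_derivation (bracket c)"
  by (simp add: mat_derivation_def mlinear_iff bracket_linear bracket_mult)

definition ad_der :: "('f::field, 'n::finite) sqmat \<Rightarrow> ('f, 'n) der" where
  "ad_der c = Abs_der (bracket c)"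

lemma der_apply_ad: "der_apply (ad_der c) = bracket c"
  by (simp add: ad_der_def Abs_der_inverse derivation_bracket)

lemma Uset_closed:
  "id \<in> Uset" "der_apply \<delta> \<in> Uset"
  "\<phi> \<in> Uset \<Longrightarrow> \<psi> \<in> Uset \<Longrightarrow> \<phi> \<circ> \<psi> \<in> Uset"
  "\<phi> \<in> Uset \<Longrightarrow> \<psi> \<in> Uset \<Longrightarrow> (\<lambda>m. \<phi> m + \<psi> m) \<in> Uset"
  "\<phi> \<in> Uset \<Longrightarrow> (\<lambda>m. mscale c (\<phi> m)) \<in> Uset"
  unfolding Uset_def
  by (metis uea_hom_one rangeI, metis uea_hom_of_der rangeI,
      auto simp flip: uea_hom_mult uea_hom_add uea_hom_scale)

lemma Uset_bracket: "bracket c \<in> Uset"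
  using Uset_closed(2)[of "ad_der c"] by (simp add: der_apply_ad)

lemma Uset_zero: "(\<lambda>m. 0) \<in> Uset"
  using Uset_closed(5)[OF Uset_closed(1), of 0] by simp

lemma Uset_sum: "(\<And>x. x \<in> A \<Longrightarrow> \<phi> x \<in> Uset) \<Longrightarrow> (\<lambda>m. \<Sum>x\<in>A. \<phi> x m) \<in> Uset"
  by (induction A rule: infinite_finite_induct) (auto simp: Uset_zero intro: Uset_closed)

lemma Uset_linear:
  assumes "\<phi> \<in> Uset"
  shows "\<phi> (a + b) = \<phi> a + \<phi> b" "\<phi> (mscale c a) = mscale c (\<phi> a)"
  using assms mlinear_uea_hom unfolding Uset_def mlinear_iff by blast+

lemma Uset_sum_arg: "\<phi> \<in> Uset \<Longrightarrow> \<phi> (\<Sum>x\<in>A. f x) = (\<Sum>x\<in>A. \<phi> (f x))"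
  using Uset_linear(2)[of \<phi> 0 0]
  by (induction A rule: infinite_finite_induct) (auto simp: Uset_linear)

lemma derivation_one: "mat_derivation D \<Longrightarrow> D (mat 1) = 0"
proof -
  assume "mat_derivation D"
  then have "D (mat 1) = D (mat 1) + D (mat 1)"
    unfolding mat_derivation_def by (metis matrix_mul_lid matrix_mul_rid)
  then show ?thesis by simp
qed

text \<open>
  Off-diagonal matrix units and the differences \<open>E p p - E q q\<close> are brackets, and a derivation maps a
  bracket to a sum of two brackets.
\<close>

lemma derivation_sl:
  fixes D :: "('f::field, 'n::finite) sqmat \<Rightarrow> ('f, 'n) sqmat"
  assumes D: "mat_derivation D" and A: "A \<in> sl"
  shows "D A \<in> sl"
proof -
  have lin: "D (a + b) = D a + D b" "D (mscale c a) = mscale c (D a)" for a b c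
    using D by (auto simp: mat_derivation_def mlinear_iff)
  have sub: "D (a - b) = D a - D b" for a b
    using lin(1)[of "a - b" b] by simp
  have bracket: "D (bracket a b) \<in> sl" for a b
  proof -
    have "D (bracket a b) = bracket (D a) b + bracket a (D b)"
      using D by (simp add: bracket_def sub mat_derivation_def)
    then show ?thesis using subspace_sl bracket_in_sl by (metis mvs.subspace_def)
  qed
  have "A \<in> {A. D A \<in> sl}"
  proof (rule sl_induct[OF _ _ _ A])
    have "D 0 = 0" using lin(2)[of 0 0] by simp
    then show "mvs.subspace {A. D A \<in> sl}"
      using subspace_sl by (auto simp: mvs.subspace_def lin)
    show "E p q \<in> {A. D A \<in> sl}" if "p \<noteq> q" for p q
      using bracket[of "E p p" "E p q"] that by (simp add: bracket_E)
    show "E p p - E q q \<in> {A. D A \<in> sl}" if "p \<noteq> q" for p q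
      using bracket[of "E p q" "E q p"] that by (simp add: bracket_E)
  qed
  then show ?thesis by simp
qed

lemma der_word_sl: "A \<in> sl \<Longrightarrow> der_word ds A \<in> sl"
  by (induction ds) (auto intro: derivation_sl[OF der_apply_derivation])

lemma der_word_one: "\<exists>c. der_word ds (mat 1) = mscale c (mat 1)"
proof (induction ds)
  case Nil
  then show ?case by (metis der_word.simps(1) mscale_simps(2))
next
  case (Cons \<delta> ds)
  then show ?case
    by (metis der_word.simps(2) der_apply_linear(2) derivation_one[OF der_apply_derivation]
        mscale_simps(1,3))
qed

lemma free_der_action_sl: "A \<in> sl \<Longrightarrow> free_der_action p A \<in> sl"
  by (induction p rule: free_alg_induct)
    (use subspace_sl in \<open>auto simp: free_der_action_simps der_word_sl mvs.subspace_def\<close>)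

lemma free_der_action_mat_1: "\<exists>c. free_der_action p (mat 1) = mscale c (mat 1)"
proof (induction p rule: free_alg_induct)
  case (single w c)
  then show ?case
    by (metis free_der_action_simps(1) der_word_one mscale_simps(4))
next
  case (add p q)
  then show ?case
    by (metis free_der_action_simps(2) mscale_distrib(3))
qed

lemma Uset_sl: "\<phi> \<in> Uset \<Longrightarrow> A \<in> sl \<Longrightarrow> \<phi> A \<in> sl"
proof -
  have "A \<in> sl \<Longrightarrow> uea_hom p A \<in> sl" for p
    by (transfer fixing: A) (rule free_der_action_sl)
  then show "\<phi> \<in> Uset \<Longrightarrow> A \<in> sl \<Longrightarrow> \<phi> A \<in> sl" by (auto simp: Uset_def)
qed

lemma Uset_one:
  assumes "\<phi> \<in> Uset"
  obtains c where "\<phi> (mat 1) = mscale c (mat 1)"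
proof -
  have "\<exists>c. uea_hom p (mat 1) = mscale c (mat 1)" for p :: "('a, 'b) uea"
    by transfer (rule free_der_action_mat_1)
  then show thesis using that assms by (auto simp: Uset_def)
qed

definition rank_one :: "('f::field, 'n::finite) sqmat \<Rightarrow> ('f, 'n) sqmat \<Rightarrow> ('f, 'n) sqmat \<Rightarrow> ('f, 'n) sqmat"
  where "rank_one w b m = mscale (trace (m ** w)) b"

definition scalar_part :: "('f::field, 'n::finite) sqmat \<Rightarrow> ('f, 'n) sqmat" where
  "scalar_part m = mscale (trace m / of_nat CARD('n)) (mat 1)"

definition sl_part :: "('f::field, 'n::finite) sqmat \<Rightarrow> ('f, 'n) sqmat" where
  "sl_part m = m - scalar_part m"

lemma rank_one_linear:
  "rank_one (w + w') b m = rank_one w b m + rank_one w' b m" "rank_one (mscale c w) b m = mscale c (rank_one w b m)"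
  "rank_one w (b + b') m = rank_one w b m + rank_one w b' m" "rank_one w (mscale c b) m = mscale c (rank_one w b m)"
  "rank_one 0 b m = 0" "rank_one w 0 m = 0"
  by (simp_all add: rank_one_def matrix_mult_distrib trace_simps mscale_distrib mscale_mult_right mult.commute)

lemma mult_mat_1 [simp]: "mscale c (mat 1) ** A = mscale c A" "A ** mscale c (mat 1) = mscale c A"
  by (simp_all add: mscale_mult_left mscale_mult_right)

lemma trace_scalar_part:
  fixes m :: "('f::field_char_0, 'n::finite) sqmat"
  shows "trace (scalar_part m) = trace m"
  by (simp add: scalar_part_def trace_simps trace_I)

lemma sl_part_in_sl:
  fixes m :: "('f::field_char_0, 'n::finite) sqmat"
  shows "sl_part m \<in> sl"
  by (simp add: sl_def sl_part_def trace_simps trace_scalar_part)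

lemma trace_sl_part: "trace (sl_part m ** w) = trace (m ** sl_part w)"
  by (simp add: sl_part_def scalar_part_def matrix_diff_distrib trace_simps)

lemma sl_part_sl: "b \<in> sl \<Longrightarrow> sl_part b = b"
  by (simp add: sl_part_def scalar_part_def sl_def)

text \<open>
  For an off-diagonal unit \<open>e\<close> one has \<open>e e = 0\<close>, so \<open>(ad e)^2 m = - 2 e m e\<close>, which is \<open>- 2 tr(m e) e\<close>.
  Composing \<open>rank_one w b\<close> with \<open>ad c\<close> on the left replaces \<open>b\<close> by \<open>[c, b]\<close>, and on the right it replaces
  \<open>w\<close> by \<open>[w, c]\<close>; so \<open>b\<close> and then \<open>w\<close> reach all of \<open>sl\<close> by \<open>sl_generated\<close>.
\<close>

lemma rank_one_in_Uset:
  fixes w b :: "('f::field_char_0, 'n::finite) sqmat"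
  assumes card: "CARD('n) \<ge> 2" and w: "w \<in> sl" and b: "b \<in> sl"
  shows "rank_one w b \<in> Uset"
proof -
  obtain p q :: 'n where pq: "p \<noteq> q"
    using card by (metis (full_types) One_nat_def card_1_singleton_iff UNIV_eq_I not_numeral_le_zero
        card_le_Suc0_iff_eq finite numeral_2_eq_2 not_less_eq_eq iso_tuple_UNIV_I)
  let ?e = "E p q :: ('f, 'n) sqmat"
  have "rank_one ?e ?e = (\<lambda>m. mscale (- 1 / 2) ((bracket ?e \<circ> bracket ?e) m))"
  proof
    fix m :: "('f, 'n) sqmat"
    have "?e ** m ** ?e = mscale (m $ q $ p) ?e"
      by (simp add: vec_eq_iff mult_E_nth E_mult_nth E_nth)
    moreover have "?e ** ?e = 0" using pq by (simp add: E_mult_E)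
    ultimately have "bracket ?e (bracket ?e m) = mscale (- 2 * m $ q $ p) ?e"
    proof -
      assume *: "?e ** m ** ?e = mscale (m $ q $ p) ?e" "?e ** ?e = 0"
      have "bracket ?e (bracket ?e m) = ?e ** ?e ** m - ?e ** m ** ?e - (?e ** m ** ?e - m ** (?e ** ?e))"
        by (simp add: bracket_def matrix_diff_distrib matrix_mul_assoc)
      then show ?thesis by (simp add: * matrix_mult_distrib vec_eq_iff)
    qed
    then show "rank_one ?e ?e m = mscale (- 1 / 2) ((bracket ?e \<circ> bracket ?e) m)"
      by (simp add: rank_one_def trace_mult_E)
  qed
  then have start: "rank_one ?e ?e \<in> Uset"
    using Uset_closed(5)[OF Uset_closed(3)[OF Uset_bracket Uset_bracket]] by (simp only:)
  have lin: "rank_one (w + w') b \<in> Uset" if "rank_one w b \<in> Uset" "rank_one w' b \<in> Uset" for w w' b :: "('f, 'n) sqmat"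
    using Uset_closed(4)[OF that] by (simp flip: rank_one_linear)
  have lin2: "rank_one w (b + b') \<in> Uset" if "rank_one w b \<in> Uset" "rank_one w b' \<in> Uset" for w b b' :: "('f, 'n) sqmat"
    using Uset_closed(4)[OF that] by (simp flip: rank_one_linear)
  have lin3: "rank_one (mscale c w) b \<in> Uset" "rank_one w (mscale c b) \<in> Uset" if "rank_one w b \<in> Uset"
    for c and w b :: "('f, 'n) sqmat"
  proof -
    have "rank_one (mscale c w) b = (\<lambda>m. mscale c (rank_one w b m))" "rank_one w (mscale c b) = (\<lambda>m. mscale c (rank_one w b m))"
      by (simp_all add: fun_eq_iff rank_one_linear)
    then show "rank_one (mscale c w) b \<in> Uset" "rank_one w (mscale c b) \<in> Uset"
      using Uset_closed(5)[OF that, of c] by simp_all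
  qed
  have zero: "rank_one 0 b \<in> Uset" "rank_one b 0 \<in> Uset" for b :: "('f, 'n) sqmat"
    using Uset_zero by (simp_all add: rank_one_linear[abs_def])
  have "sl \<subseteq> {b. rank_one ?e b \<in> Uset}"
  proof (rule sl_generated[OF _ _ _ pq])
    show "mvs.subspace {b. rank_one ?e b \<in> Uset}"
      by (simp add: mvs.subspace_def zero lin2 lin3)
    show "bracket c b \<in> {b. rank_one ?e b \<in> Uset}" if "b \<in> {b. rank_one ?e b \<in> Uset}" for c b
    proof -
      have "rank_one ?e (bracket c b) = bracket c \<circ> rank_one ?e b"
        by (simp add: fun_eq_iff rank_one_def bracket_linear)
      then show ?thesis using that by (simp add: Uset_closed(3) Uset_bracket)
    qed
    show "?e \<in> {b. rank_one ?e b \<in> Uset}" using start by simp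
  qed
  then have b': "rank_one ?e b \<in> Uset" using b by blast
  have "sl \<subseteq> {w. rank_one w b \<in> Uset}"
  proof (rule sl_generated[OF _ _ _ pq])
    show "mvs.subspace {w. rank_one w b \<in> Uset}"
      by (simp add: mvs.subspace_def zero lin lin3)
    show "bracket c w \<in> {w. rank_one w b \<in> Uset}" if "w \<in> {w. rank_one w b \<in> Uset}" for c w
    proof -
      have "bracket c w = - bracket w c" by (simp add: bracket_def)
      then have "trace (m ** bracket c w) = - trace (m ** bracket w c)" for m
        using trace_simps(2)[of 0 "m ** bracket w c"] matrix_diff_distrib(2)[of m 0 "bracket w c"]
        by (simp add: trace_simps matrix_mult_distrib)
      then have "rank_one (bracket c w) b = (\<lambda>m. mscale (- 1) ((rank_one w b \<circ> bracket c) m))"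
        by (simp add: fun_eq_iff rank_one_def trace_bracket)
      moreover have "(\<lambda>m. mscale (- 1) ((rank_one w b \<circ> bracket c) m)) \<in> Uset"
        using that by (intro Uset_closed Uset_bracket) simp
      ultimately show ?thesis by simp
    qed
    show "?e \<in> {w. rank_one w b \<in> Uset}" using b' by simp
  qed
  then show ?thesis using w by blast
qed

text \<open>
  The family \<open>slot s\<close> is dual to \<open>sl_vec w s\<close> under the trace form: it reads off an entry of the
  traceless part, whatever \<open>w\<close> is.
\<close>

definition slot :: "'n \<times> 'n \<Rightarrow> ('f::field, 'n::finite) sqmat" where
  "slot s = sl_part (E (snd s) (fst s))"

lemma trace_slot: "trace (m ** slot s) = sl_part m $ fst s $ snd s"
  by (simp add: slot_def trace_sl_part[symmetric] trace_mult_E)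

lemma sl_part_expand:
  fixes m :: "('f::field_char_0, 'n::finite) sqmat"
  shows "sl_part m = (\<Sum>s\<in>UNIV - {(w, w)}. rank_one (slot s) (sl_vec w s) m)"
  using sl_expand[OF sl_part_in_sl, of m w] by (simp add: rank_one_def trace_slot)

lemma sl_vec_in_sl: "sl_vec w s \<in> sl"
  by (auto simp: sl_vec_def sl_def trace_E trace_simps)

lemma slot_in_sl: "(slot s :: ('f::field_char_0, 'n::finite) sqmat) \<in> sl"
  by (simp add: slot_def sl_part_in_sl)

text \<open>
  The projection to the scalar matrices is the identity minus a sum of maps \<open>rank_one (slot s) b\<close>.
\<close>

lemma scalar_part_in_Uset:
  assumes card: "CARD('n) \<ge> 2"
  shows "(scalar_part :: ('f::field_char_0, 'n::finite) sqmat \<Rightarrow> _) \<in> Uset"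
proof -
  fix w :: 'n
  have "(\<lambda>m. \<Sum>s\<in>UNIV - {(w, w)}. rank_one (slot s) (sl_vec w s) m) \<in> (Uset :: (('f, 'n) sqmat \<Rightarrow> _) set)"
    by (intro Uset_sum rank_one_in_Uset card slot_in_sl sl_vec_in_sl)
  then have "(sl_part :: ('f, 'n) sqmat \<Rightarrow> _) \<in> Uset"
    by (simp add: sl_part_expand[symmetric] cong: if_cong)
  then have "(\<lambda>m :: ('f, 'n) sqmat. id m + mscale (- 1) (sl_part m)) \<in> Uset"
    by (intro Uset_closed)
  moreover have "(\<lambda>m :: ('f, 'n) sqmat. id m + mscale (- 1) (sl_part m)) = scalar_part"
    by (simp add: fun_eq_iff sl_part_def vec_eq_iff)
  ultimately show ?thesis by simp
qed

text \<open>
  A map in \<open>U\<close> is determined by its values on the basis \<open>sl_vec w s\<close> and on \<open>mat 1\<close>; these values are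
  traceless and scalar, respectively, so only letters of the two kinds occur.
\<close>

lemma Uset_expand:
  fixes m :: "('f::field_char_0, 'n::finite) sqmat"
  assumes "\<phi> \<in> Uset" "\<phi> (mat 1) = mscale c (mat 1)"
  shows "\<phi> m = (\<Sum>s\<in>UNIV - {(w, w)}. rank_one (slot s) (\<phi> (sl_vec w s)) m) + mscale c (scalar_part m)"
proof -
  have "\<phi> m = \<phi> (sl_part m + scalar_part m)" by (simp add: sl_part_def)
  also have "\<dots> = \<phi> (sl_part m) + \<phi> (scalar_part m)" by (simp add: Uset_linear assms)
  also have "\<phi> (scalar_part m) = mscale c (scalar_part m)"
    by (simp add: scalar_part_def Uset_linear assms mult.commute)
  also have "\<phi> (sl_part m) = (\<Sum>s\<in>UNIV - {(w, w)}. rank_one (slot s) (\<phi> (sl_vec w s)) m)"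
    by (simp add: sl_part_expand[of m w] Uset_sum_arg assms rank_one_def Uset_linear)
  finally show ?thesis .
qed

section \<open>Bilinear forms that factor through the matrix product\<close>

lemma other_index:
  assumes "CARD('n::finite) \<ge> 2"
  obtains b :: "'n::finite" where "b \<noteq> a"
  using assms by (metis (full_types) UNIV_I card_le_Suc0_iff_eq finite not_less_eq_eq numeral_2_eq_2)

definition other :: "'n \<Rightarrow> 'n" where
  "other p = (SOME a. a \<noteq> p)"

lemma other: "CARD('n::finite) \<ge> 2 \<Longrightarrow> other p \<noteq> (p :: 'n)"
  unfolding other_def by (rule someI_ex) (metis other_index)

text \<open>
  Row \<open>a\<close> of this matrix is the unit vector at \<open>q\<close>, which is all that enters into
  \<open>E p a ** row_unit a q\<close>; the other rows make the trace vanish.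
\<close>

definition row_unit :: "'n \<Rightarrow> 'n \<Rightarrow> ('f::field, 'n::finite) sqmat" where
  "row_unit a q = (if a = q then E a a - E (other a) (other a) else E a q)"

lemma row_unit:
  assumes "CARD('n::finite) \<ge> 2"
  shows "(row_unit a q :: ('f::field, 'n::finite) sqmat) \<in> sl"
    and "E p a ** (row_unit a q :: ('f, 'n::finite) sqmat) = E p q"
proof -
  have "other a \<noteq> a" by (rule other[OF assms])
  then show "E p a ** (row_unit a q :: ('f, 'n) sqmat) = E p q"
    by (auto simp: row_unit_def matrix_diff_distrib E_mult_E)
  show "(row_unit a q :: ('f, 'n) sqmat) \<in> sl"
    by (simp add: row_unit_def E_in_sl)
qed

text \<open>
  The passage from shorter to longer products.  Here \<open>f b u\<close> stands for a letter with matrix \<open>b\<close> times a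
  word with product \<open>u\<close>, and \<open>g z m\<close> for a pair of letters with product \<open>m\<close> times a word with product
  \<open>z\<close>.  Writing \<open>E p q = E p a ** row_unit a q\<close> with \<open>a \<noteq> p\<close> gives \<open>f b (E p q) = (\<Sum>r. b_rp h_aq(r))\<close>, where
  \<open>h_aq(r) = g (row_unit a q) (E r a)\<close>.  Once \<open>h_aq\<close> is known not to depend on \<open>a\<close>, this is a linear
  function of \<open>b ** E p q\<close>.
\<close>

lemma (in vector_space) associative_factor:
  fixes f :: "('a, 'n::finite) sqmat \<Rightarrow> ('a, 'n) sqmat \<Rightarrow> 'b"
    and g :: "('a, 'n::finite) sqmat \<Rightarrow> ('a, 'n) sqmat \<Rightarrow> 'b"
  assumes card: "CARD('n) \<ge> 2"
    and f: "\<And>b u u'. f b (u + u') = f b u + f b u'" "\<And>b t u. f b (mscale t u) = scale t (f b u)"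
    and g: "\<And>z m m'. g z (m + m') = g z m + g z m'" "\<And>z t m. g z (mscale t m) = scale t (g z m)"
    and fg: "\<And>b q z. b \<in> sl \<Longrightarrow> q \<in> sl \<Longrightarrow> z \<in> sl \<Longrightarrow> f b (q ** z) = g z (b ** q)"
  shows "\<exists>G. (\<forall>m m'. G (m + m') = G m + G m') \<and> (\<forall>t m. G (mscale t m) = scale t (G m)) \<and>
    (\<forall>b\<in>sl. \<forall>u. f b u = G (b ** u))"
proof -
  have f0: "f b 0 = 0" for b using f(1)[of b 0 0] by simp
  have g0: "g z 0 = 0" for z using g(1)[of z 0 0] by simp
  have g_sum: "g z (\<Sum>x\<in>A. k x) = (\<Sum>x\<in>A. g z (k x))" for z k and A :: "'n set"
    by (induction A rule: infinite_finite_induct) (simp_all add: g g0)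
  define h where "h a q r = g (row_unit a q) (E r a)" for a q r
  have col: "b ** E p a = (\<Sum>r\<in>UNIV. mscale (b $ r $ p) (E r a))" for b :: "('a, 'n) sqmat" and p a
  proof -
    have "(\<Sum>r\<in>UNIV. b $ r $ p * E r a $ i $ j) = (\<Sum>r\<in>UNIV. if r = i then (if j = a then b $ i $ p else 0) else 0)" for i j
      by (rule sum.cong) (auto simp: E_nth)
    then show ?thesis by (simp add: vec_eq_iff mult_E_nth)
  qed
  have step: "f b (E p q) = (\<Sum>r\<in>UNIV. scale (b $ r $ p) (h a q r))" if "b \<in> sl" "a \<noteq> p" for b p q a
  proof -
    have "f b (E p q) = g (row_unit a q) (b ** E p a)"
      using fg[OF that(1), of "E p a" "row_unit a q"] that by (simp add: E_in_sl row_unit[OF card])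
    then show ?thesis by (simp add: col[of b p a] g_sum g h_def)
  qed
  \<comment> \<open>For \<open>a \<noteq> q\<close> compare two factorisations of \<open>E a q\<close> into traceless matrices, as
    \<open>E a q ** row_unit q q\<close> and as \<open>(E a a - E q q) ** E a q\<close>.\<close>
  have indep: "h a q r = h q q r" for a q r
  proof (cases "a = q")
    case False
    let ?H = "E a a - E q q :: ('a, 'n) sqmat"
    have 1: "(\<Sum>r\<in>UNIV. scale (b $ r $ a) (h q q r)) = g (E a q) (b ** ?H)" if "b \<in> sl" for b
      using step[OF that, of q a q] fg[OF that, of ?H "E a q"] False
      by (simp add: E_in_sl matrix_diff_distrib E_mult_E)
    show ?thesis
    proof (cases "r = a")
      case True
      have "(\<Sum>r\<in>UNIV. scale (?H $ r $ a) (h q q r)) = (\<Sum>r\<in>UNIV. if r = a then h q q a else 0)"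
        by (rule sum.cong) (use False in \<open>auto simp: E_nth\<close>)
      then have "h q q a = g (E a q) (?H ** ?H)"
        using 1[of ?H] by (simp add: E_in_sl)
      also have "\<dots> = g (E a q) (E a a) + g (E a q) (E q a ** E a q)"
        using False by (simp add: matrix_diff_distrib E_mult_E flip: g)
      \<comment> \<open>The square of \<open>E a a - E q q\<close> has the additional term \<open>E q q\<close>; since it equals
        \<open>E q a ** E a q\<close>, reassociating produces \<open>E a q ** E a q = 0\<close>.\<close>
      also have "g (E a q) (E q a ** E a q) = 0"
        using fg[of "E q a" "E a q" "E a q"] False by (simp add: E_in_sl E_mult_E f0)
      finally show ?thesis using False True by (simp add: h_def row_unit_def)
    next
      case r: False
      have "(\<Sum>x\<in>UNIV. scale (E r a $ x $ a) (h q q x)) = (\<Sum>x\<in>UNIV. if x = r then h q q r else 0)"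
        by (rule sum.cong) (auto simp: E_nth)
      then have "h q q r = g (E a q) (E r a ** ?H)"
        using 1[of "E r a"] r by (simp add: E_in_sl)
      then show ?thesis using False by (simp add: matrix_diff_distrib E_mult_E h_def row_unit_def)
    qed
  qed simp
  define G where "G m = (\<Sum>(r, q)\<in>UNIV. scale (m $ r $ q) (h q q r))" for m :: "('a, 'n) sqmat"
  have lin: "G (a + b) = G a + G b" "G (mscale t a) = scale t (G a)" for a b t
    by (simp_all add: G_def scale_left_distrib sum.distrib scale_sum_right case_prod_unfold)
  have G0: "G 0 = 0" using lin(1)[of 0 0] by simp
  have "f b u = G (b ** u)" if b: "b \<in> sl" for b u
  proof -
    have "u \<in> {u. f b u = G (b ** u)}"
    proof (rule matrix_induct)
      show "mvs.subspace {u. f b u = G (b ** u)}"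
        by (simp add: mvs.subspace_def f0 f lin G0 matrix_mult_distrib mscale_mult_right)
      fix p q :: 'n
      obtain a where "a \<noteq> p" using other_index[OF card] .
      then have "f b (E p q) = (\<Sum>r\<in>UNIV. scale (b $ r $ p) (h q q r))"
        by (simp add: step[OF b] indep[of a q])
      also have "\<dots> = (\<Sum>r\<in>UNIV. \<Sum>q'\<in>UNIV. if q' = q then scale (b $ r $ p) (h q q r) else 0)"
        by simp
      also have "\<dots> = (\<Sum>(r, q')\<in>UNIV. if q' = q then scale (b $ r $ p) (h q q r) else 0)"
        by (simp only: sum.cartesian_product UNIV_Times_UNIV)
      also have "\<dots> = G (b ** E p q)"
        unfolding G_def by (rule sum.cong) (auto simp: mult_E_nth)
      finally show "E p q \<in> {u. f b u = G (b ** u)}" by simp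
    qed
    then show ?thesis by simp
  qed
  then show ?thesis using lin by blast
qed

text \<open>
  \<open>act c\<close> is meant to be the action of \<open>ad c\<close> on a quotient module, transported to a complement of the
  submodule.
\<close>

locale equivariant_form = vector_space s
  for s :: "'f::field_char_0 \<Rightarrow> 'v::ab_group_add \<Rightarrow> 'v" +
  fixes act :: "('f, 'n::finite) sqmat \<Rightarrow> 'v \<Rightarrow> 'v"
    and B :: "('f, 'n) sqmat \<Rightarrow> ('f, 'n) sqmat \<Rightarrow> 'v"
  assumes act_add: "act c (x + y) = act c x + act c y"
    and act_scale: "act c (s t x) = s t (act c x)"
    and B_add: "B (a + a') b = B a b + B a' b" "B a (b + b') = B a b + B a b'"
    and B_scale: "B (mscale t a) b = s t (B a b)" "B a (mscale t b) = s t (B a b)"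
    and act_B: "act c (B a b) = B (bracket c a) b + B a (bracket c b)"
begin

lemma act_zero: "act c 0 = 0"
  using act_add[of c 0 0] by simp

lemma act_diff: "act c (x - y) = act c x - act c y"
  using act_add[of c "x - y" y] by (simp add: algebra_simps)

lemma B_zero: "B 0 b = 0" "B a 0 = 0"
  using B_add(1)[of 0 0 b] B_add(2)[of a 0 0] by simp_all

lemma B_diff: "B (a - a') b = B a b - B a' b" "B a (b - b') = B a b - B a b'"
  using B_add(1)[of "a - a'" a' b] B_add(2)[of a "b - b'" b'] by (simp_all add: algebra_simps)

lemma B_minus: "B (- a) b = - B a b" "B a (- b) = - B a b"
  using B_diff(1)[of 0 a b] B_diff(2)[of a 0 b] by (simp_all add: B_zero)

lemma act_minus: "act c (- x) = - act c x"
  using act_diff[of c 0 x] by (simp add: act_zero)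

lemma double_eq_0: "x + x = 0 \<Longrightarrow> x = (0::'v)"
proof -
  assume "x + x = 0"
  then have "s 2 x = 0" using scale_left_distrib[of 1 1 x] by simp
  then show ?thesis by simp
qed

lemmas calc = act_B bracket_E bracket_linear B_zero B_diff B_minus B_add act_diff act_add act_minus act_zero

lemma bilinear_eqI:
  assumes off: "\<And>p q r t. p \<noteq> q \<Longrightarrow> r \<noteq> t \<Longrightarrow> B (E p q) (E r t) = G (E p q ** E r t)"
    and diag_off: "\<And>p q r t. p \<noteq> q \<Longrightarrow> r \<noteq> t \<Longrightarrow> B (E p p - E q q) (E r t) = G ((E p p - E q q) ** E r t)"
    and off_diag: "\<And>p q r t. p \<noteq> q \<Longrightarrow> r \<noteq> t \<Longrightarrow> B (E p q) (E r r - E t t) = G (E p q ** (E r r - E t t))"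
    and diag: "\<And>p q r t. p \<noteq> q \<Longrightarrow> r \<noteq> t \<Longrightarrow>
      B (E p p - E q q) (E r r - E t t) = G ((E p p - E q q) ** (E r r - E t t))"
    and G: "\<And>a b. G (a + b) = G a + G b" "\<And>t a. G (mscale t a) = s t (G a)"
    and "a \<in> sl" "b \<in> sl"
  shows "B a b = G (a ** b)"
proof -
  have G0: "G 0 = 0" using G(1)[of 0 0] by simp
  have *: "b \<in> {b. B a b = G (a ** b)}"
    if "\<And>r t. r \<noteq> t \<Longrightarrow> B a (E r t) = G (a ** E r t)"
      "\<And>r t. r \<noteq> t \<Longrightarrow> B a (E r r - E t t) = G (a ** (E r r - E t t))" for a
    by (rule sl_induct[OF _ _ _ \<open>b \<in> sl\<close>])
      (use that in \<open>auto simp: mvs.subspace_def B_zero B_add B_scale G G0 matrix_mult_distrib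
        mscale_mult_right\<close>)
  have "a \<in> {a. B a b = G (a ** b)}"
    by (rule sl_induct[OF _ _ _ \<open>a \<in> sl\<close>])
      (use *[of "E _ _"] *[of "E _ _ - E _ _"] off diag_off off_diag diag in
        \<open>auto simp: mvs.subspace_def B_zero B_add B_scale G G0 matrix_mult_distrib
        mscale_mult_left\<close>)
  then show ?thesis by simp
qed

text \<open>
  If \<open>B\<close> factors through \<open>G\<close>, then \<open>G\<close> is equivariant, so its kernel is closed under brackets.  The
  kernel contains \<open>E p p\<close>, and \<open>[E q p, E p p] = E q p\<close> generates \<open>sl\<close>, which together with \<open>E p p\<close>
  spans everything.
\<close>

lemma vanishes_if_at_unit:
  assumes card: "CARD('n) \<ge> 2"
    and G: "\<And>a b. G (a + b) = G a + G b" "\<And>t a. G (mscale t a) = s t (G a)"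
    and BG: "\<And>a b. a \<in> sl \<Longrightarrow> b \<in> sl \<Longrightarrow> B a b = G (a ** b)"
    and pq: "p \<noteq> q" "B (E p q) (E q p) = 0"
  shows "G m = 0"
proof -
  have G0: "G 0 = 0" using G(1)[of 0 0] by simp
  have sub: "mvs.subspace {m. G m = 0}" by (simp add: mvs.subspace_def G G0)
  have equiv: "act c (G m) = G (bracket c m)" for c m
  proof -
    have "m \<in> {m. act c (G m) = G (bracket c m)}"
    proof (rule matrix_induct)
      show "mvs.subspace {m. act c (G m) = G (bracket c m)}"
        by (simp add: mvs.subspace_def G G0 act_add act_scale act_zero bracket_linear)
      fix r t :: 'n
      obtain a where a: "a \<noteq> r" using other_index[OF card] .
      have "act c (B (E r a) (row_unit a t)) = G (bracket c (E r a ** row_unit a t))"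
        unfolding act_B bracket_mult G using a by (simp add: BG E_in_sl bracket_in_sl row_unit(1)[OF card])
      moreover have "B (E r a) (row_unit a t) = G (E r t)"
        using a BG[of "E r a" "row_unit a t"] by (simp add: E_in_sl row_unit[OF card])
      ultimately show "E r t \<in> {m. act c (G m) = G (bracket c m)}"
        by (simp add: row_unit[OF card])
    qed
    then show ?thesis by simp
  qed
  have Epp: "G (E p p) = 0"
    using pq BG[of "E p q" "E q p"] by (simp add: E_in_sl E_mult_E)
  have "G (bracket (E q p) (E p p)) = 0"
    by (simp add: equiv[symmetric] Epp act_zero)
  then have Eqp: "G (E q p) = 0" using pq by (simp add: bracket_E)
  have "sl \<subseteq> {m. G m = 0}"
    by (rule sl_generated[OF sub, of q p]) (use Eqp pq in \<open>auto simp: equiv[symmetric] act_zero\<close>)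
  then have sl: "G m = 0" if "m \<in> sl" for m using that by blast
  have "m \<in> {m. G m = 0}"
  proof (rule matrix_induct[OF sub])
    fix r t :: 'n
    have "G (E r r) = G (E r r - E p p) + G (E p p)"
      by (simp flip: G)
    then have "G (E r r) = 0" by (simp add: sl E_in_sl Epp)
    then show "E r t \<in> {m. G m = 0}" by (cases "r = t") (simp_all add: sl E_in_sl)
  qed
  then show ?thesis by simp
qed

end

text \<open>
  The case \<open>k \<ge> 3\<close>.  Applying \<open>act (E a b)\<close> to a relation \<open>B (E p q) (E r t) = 0\<close> replaces first
  indices \<open>b\<close> by \<open>a\<close> and second indices \<open>a\<close> by \<open>b\<close>, with a sign.  All relations that hold for the matrix
  product are obtained from the one at \<open>start\<close> in this way.
\<close>

locale equivariant_form_3 = equivariant_form s act B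
  for s :: "'f::field_char_0 \<Rightarrow> 'v::ab_group_add \<Rightarrow> 'v"
    and act :: "('f, 'n::finite) sqmat \<Rightarrow> 'v \<Rightarrow> 'v" and B +
  fixes i1 i2 i3 :: 'n
  assumes distinct: "i1 \<noteq> i2" "i1 \<noteq> i3" "i2 \<noteq> i3"
    and start: "B (E i1 i2) (E i3 i1) = 0"
begin

lemma swap_23:
  assumes "B (E p q) (E r p) = 0" "p \<noteq> q" "p \<noteq> r" "q \<noteq> r"
  shows "B (E p r) (E q p) = 0"
proof -
  have "0 = act (E q r) (act (E q r) (B (E p q) (E r p)))"
    by (simp add: assms(1) act_zero)
  also have "\<dots> = - (B (E p r) (E q p) + B (E p r) (E q p))"
    using assms(2-4) by (simp add: calc)
  finally show ?thesis using double_eq_0 by (metis neg_0_equal_iff_equal)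
qed

lemma swap_12:
  assumes "B (E p q) (E r p) = 0" "p \<noteq> q" "p \<noteq> r" "q \<noteq> r"
  shows "B (E q p) (E r q) = 0"
proof -
  have 1: "B (E q q - E p p) (E r p) = 0"
    using arg_cong[OF assms(1), of "act (E q p)"] assms(2-4) by (simp add: calc)
  have 2: "B (E p q) (E r q) = 0"
    using arg_cong[OF assms(1), of "act (E p q)"] assms(2-4) by (simp add: calc)
  have 3: "B (E q q - E p p) (E r q) = 0"
    using arg_cong[OF 2, of "act (E q p)"] assms by (simp add: calc)
  have "- (B (E q p) (E r q) + B (E q p) (E r q)) = B (E q q - E p p) (E r p)"
    using arg_cong[OF 3, of "act (E q p)"] assms(2-4) by (simp add: calc algebra_simps)
  then show ?thesis using double_eq_0 by (metis 1 neg_0_equal_iff_equal minus_minus)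
qed

lemma replace_2:
  assumes "B (E p q) (E r p) = 0" "p \<noteq> q" "p \<noteq> r" "q \<noteq> r" "a \<notin> {p, q, r}"
  shows "B (E p a) (E r p) = 0"
  using arg_cong[OF assms(1), of "act (E q a)"] assms(2-) by (simp add: calc)

text \<open>
  The transpositions of neighbouring indices and the replacement of one index by an unused one connect
  any two triples of distinct indices.
\<close>

lemma all_triples:
  assumes "p \<noteq> q" "p \<noteq> r" "q \<noteq> r"
  shows "B (E p q) (E r p) = 0"
proof -
  define Q where "Q p q r \<longleftrightarrow> p \<noteq> q \<and> p \<noteq> r \<and> q \<noteq> r \<and> B (E p q) (E r p) = 0" for p q r
  have s23: "Q p r q" and s12: "Q q p r" and r2: "a \<notin> {p, q, r} \<Longrightarrow> Q p a r" if "Q p q r" for p q r a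
    using that swap_23 swap_12 replace_2 unfolding Q_def by blast+
  have "\<exists>y z. Q p y z"
    using s23 s12 r2 start distinct unfolding Q_def[symmetric] by (metis Q_def insert_iff empty_iff)
  then have "\<exists>z. Q p q z"
    using s23 r2 assms by (metis insert_iff empty_iff)
  then have "Q p q r"
    using s23 r2 assms by (metis insert_iff empty_iff)
  then show ?thesis by (simp add: Q_def)
qed

lemma off_off:
  assumes "p \<noteq> q" "r \<noteq> t" "q \<noteq> r"
  shows "B (E p q) (E r t) = 0"
proof -
  have ts: "B (E p q) (E r t) = 0" if "p \<noteq> q" "r \<noteq> t" "q \<noteq> r" "t \<noteq> q" "p \<noteq> t" for p q r t
    using arg_cong[OF all_triples[of t q r], of "act (E p t)"] that by (simp add: calc)
  have third: "\<exists>x. x \<noteq> a \<and> x \<noteq> b" for a b :: 'n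
    using distinct by metis
  consider "p = t" | "p \<noteq> t" "t \<noteq> q" | "t = q" "p \<noteq> r" | "t = q" "p = r" by blast
  then show ?thesis
  proof cases
    case 1
    then show ?thesis using all_triples[of p q r] assms by auto
  next
    case 2
    then show ?thesis using ts assms by blast
  next
    case 3
    then show ?thesis
      using arg_cong[OF all_triples[of p q r], of "act (E p q)"] assms by (simp add: calc)
  next
    case 4
    obtain x where "x \<noteq> r" "x \<noteq> q" using third by blast
    then show ?thesis
      using arg_cong[OF ts[of r q r x], of "act (E x q)"] assms 4 by (simp add: calc)
  qed
qed

lemma third: "\<exists>x. x \<noteq> a \<and> x \<noteq> (b::'n)"
  using distinct by metis

lemma diag_zero:
  assumes "p \<noteq> q" "r \<noteq> p" "r \<noteq> q" "r \<noteq> t"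
  shows "B (E q q - E p p) (E r t) = 0"
  using arg_cong[OF off_off[of p q r t], of "act (E q p)"] assms off_off[of p q r p]
  by (simp add: calc split: if_splits)

lemma zero_diag:
  assumes "p \<noteq> q" "q \<noteq> r" "q \<noteq> t" "r \<noteq> t"
  shows "B (E p q) (E t t - E r r) = 0"
  using arg_cong[OF off_off[of p q r t], of "act (E t r)"] assms off_off[of t q r t]
  by (simp add: calc split: if_splits)

lemma mid_indep:
  assumes "q \<noteq> p" "q \<noteq> t" "r \<noteq> p" "r \<noteq> t"
  shows "B (E p q) (E q t) = B (E p r) (E r t)"
proof (cases "q = r")
  case False
  then show ?thesis
    using arg_cong[OF off_off[of p q r t], of "act (E q r)"] assms
    by (simp add: calc split: if_splits)
qed simp

text \<open>
  The common value of \<open>B (E p q) (E q t)\<close> for all \<open>q\<close> other than \<open>p\<close> and \<open>t\<close> (see \<open>mid_indep\<close>), which is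
  going to be the value at \<open>E p t\<close> of the map through which \<open>B\<close> factors.
\<close>

definition G0 :: "'n \<Rightarrow> 'n \<Rightarrow> 'v" where
  "G0 p t = (let q = SOME q. q \<noteq> p \<and> q \<noteq> t in B (E p q) (E q t))"

lemma G0:
  assumes "q \<noteq> p" "q \<noteq> t"
  shows "B (E p q) (E q t) = G0 p t"
proof -
  have "(SOME q. q \<noteq> p \<and> q \<noteq> t) \<noteq> p \<and> (SOME q. q \<noteq> p \<and> q \<noteq> t) \<noteq> t"
    using someI_ex[OF third[of p t]] .
  then show ?thesis
    using mid_indep[of q p t "SOME q. q \<noteq> p \<and> q \<noteq> t"] assms by (simp add: G0_def Let_def)
qed

lemma diag_off_1:
  assumes "p \<noteq> t" "q \<noteq> p"
  shows "B (E p p - E q q) (E p t) = G0 p t"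
proof -
  have *: "B (E p p - E q q) (E p t) = G0 p t" if "p \<noteq> t" "q \<noteq> p" "q \<noteq> t" for q
    using arg_cong[OF off_off[of p q p t], of "act (E q p)"] that G0[of q p t]
    by (simp add: calc algebra_simps)
  show ?thesis
  proof (cases "q = t")
    case True
    obtain c where c: "c \<noteq> p" "c \<noteq> t" using third by blast
    have "B (E p p - E q q) (E p t) = B (E p p - E c c) (E p t) + B (E c c - E q q) (E p t)"
      by (simp flip: B_add)
    also have "\<dots> = G0 p t"
      using *[of c] diag_zero[of q c p t] assms c True by simp
    finally show ?thesis .
  qed (use * assms in blast)
qed

lemma off_diag_1:
  assumes "p \<noteq> t" "q \<noteq> t"
  shows "B (E p t) (E t t - E q q) = G0 p t"
proof -
  have *: "B (E p t) (E t t - E q q) = G0 p t" if "p \<noteq> t" "q \<noteq> p" "q \<noteq> t" for q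
    using arg_cong[OF off_off[of p t q t], of "act (E t q)"] that G0[of q p t]
    by (simp add: calc algebra_simps)
  show ?thesis
  proof (cases "q = p")
    case True
    obtain c where c: "c \<noteq> p" "c \<noteq> t" using third by blast
    have "B (E p t) (E t t - E q q) = B (E p t) (E t t - E c c) + B (E p t) (E c c - E q q)"
      by (simp flip: B_add)
    also have "\<dots> = G0 p t"
      using *[of c] zero_diag[of p t q c] assms c True by simp
    finally show ?thesis .
  qed (use * assms in blast)
qed

lemma diag_off:
  assumes "a \<noteq> b" "r \<noteq> t"
  shows "B (E a a - E b b) (E r t) = (if r = a then G0 r t else if r = b then - G0 r t else 0)"
proof -
  have "E a a - E b b = - (E b b - E a a)" by simp
  then show ?thesis
    using assms diag_off_1[of a t b] diag_off_1[of b t a] diag_zero[of b a r t]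
    by (metis B_minus(1))
qed

lemma off_diag:
  assumes "a \<noteq> b" "p \<noteq> t"
  shows "B (E p t) (E a a - E b b) = (if t = a then G0 p t else if t = b then - G0 p t else 0)"
proof -
  have "E a a - E b b = - (E b b - E a a)" by simp
  then show ?thesis
    using assms off_diag_1[of p a b] off_diag_1[of p b a] zero_diag[of p t b a]
    by (metis B_minus(2))
qed

lemma act_G0:
  assumes "r \<noteq> t"
  shows "act (E t r) (G0 r t) = G0 t t - G0 r r"
proof -
  obtain m where "m \<noteq> r" "m \<noteq> t" using third by blast
  then show ?thesis
    using assms by (simp add: G0[of m, symmetric] calc)
qed

text \<open>
  Obtained from the relation for \<open>B (E a a - E b b) (E r t)\<close> by applying \<open>act (E t r)\<close>.
\<close>

lemma diag_diag:
  assumes "a \<noteq> b" "r \<noteq> t"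
  shows "B (E a a - E b b) (E t t - E r r)
    = (if t = a then G0 t t else if t = b then - G0 t t else 0)
    - (if r = a then G0 r r else if r = b then - G0 r r else 0)"
proof -
  have 1: "B (bracket (E t r) (E a a - E b b)) (E r t)
      = (if r = a then G0 t t else if r = b then - G0 t t else 0)
      - (if t = a then G0 t t else if t = b then - G0 t t else 0)"
    using assms G0[of r t t] by (auto simp: bracket_E bracket_linear B_minus B_zero B_diff)
  have "B (bracket (E t r) (E a a - E b b)) (E r t) + B (E a a - E b b) (E t t - E r r)
      = act (E t r) (B (E a a - E b b) (E r t))"
    by (simp add: act_B bracket_E)
  also have "\<dots> = (if r = a then G0 t t - G0 r r else if r = b then - (G0 t t - G0 r r) else 0)"
    using assms by (auto simp: diag_off act_G0 act_minus act_zero)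
  finally show ?thesis
    unfolding 1 by (auto simp: algebra_simps split: if_splits)
qed

lemma factors_through_product:
  "\<exists>G. (\<forall>a b. G (a + b) = G a + G b) \<and> (\<forall>t a. G (mscale t a) = s t (G a)) \<and>
    (\<forall>a\<in>sl. \<forall>b\<in>sl. B a b = G (a ** b))"
proof -
  define G where "G m = (\<Sum>(p, t)\<in>UNIV. s (m $ p $ t) (G0 p t))" for m :: "('f, 'n) sqmat"
  have lin: "G (a + b) = G a + G b" "G (mscale t a) = s t (G a)" for a b t
    by (simp_all add: G_def scale_left_distrib sum.distrib scale_sum_right case_prod_unfold)
  have minus: "G (a - b) = G a - G b" for a b
    using lin(1)[of "a - b" b] by (simp add: algebra_simps)
  have zero: "G 0 = 0" using minus[of 0 0] by simp
  have E: "G (E p t) = G0 p t" for p t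
  proof -
    have "G (E p t) = (\<Sum>x\<in>UNIV. if x = (p, t) then G0 p t else 0)"
      unfolding G_def by (rule sum.cong) (auto simp: E_nth split: if_splits)
    then show ?thesis by simp
  qed
  have "B a b = G (a ** b)" if "a \<in> sl" "b \<in> sl" for a b
  proof (rule bilinear_eqI[of G, OF _ _ _ _ lin that])
    fix p q r t :: 'n
    assume pq: "p \<noteq> q" and rt: "r \<noteq> t"
    show "B (E p q) (E r t) = G (E p q ** E r t)"
      using off_off[OF pq rt] G0[of q p t] pq rt by (auto simp: E_mult_E E zero)
    show "B (E p p - E q q) (E r t) = G ((E p p - E q q) ** E r t)"
      using diag_off[OF pq rt] pq by (auto simp: E_mult_E E zero minus matrix_diff_distrib)
    show "B (E p q) (E r r - E t t) = G (E p q ** (E r r - E t t))"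
      using off_diag[OF rt pq] rt by (auto simp: E_mult_E E zero minus matrix_diff_distrib)
    show "B (E p p - E q q) (E r r - E t t) = G ((E p p - E q q) ** (E r r - E t t))"
      using diag_diag[of p q t r] pq rt by (auto simp: E_mult_E E zero minus matrix_diff_distrib)
  qed
  then show ?thesis using lin by blast
qed

end

text \<open>
  The case \<open>k = 2\<close>, where \<open>sl\<close> has the basis \<open>e, f, h\<close>.  The tensor \<open>e \<otimes> e\<close> is a highest weight vector,
  and applying \<open>f\<close> to it four times yields the five relations that hold for products of \<open>e\<close>, \<open>f\<close> and
  \<open>h\<close>.
\<close>

locale equivariant_form_2 = equivariant_form s act B
  for s :: "'f::field_char_0 \<Rightarrow> 'v::ab_group_add \<Rightarrow> 'v"
    and act :: "('f, 'n::finite) sqmat \<Rightarrow> 'v \<Rightarrow> 'v" and B +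
  fixes i1 i2 :: 'n
  assumes two: "i1 \<noteq> i2" "UNIV = {i1, i2}"
    and start: "B (E i1 i2) (E i1 i2) = 0"
begin

lemma triple_eq_0: "x + x + x = 0 \<Longrightarrow> x = (0::'v)"
proof -
  assume "x + x + x = 0"
  moreover have "s 3 x = x + x + x"
    using scale_left_distrib[of 1 2 x] scale_left_distrib[of 1 1 x] by simp
  ultimately show ?thesis by simp
qed

lemma relations:
  defines "e \<equiv> E i1 i2" and "f \<equiv> E i2 i1" and "h \<equiv> E i1 i1 - E i2 i2"
  shows "B e e = 0" "B e h = - B h e" "B h h = B e f + B f e" "B f h = - B h f" "B f f = 0"
proof -
  have bracket: "bracket f e = - h" "bracket f h = mscale 2 f" "bracket f f = 0"
    using two by (simp_all add: e_def f_def h_def bracket_E bracket_linear) (simp add: vec_eq_iff)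
  have s2: "s 2 x = x + x" for x :: 'v
    using scale_left_distrib[of 1 1 x] by simp
  note c = act_B bracket B_scale s2 B_minus B_add B_zero act_add act_diff act_minus
  show ee: "B e e = 0" using start by (simp add: e_def)
  have "act f (B e e) = - (B h e + B e h)" by (simp add: c)
  then have 1: "B h e + B e h = 0" by (metis ee act_zero neg_0_equal_iff_equal)
  then show "B e h = - B h e" by (metis add.commute eq_neg_iff_add_eq_0)
  have "act f (B h e + B e h) = (B e f + B f e - B h h) + (B e f + B f e - B h h)"
    by (simp add: c)
  then have 2: "B e f + B f e - B h h = 0"
    using double_eq_0 by (metis 1 act_zero)
  then show hh: "B h h = B e f + B f e" by simp
  have "act f (B e f + B f e - B h h) = - ((B f h + B h f) + (B f h + B h f) + (B f h + B h f))"
    by (simp add: c)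
  then have 3: "B f h + B h f = 0"
    using triple_eq_0[of "B f h + B h f"] by (metis 2 act_zero neg_0_equal_iff_equal)
  then show "B f h = - B h f" by (metis eq_neg_iff_add_eq_0)
  have "act f (B f h + B h f) = (B f f + B f f) + (B f f + B f f)"
    by (simp add: c)
  then show "B f f = 0" using double_eq_0 by (metis 3 act_zero)
qed

lemma factors_through_product:
  "\<exists>G. (\<forall>a b. G (a + b) = G a + G b) \<and> (\<forall>t a. G (mscale t a) = s t (G a)) \<and>
    (\<forall>a\<in>sl. \<forall>b\<in>sl. B a b = G (a ** b))"
proof -
  define e f h where "e = (E i1 i2 :: ('f, 'n) sqmat)" and "f = (E i2 i1 :: ('f, 'n) sqmat)"
    and "h = (E i1 i1 - E i2 i2 :: ('f, 'n) sqmat)"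
  note rel = relations[folded e_def f_def h_def]
  define G where "G m = s (m $ i1 $ i1) (B e f) + s (m $ i2 $ i2) (B f e)
    + s (m $ i1 $ i2) (B h e) + s (m $ i2 $ i1) (B f h)" for m :: "('f, 'n) sqmat"
  have lin: "G (a + b) = G a + G b" "G (mscale t a) = s t (G a)" for a b t
    by (simp_all add: G_def scale_left_distrib scale_right_distrib algebra_simps)
  have cases: "p = i1 \<and> q = i2 \<or> p = i2 \<and> q = i1" if "p \<noteq> q" for p q
    using two that by (metis UNIV_I insertE singletonD)
  have minus: "G (- a) = - G a" for a
    using lin(1)[of "- a" a] lin(2)[of 0 0] by (simp add: eq_neg_iff_add_eq_0)
  have prod: "e ** e = 0" "f ** f = 0" "e ** f = E i1 i1" "f ** e = E i2 i2" "h ** e = e"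
    "e ** h = - e" "h ** f = - f" "f ** h = f" "h ** h = E i1 i1 + E i2 i2"
    using two(1) by (simp_all add: e_def f_def h_def E_mult_E matrix_diff_distrib)
  have val: "G 0 = 0" "G e = B h e" "G f = B f h" "G (E i1 i1) = B e f" "G (E i2 i2) = B f e"
    using two(1) by (simp_all add: G_def E_nth e_def f_def)
  have neg: "(- a) ** b = - (a ** b)" "a ** (- b) = - (a ** b)" for a b :: "('f, 'n) sqmat"
    using matrix_diff_distrib[of 0 a b] matrix_diff_distrib[of a 0 b]
    by (simp_all add: matrix_mult_distrib)
  have table: "B x y = G (x ** y)" if "x \<in> {e, f, h, - h}" "y \<in> {e, f, h, - h}" for x y
    using that by (auto simp: prod val rel minus[of "_ + _"] minus[of e] minus[of f] neg lin B_minus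
        simp del: minus_add_distrib)
  have mem: "E p q \<in> {e, f, h, - h}" "E p p - E q q \<in> {e, f, h, - h}" if "p \<noteq> q" for p q
    using cases[OF that] by (auto simp: e_def f_def h_def)
  have "B a b = G (a ** b)" if "a \<in> sl" "b \<in> sl" for a b
    by (rule bilinear_eqI[of G, OF _ _ _ _ lin that]; rule table; rule mem)
  then show ?thesis using lin by blast
qed

end

section \<open>U-polynomials\<close>

lemma vector_space_upoly: "vector_space (upoly_scale :: 'f::field \<Rightarrow> ('f, 'n::finite) upoly \<Rightarrow> _)"
  using module_upoly_scale by (simp add: module_iff_vector_space)

interpretation uvs: vector_space "upoly_scale :: 'f::field \<Rightarrow> ('f, 'n::finite) upoly \<Rightarrow> _"
  by (rule vector_space_upoly)

lemma upoly_scale_mult_left: "upoly_scale c f * h = upoly_scale c (f * h)"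
  by transfer (auto simp: fscale_mult_left upoly_rel_def ideal_gen.zero free_alg_lookup_mult_0
      lookup_fscale_0)

lemma upoly_scale_mult_right: "f * upoly_scale c h = upoly_scale c (f * h)"
  by transfer (auto simp: fscale_mult_right upoly_rel_def ideal_gen.zero free_alg_lookup_mult_0
      lookup_fscale_0)

text \<open>
  A representative has no constant term, so it is a combination of nonempty words, and these are
  products of symbols.  In the induction over representatives the constant term is subtracted, because
  the summands that occur there may have one.
\<close>

lemma upoly_induct [case_names xvar add mult scale]:
  fixes f :: "('f::field, 'n::finite) upoly"
  assumes xvar: "\<And>i u. P (xvar i u)" and add: "\<And>f h. P f \<Longrightarrow> P h \<Longrightarrow> P (f + h)"
    and mult: "\<And>f h. P f \<Longrightarrow> P h \<Longrightarrow> P (f * h)" and scale: "\<And>c f. P f \<Longrightarrow> P (upoly_scale c f)"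
  shows "P f"
proof (rule upoly.abs_induct[of P f])
  fix p :: "(nat \<times> ('f, 'n) uop, 'f) free_alg"
  assume 1: "upoly_rel p p"
  have zero: "P 0" using scale[OF xvar, of 0] by simp
  have letter: "P (abs_upoly (letter a))" for a
    using xvar[of "fst a" "snd a"] by (simp add: xvar.abs_eq)
  have word: "P (abs_upoly (Poly_Mapping.single (Word (a # w)) 1))" for a w
  proof (induction w arbitrary: a)
    case Nil
    then show ?case using letter by (simp add: letter_def)
  next
    case (Cons b w)
    have "abs_upoly (Poly_Mapping.single (Word (a # b # w)) 1)
        = abs_upoly (letter a) * abs_upoly (Poly_Mapping.single (Word (b # w)) 1)"
      by (subst times_upoly.abs_eq)
        (simp_all add: upoly_rel_refl lookup_letter_0 lookup_single zero_fmon_def letter_def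
          mult_single plus_fmon_def)
    then show ?case using mult letter Cons by simp
  qed
  have "P (abs_upoly (p - Poly_Mapping.single 0 (Poly_Mapping.lookup p 0)))"
    for p :: "(nat \<times> ('f, 'n) uop, 'f) free_alg"
  proof (induction p rule: free_alg_induct)
    case (single w c)
    show ?case
    proof (cases "letters w")
      case Nil
      then have "w = 0" by (cases w) (simp add: zero_fmon_def)
      then show ?thesis using zero by (simp add: zero_upoly.abs_eq[symmetric])
    next
      case (Cons a v)
      then have w: "w = Word (a # v)" by (cases w) simp
      have "abs_upoly (Poly_Mapping.single w c) = upoly_scale c (abs_upoly (Poly_Mapping.single w 1))"
        by (subst upoly_scale.abs_eq)
          (simp_all add: upoly_rel_refl lookup_single w zero_fmon_def single_eq_fscale[of _ c])
      then show ?thesis using scale word by (simp add: w lookup_single zero_fmon_def)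
    qed
  next
    case (add p q)
    have "abs_upoly (p + q - Poly_Mapping.single 0 (Poly_Mapping.lookup (p + q) 0))
        = abs_upoly (p - Poly_Mapping.single 0 (Poly_Mapping.lookup p 0))
        + abs_upoly (q - Poly_Mapping.single 0 (Poly_Mapping.lookup q 0))"
      by (subst plus_upoly.abs_eq)
        (simp_all add: upoly_rel_refl lookup_minus lookup_add single_add algebra_simps)
    then show ?case using add assms(2) by simp
  qed
  from this[of p] show "P (abs_upoly p)"
    using 1 by (simp add: upoly_rel_def)
qed

section \<open>Substitutions\<close>

lemma Abs_uop_inverse': "\<phi> \<in> Uset \<Longrightarrow> uop_apply (Abs_uop \<phi>) = \<phi>"
  by (simp add: Uset_def Abs_uop_inverse)

lemma uop_apply_in_Uset: "uop_apply u \<in> Uset"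
  using uop_apply[of u] by (simp add: Uset_def)

definition uop_comp :: "('f::field, 'n::finite) uop \<Rightarrow> ('f, 'n) uop \<Rightarrow> ('f, 'n) uop" where
  "uop_comp u v = Abs_uop (uop_apply u \<circ> uop_apply v)"

lemma uop_apply_comp: "uop_apply (uop_comp u v) = uop_apply u \<circ> uop_apply v"
  by (simp add: uop_comp_def Abs_uop_inverse' Uset_closed(3) uop_apply_in_Uset)

lemma uop_comp_linear:
  "uop_comp (uop_add u u') v = uop_add (uop_comp u v) (uop_comp u' v)"
  "uop_comp (uop_scale c u) v = uop_scale c (uop_comp u v)"
  "uop_comp (uop_der_comp \<delta> u) v = uop_der_comp \<delta> (uop_comp u v)"
  by (simp_all add: uop_apply_inject[symmetric] uop_apply_comp uop_add.rep_eq uop_scale.rep_eq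
      uop_der_comp.rep_eq fun_eq_iff)

text \<open>
  The endomorphism \<open>x_i \<mapsto> x_{f i}^{v i}\<close>, which maps \<open>x_i^u\<close> to \<open>x_{f i}^{u \<circ> v i}\<close>.  It commutes with
  derivations because these act by composition on the other side.
\<close>

definition free_sub :: "(nat \<Rightarrow> nat) \<Rightarrow> (nat \<Rightarrow> ('f::field, 'n::finite) uop) \<Rightarrow>
    (nat \<times> ('f, 'n) uop, 'f) free_alg \<Rightarrow> (nat \<times> ('f, 'n) uop, 'f) free_alg" where
  "free_sub f v = linext fscale
     (\<lambda>w. Poly_Mapping.single (Word (map (\<lambda>(i, u). (f i, uop_comp u (v i))) (letters w))) 1)"

lemma free_sub_simps:
  "free_sub f v (Poly_Mapping.single w c) =
     fscale c (Poly_Mapping.single (Word (map (\<lambda>(i, u). (f i, uop_comp u (v i))) (letters w))) 1)"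
  "free_sub f v (p + q) = free_sub f v p + free_sub f v q"
  "free_sub f v (p - q) = free_sub f v p - free_sub f v q"
  "free_sub f v (fscale c p) = fscale c (free_sub f v p)"
  "free_sub f v 0 = 0"
  by (simp_all add: free_sub_def linext_zero linext_single linext_add linext_diff
      linext_fscale module_fscale)

lemma free_sub_letter: "free_sub f v (letter (i, u)) = letter (f i, uop_comp u (v i))"
  by (simp add: letter_def free_sub_simps fscale_module_laws)

lemma free_sub_mult: "free_sub f v (p * q) = free_sub f v p * free_sub f v q"
proof (induction p rule: free_alg_induct)
  case (single w c)
  show ?case
    by (induction q rule: free_alg_induct)
      (simp_all add: mult_single free_sub_simps plus_fmon_def distrib_left fscale_mult_left
        fscale_mult_right fscale_module_laws mult.commute)
qed (simp add: algebra_simps free_sub_simps)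

lemma lookup_free_sub_0: "Poly_Mapping.lookup (free_sub f v p) 0 = Poly_Mapping.lookup p 0"
proof (induction p rule: free_alg_induct)
  case (single w c)
  show ?case
    by (cases w) (auto simp: free_sub_simps(1) fscale_def mult_single lookup_single zero_fmon_def when_def
        plus_fmon_def)
qed (simp add: free_sub_simps lookup_add)

lemma free_sub_ideal: "p \<in> ideal_gen upoly_rels \<Longrightarrow> free_sub f v p \<in> ideal_gen upoly_rels"
proof (induction rule: ideal_gen.induct)
  case (base r)
  then have "free_sub f v r \<in> upoly_rels"
    by (auto simp: upoly_rels_def free_sub_simps free_sub_letter uop_comp_linear) blast+
  then show ?case by (rule ideal_gen.base)
qed (auto simp: free_sub_simps free_sub_mult intro: ideal_gen.intros)

lift_definition usub :: "(nat \<Rightarrow> nat) \<Rightarrow> (nat \<Rightarrow> ('f::field, 'n::finite) uop) \<Rightarrow>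
    ('f, 'n) upoly \<Rightarrow> ('f, 'n) upoly" is free_sub
  by (auto simp: upoly_rel_def lookup_free_sub_0 free_sub_simps(3)[symmetric] free_sub_ideal)

lemma usub_xvar: "usub f v (xvar i u) = xvar (f i) (uop_comp u (v i))"
  by transfer (simp add: free_sub_letter upoly_rel_refl lookup_letter_0)

lemma usub_mult: "usub f v (p * q) = usub f v p * usub f v q"
  by transfer (auto simp: free_sub_mult upoly_rel_def ideal_gen.zero free_alg_lookup_mult_0
      lookup_free_sub_0)

lemma usub_linear:
  "usub f v (p + q) = usub f v p + usub f v q"
  "usub f v (upoly_scale c p) = upoly_scale c (usub f v p)"
  by (transfer; auto simp: free_sub_simps upoly_rel_def ideal_gen.zero lookup_add
      lookup_fscale_0 lookup_free_sub_0)+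

lemma usub_endomorphism: "upoly_endomorphism (usub f v)"
  unfolding upoly_endomorphism_def module_hom_iff
  by (simp add: module_upoly_scale usub_linear usub_mult)

lemma usub_lact: "usub f v (lact \<delta> p) = lact \<delta> (usub f v p)"
  by (induction p rule: upoly_induct)
    (simp_all add: lact_xvar usub_xvar lact_linear usub_linear lact_mult usub_mult uop_comp_linear)

lemma usub_diff: "usub f v (p - q) = usub f v p - usub f v q"
  using usub_linear(1)[of f v "p - q" q] by simp

section \<open>The ideal of identities\<close>

lemma ueval_lact: "ueval m (lact \<delta> p) = der_apply \<delta> (ueval m p)"
proof (induction p rule: upoly_induct)
  case (mult p q)
  then show ?case
    using der_apply_derivation[of \<delta>]
    by (simp add: lact_mult ueval_linear ueval_mult mat_derivation_def)
qed (simp_all add: lact_xvar ueval_xvar uop_der_comp.rep_eq lact_linear ueval_linear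
    der_apply_linear)

lemma ueval_zero: "ueval m 0 = 0"
  using ueval_linear(2)[of m 0 0] by simp

lemma ueval_diff: "ueval m (p - q) = ueval m p - ueval m q"
  using ueval_linear(1)[of m "p - q" q] by simp

text \<open>
  The symbols \<open>x_i^u\<close> are obtained from \<open>x_i\<close> by the action of the enveloping algebra.  Both \<open>\<psi>\<close> and the
  evaluation commute with that action, so \<open>\<psi>\<close> followed by the evaluation at \<open>m\<close> is the evaluation at
  the images of the \<open>x_i\<close>.
\<close>

lemma ueval_endomorphism:
  fixes \<psi> :: "('f::field, 'n::finite) upoly \<Rightarrow> ('f, 'n) upoly"
  assumes \<psi>: "upoly_endomorphism \<psi>" and comm: "\<And>\<delta> f. \<psi> (lact \<delta> f) = lact \<delta> (\<psi> f)"
  shows "ueval m (\<psi> p) = ueval (\<lambda>i. ueval m (\<psi> (xvar i (Abs_uop id)))) p"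
proof -
  define m' where "m' i = ueval m (\<psi> (xvar i (Abs_uop id)))" for i
  have lin: "\<psi> (f + h) = \<psi> f + \<psi> h" "\<psi> (upoly_scale c f) = upoly_scale c (\<psi> f)"
    "\<psi> (f * h) = \<psi> f * \<psi> h" for f h c
    using \<psi> by (auto simp: upoly_endomorphism_def module_hom_iff)
  have id: "(id :: ('f, 'n) sqmat \<Rightarrow> _) \<in> Uset" by (rule Uset_closed)
  have word: "ueval m (\<psi> (xvar i (Abs_uop (der_word ds)))) = der_word ds (m' i)
      \<and> (der_word ds :: ('f, 'n) sqmat \<Rightarrow> _) \<in> Uset" for i and ds :: "('f, 'n) der list"
  proof (induction ds)
    case Nil
    show ?case using id by (simp add: m'_def id_def)
  next
    case (Cons \<delta> ds)
    have comp: "der_word (\<delta> # ds) = der_apply \<delta> \<circ> der_word ds" by (simp add: fun_eq_iff)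
    have "Abs_uop (der_word (\<delta> # ds)) = uop_der_comp \<delta> (Abs_uop (der_word ds))"
      using Cons by (simp add: uop_apply_inject[symmetric] uop_der_comp.rep_eq Abs_uop_inverse' comp
          Uset_closed)
    then have "xvar i (Abs_uop (der_word (\<delta> # ds))) = lact \<delta> (xvar i (Abs_uop (der_word ds)))"
      by (simp add: lact_xvar)
    moreover have "der_word (\<delta> # ds) \<in> (Uset :: (('f, 'n) sqmat \<Rightarrow> _) set)"
      unfolding comp using Cons by (intro Uset_closed) simp
    ultimately show ?case
      using Cons by (simp add: comm ueval_lact comp comp_def del: der_word.simps)
  qed
  have "ueval m (\<psi> (xvar i (Abs_uop (free_der_action p)))) = free_der_action p (m' i)
      \<and> free_der_action p \<in> Uset" for i and p :: "(('f, 'n) der, 'f) free_alg"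
  proof (induction p rule: free_alg_induct)
    case (single w c)
    let ?\<phi> = "der_word (letters w)"
    have eq: "free_der_action (Poly_Mapping.single w c) = (\<lambda>m. mscale c (?\<phi> m))"
      by (simp add: fun_eq_iff free_der_action_simps)
    have "Abs_uop (\<lambda>m. mscale c (?\<phi> m)) = uop_scale c (Abs_uop ?\<phi>)"
      using word[of 0 "letters w"]
      by (simp add: uop_apply_inject[symmetric] uop_scale.rep_eq Abs_uop_inverse' Uset_closed)
    then show ?case
      using word[of i "letters w"] by (simp add: eq xvar_scale lin ueval_linear Uset_closed)
  next
    case (add p q)
    have eq: "free_der_action (p + q) = (\<lambda>m. free_der_action p m + free_der_action q m)"
      by (simp add: fun_eq_iff free_der_action_simps)
    have "Abs_uop (\<lambda>m. free_der_action p m + free_der_action q m)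
        = uop_add (Abs_uop (free_der_action p)) (Abs_uop (free_der_action q))"
      using add by (simp add: uop_apply_inject[symmetric] uop_add.rep_eq Abs_uop_inverse' Uset_closed)
    then show ?case
      using add by (simp add: eq xvar_add lin ueval_linear Uset_closed)
  qed
  moreover have "\<exists>p. uop_apply u = free_der_action p" for u :: "('f, 'n) uop"
  proof -
    obtain a where "uop_apply u = uea_hom a" using uop_apply[of u] by auto
    moreover have "\<exists>p. uea_hom a = free_der_action p" by transfer auto
    ultimately show ?thesis by metis
  qed
  ultimately have x: "ueval m (\<psi> (xvar i u)) = uop_apply u (m' i)" for i u
    by (metis uop_apply_inverse)
  show ?thesis unfolding m'_def[symmetric]
    by (induction p rule: upoly_induct)
      (simp_all add: x ueval_xvar lin ueval_linear ueval_mult)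
qed

lemma TU_ideal_identities: "TU_ideal (U_identities :: ('f::field, 'n::finite) upoly set)"
proof -
  have "module.subspace upoly_scale (U_identities :: ('f, 'n) upoly set)"
    by (simp add: uvs.subspace_def U_identities_def ueval_zero ueval_linear)
  moreover have "f * h \<in> U_identities \<and> h * f \<in> U_identities" if "f \<in> U_identities"
    for f h :: "('f, 'n) upoly"
    using that by (simp add: U_identities_def ueval_mult matrix_mult_distrib)
  moreover have "lact \<delta> ` U_identities \<subseteq> (U_identities :: ('f, 'n) upoly set)" for \<delta>
    using der_apply_linear(2)[of \<delta> 0 0] by (auto simp: U_identities_def ueval_lact)
  moreover have "\<psi> ` U_identities \<subseteq> U_identities"
    if "upoly_endomorphism \<psi> \<and> (\<forall>\<delta> f. \<psi> (lact \<delta> f) = lact \<delta> (\<psi> f))"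
    for \<psi> :: "('f, 'n) upoly \<Rightarrow> ('f, 'n) upoly"
  proof clarify
    fix f assume f: "f \<in> (U_identities :: ('f, 'n) upoly set)"
    have "ueval m (\<psi> f) = 0" for m
      using f that by (subst ueval_endomorphism) (auto simp: U_identities_def)
    then show "\<psi> f \<in> U_identities" by (simp add: U_identities_def)
  qed
  ultimately show ?thesis unfolding TU_ideal_def by blast
qed

section \<open>Symbols of rank one operators and of the scalar projection\<close>

definition xop :: "nat \<Rightarrow> (('f::field, 'n::finite) sqmat \<Rightarrow> ('f, 'n) sqmat) \<Rightarrow> ('f, 'n) upoly" where
  "xop i \<phi> = xvar i (Abs_uop \<phi>)"

lemma xop_add: "\<phi> \<in> Uset \<Longrightarrow> \<psi> \<in> Uset \<Longrightarrow> xop i (\<lambda>m. \<phi> m + \<psi> m) = xop i \<phi> + xop i \<psi>"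
proof -
  assume "\<phi> \<in> Uset" "\<psi> \<in> Uset"
  then have "Abs_uop (\<lambda>m. \<phi> m + \<psi> m) = uop_add (Abs_uop \<phi>) (Abs_uop \<psi>)"
    by (simp add: uop_apply_inject[symmetric] uop_add.rep_eq Abs_uop_inverse' Uset_closed)
  then show ?thesis by (simp add: xop_def xvar_add)
qed

lemma xop_scale: "\<phi> \<in> Uset \<Longrightarrow> xop i (\<lambda>m. mscale c (\<phi> m)) = upoly_scale c (xop i \<phi>)"
proof -
  assume "\<phi> \<in> Uset"
  then have "Abs_uop (\<lambda>m. mscale c (\<phi> m)) = uop_scale c (Abs_uop \<phi>)"
    by (simp add: uop_apply_inject[symmetric] uop_scale.rep_eq Abs_uop_inverse' Uset_closed)
  then show ?thesis by (simp add: xop_def xvar_scale)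
qed

lemma xop_zero: "xop i (\<lambda>m. 0) = 0"
  using xop_scale[OF Uset_zero, of i 0] by simp

lemma xop_sum:
  "(\<And>x. x \<in> A \<Longrightarrow> \<phi> x \<in> Uset) \<Longrightarrow> xop i (\<lambda>m. \<Sum>x\<in>A. \<phi> x m) = (\<Sum>x\<in>A. xop i (\<phi> x))"
  by (induction A rule: infinite_finite_induct) (auto simp: xop_zero xop_add Uset_sum)

lemma lact_xop: "\<phi> \<in> Uset \<Longrightarrow> lact (ad_der c) (xop i \<phi>) = xop i (bracket c \<circ> \<phi>)"
proof -
  assume "\<phi> \<in> Uset"
  then have "uop_der_comp (ad_der c) (Abs_uop \<phi>) = Abs_uop (bracket c \<circ> \<phi>)"
    by (simp add: uop_apply_inject[symmetric] uop_der_comp.rep_eq Abs_uop_inverse' Uset_closed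
        der_apply_ad Uset_bracket)
  then show ?thesis by (simp add: xop_def lact_xvar)
qed

lemma usub_xop: "\<phi> \<in> Uset \<Longrightarrow> usub f v (xop i \<phi>) = xop (f i) (\<phi> \<circ> uop_apply (v i))"
  by (simp add: xop_def usub_xvar uop_comp_def Abs_uop_inverse')

lemma ueval_xop: "\<phi> \<in> Uset \<Longrightarrow> ueval m (xop i \<phi>) = \<phi> (m i)"
  by (simp add: xop_def ueval_xvar Abs_uop_inverse')

lemma sl_part_linear:
  "sl_part (a + b) = sl_part a + sl_part b" "sl_part (mscale c a) = mscale c (sl_part a)"
  by (simp_all add: sl_part_def scalar_part_def trace_simps mscale_distrib add_divide_distrib
      algebra_simps)

lemma bracket_sl_part: "bracket c (sl_part b) = bracket c b"
proof -
  have "bracket c (scalar_part b) = 0"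
    by (simp add: bracket_def scalar_part_def)
  then show ?thesis by (simp add: sl_part_def bracket_linear)
qed

text \<open>
  Projecting both arguments to \<open>sl\<close> keeps the operator in \<open>U\<close> and makes the symbol bilinear on all
  matrices.
\<close>

definition xsl :: "nat \<Rightarrow> ('f::field, 'n::finite) sqmat \<Rightarrow> ('f, 'n) sqmat \<Rightarrow> ('f, 'n) upoly" where
  "xsl i w b = xop i (rank_one (sl_part w) (sl_part b))"

definition xscalar :: "nat \<Rightarrow> ('f::field, 'n::finite) upoly" where
  "xscalar i = xop i scalar_part"

lemma xsl_sl_part:
  fixes b :: "('f::field_char_0, 'n::finite) sqmat"
  shows "xsl i w (sl_part b) = xsl i w b"
  by (simp add: xsl_def sl_part_sl sl_part_in_sl)

context
  assumes card: "CARD('n::finite) \<ge> 2"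
begin

lemma rank_one_sl_part: "rank_one (sl_part w) (sl_part b) \<in> (Uset :: (('f::field_char_0, 'n) sqmat \<Rightarrow> _) set)"
  by (rule rank_one_in_Uset[OF card sl_part_in_sl sl_part_in_sl])

lemma xsl_linear:
  fixes a b :: "('f::field_char_0, 'n) sqmat"
  shows "xsl i w (a + b) = xsl i w a + xsl i w b" "xsl i w (mscale c a) = upoly_scale c (xsl i w a)"
proof -
  have "rank_one (sl_part w) (sl_part (a + b))
      = (\<lambda>m. rank_one (sl_part w) (sl_part a) m + rank_one (sl_part w) (sl_part b) m)"
    "rank_one (sl_part w) (sl_part (mscale c a)) = (\<lambda>m. mscale c (rank_one (sl_part w) (sl_part a) m))"
    by (simp_all add: fun_eq_iff rank_one_linear sl_part_linear)
  then show "xsl i w (a + b) = xsl i w a + xsl i w b" "xsl i w (mscale c a) = upoly_scale c (xsl i w a)"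
    by (simp_all add: xsl_def xop_add xop_scale rank_one_sl_part)
qed

lemma lact_xsl:
  fixes b :: "('f::field_char_0, 'n) sqmat"
  shows "lact (ad_der c) (xsl i w b) = xsl i w (bracket c b)"
proof -
  have "bracket c \<circ> rank_one (sl_part w) (sl_part b) = rank_one (sl_part w) (sl_part (bracket c b))"
    by (simp add: fun_eq_iff rank_one_def bracket_linear bracket_sl_part sl_part_sl bracket_in_sl)
  then show ?thesis by (simp add: xsl_def lact_xop rank_one_sl_part)
qed

lemma lact_xscalar: "lact (ad_der c) (xscalar i :: ('f::field_char_0, 'n) upoly) = 0"
proof -
  have "bracket c \<circ> scalar_part = (\<lambda>m. 0)"
    by (simp add: fun_eq_iff bracket_def scalar_part_def)
  then show ?thesis by (simp add: xscalar_def lact_xop scalar_part_in_Uset[OF card] xop_zero)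
qed

text \<open>
  The composition of \<open>m \<mapsto> tr(m w') a\<close> with \<open>m \<mapsto> tr(m w) b\<close> is \<open>m \<mapsto> tr(a w) tr(m w') b\<close>.
\<close>

lemma usub_xsl:
  fixes w w' a b :: "('f::field_char_0, 'n) sqmat"
  assumes "v i = Abs_uop (rank_one (sl_part w') (sl_part a))" "trace (sl_part a ** sl_part w) = 1"
  shows "usub f v (xsl i w b) = xsl (f i) w' b"
proof -
  have "rank_one (sl_part w) (sl_part b) \<circ> rank_one (sl_part w') (sl_part a) = rank_one (sl_part w') (sl_part b)"
    using assms(2) by (simp add: fun_eq_iff rank_one_def mscale_mult_left trace_simps)
  then show ?thesis
    by (simp add: xsl_def usub_xop rank_one_sl_part assms(1) Abs_uop_inverse')
qed

lemma usub_xscalar: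
  assumes "v i = Abs_uop id"
  shows "usub f v (xscalar i :: ('f::field_char_0, 'n) upoly) = xscalar (f i)"
  by (simp add: xscalar_def usub_xop scalar_part_in_Uset[OF card] assms Abs_uop_inverse' Uset_closed)

lemma ueval_xsl:
  fixes b :: "('f::field_char_0, 'n) sqmat"
  shows "ueval m (xsl i w b) = mscale (trace (m i ** sl_part w)) (sl_part b)"
  by (simp add: xsl_def ueval_xop rank_one_sl_part rank_one_def)

lemma ueval_xscalar: "ueval m (xscalar i :: ('f::field_char_0, 'n) upoly) = scalar_part (m i)"
  by (simp add: xscalar_def ueval_xop scalar_part_in_Uset[OF card])

lemma xvar_expand:
  fixes u :: "('f::field_char_0, 'n) uop"
  shows "\<exists>b c. (\<forall>s. b s \<in> sl) \<and>
    xvar i u = (\<Sum>s\<in>UNIV - {(w, w)}. xsl i (slot s) (b s)) + upoly_scale c (xscalar i)"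
proof -
  have u: "uop_apply u \<in> Uset" by (rule uop_apply_in_Uset)
  obtain c where c: "uop_apply u (mat 1) = mscale c (mat 1)" using Uset_one[OF u] .
  define b where "b s = uop_apply u (sl_vec w s)" for s
  have b: "b s \<in> sl" for s by (simp add: b_def Uset_sl[OF u] sl_vec_in_sl)
  have rank_one: "rank_one (slot s) (b s) \<in> Uset" for s
    by (rule rank_one_in_Uset[OF card slot_in_sl b])
  have "uop_apply u = (\<lambda>m. (\<Sum>s\<in>UNIV - {(w, w)}. rank_one (slot s) (b s) m) + mscale c (scalar_part m))"
    using Uset_expand[OF u c] by (simp add: fun_eq_iff b_def)
  then have "xop i (uop_apply u) = (\<Sum>s\<in>UNIV - {(w, w)}. xop i (rank_one (slot s) (b s))) + upoly_scale c (xop i scalar_part)"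
    by (simp add: xop_add xop_sum xop_scale Uset_sum Uset_closed rank_one scalar_part_in_Uset[OF card])
  then have "xvar i u = (\<Sum>s\<in>UNIV - {(w, w)}. xsl i (slot s) (b s)) + upoly_scale c (xscalar i)"
    by (simp add: xop_def[of i "uop_apply u"] uop_apply_inverse xsl_def xscalar_def sl_part_sl b slot_in_sl)
  then show ?thesis using b by blast
qed

end

section \<open>Homogeneous components\<close>

text \<open>
  \<open>homog w \<kappa> a f\<close> says that \<open>f\<close> is a combination of words whose letters read off the coordinates in
  \<open>\<kappa>\<close>, and that multiplying out the matrices in these words gives \<open>a\<close> altogether.  The pair
  \<open>(w, w)\<close>, which is not the index of a basis vector of \<open>sl\<close>, stands for the scalar coordinate.
\<close>

inductive homog :: "'n \<Rightarrow> (nat \<times> 'n \<times> 'n) multiset \<Rightarrow> ('f::field_char_0, 'n::finite) sqmat \<Rightarrow>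
    ('f, 'n) upoly \<Rightarrow> bool" for w :: 'n where
  zero: "homog w \<kappa> 0 0"
| add: "homog w \<kappa> a f \<Longrightarrow> homog w \<kappa> b h \<Longrightarrow> homog w \<kappa> (a + b) (f + h)"
| scale: "homog w \<kappa> a f \<Longrightarrow> homog w \<kappa> (mscale c a) (upoly_scale c f)"
| xscalar: "homog w {#(i, w, w)#} (mat 1) (xscalar i)"
| xsl: "s \<noteq> (w, w) \<Longrightarrow> b \<in> sl \<Longrightarrow> homog w {#(i, s)#} b (xsl i (slot s) b)"
| xscalar_mult: "homog w \<kappa> a f \<Longrightarrow> \<kappa> \<noteq> {#} \<Longrightarrow> homog w (add_mset (i, w, w) \<kappa>) a (xscalar i * f)"
| xsl_mult: "homog w \<kappa> a f \<Longrightarrow> \<kappa> \<noteq> {#} \<Longrightarrow> s \<noteq> (w, w) \<Longrightarrow> b \<in> sl \<Longrightarrow>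
    homog w (add_mset (i, s) \<kappa>) (b ** a) (xsl i (slot s) b * f)"

lemma homog_mult:
  assumes "homog w \<kappa> a f" "homog w \<mu> b h" "\<kappa> \<noteq> {#}" "\<mu> \<noteq> {#}"
  shows "homog w (\<kappa> + \<mu>) (a ** b) (f * h)"
  using assms
proof (induction rule: homog.induct)
  case (zero \<kappa>)
  then show ?case by (simp add: matrix_mult_distrib homog.zero)
next
  case (xsl_mult \<kappa> a f s c i)
  then have "homog w (add_mset (i, s) (\<kappa> + \<mu>)) (c ** (a ** b)) (xsl i (slot s) c * (f * h))"
    by (intro homog.xsl_mult) auto
  then show ?case by (simp add: matrix_mul_assoc mult.assoc)
qed (auto simp: matrix_mult_distrib distrib_right mscale_mult_left upoly_scale_mult_left mult.assoc
    intro: homog.intros)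

definition coord :: "'n \<Rightarrow> (nat \<Rightarrow> ('f::field, 'n::finite) sqmat) \<Rightarrow> nat \<times> 'n \<times> 'n \<Rightarrow> 'f" where
  "coord w m x = (if snd x = (w, w) then trace (m (fst x)) / of_nat CARD('n)
     else trace (m (fst x) ** slot (snd x)))"

lemma ueval_homog:
  fixes f :: "('f::field_char_0, 'n::finite) upoly"
  assumes card: "CARD('n) \<ge> 2" and "homog w \<kappa> a f"
  shows "ueval m f = mscale (\<Prod>x\<in>#\<kappa>. coord w m x) a"
  using assms(2)
proof (induction rule: homog.induct)
  case (xsl_mult \<kappa> a f s b i)
  then show ?case
    by (simp add: ueval_mult ueval_xsl[OF card] sl_part_sl slot_in_sl coord_def mscale_mult_left
        mscale_mult_right mult.commute)
qed (auto simp: ueval_zero ueval_linear mscale_distrib ueval_mult ueval_xscalar[OF card]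
    ueval_xsl[OF card] scalar_part_def coord_def sl_part_sl slot_in_sl mult.commute)

definition decomposable :: "'n \<Rightarrow> ('f::field_char_0, 'n::finite) upoly \<Rightarrow> bool" where
  "decomposable w f \<longleftrightarrow> (\<exists>A b F. finite A \<and> (\<forall>\<kappa>. homog w \<kappa> (b \<kappa>) (F \<kappa>)) \<and> {#} \<notin> A \<and> f = (\<Sum>\<kappa>\<in>A. F \<kappa>))"

lemma decomposable_homog:
  assumes "homog w \<kappa> a f" "\<kappa> \<noteq> {#}"
  shows "decomposable w f"
  unfolding decomposable_def
  by (rule exI[of _ "{\<kappa>}"], rule exI[of _ "\<lambda>\<kappa>'. if \<kappa>' = \<kappa> then a else 0"],
      rule exI[of _ "\<lambda>\<kappa>'. if \<kappa>' = \<kappa> then f else 0"]) (use assms homog.zero in auto)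

lemma decomposable_zero: "decomposable w 0"
  unfolding decomposable_def
  by (rule exI[of _ "{}"], rule exI[of _ "\<lambda>_. 0"], rule exI[of _ "\<lambda>_. 0"]) (simp add: homog.zero)

lemma decomposable_add:
  assumes "decomposable w f" "decomposable w h"
  shows "decomposable w (f + h)"
proof -
  obtain A a F where A: "finite A" "\<And>\<kappa>. homog w \<kappa> (a \<kappa>) (F \<kappa>)" "{#} \<notin> A" "f = (\<Sum>\<kappa>\<in>A. F \<kappa>)"
    using assms(1) unfolding decomposable_def by blast
  obtain B b H where B: "finite B" "\<And>\<kappa>. homog w \<kappa> (b \<kappa>) (H \<kappa>)" "{#} \<notin> B" "h = (\<Sum>\<kappa>\<in>B. H \<kappa>)"
    using assms(2) unfolding decomposable_def by blast
  define a' b' F' H' where "a' \<kappa> = (if \<kappa> \<in> A then a \<kappa> else 0)" and "b' \<kappa> = (if \<kappa> \<in> B then b \<kappa> else 0)"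
    and "F' \<kappa> = (if \<kappa> \<in> A then F \<kappa> else 0)" and "H' \<kappa> = (if \<kappa> \<in> B then H \<kappa> else 0)" for \<kappa>
  have h: "homog w \<kappa> (a' \<kappa> + b' \<kappa>) (F' \<kappa> + H' \<kappa>)" for \<kappa>
    using A(2) B(2) by (auto simp: a'_def b'_def F'_def H'_def intro!: homog.add homog.zero)
  have "f = (\<Sum>\<kappa>\<in>A \<union> B. F' \<kappa>)" "h = (\<Sum>\<kappa>\<in>A \<union> B. H' \<kappa>)"
    unfolding A(4) B(4) F'_def H'_def using A(1) B(1)
    by (auto intro!: sum.mono_neutral_cong_left)
  then have "f + h = (\<Sum>\<kappa>\<in>A \<union> B. F' \<kappa> + H' \<kappa>)" by (simp add: sum.distrib)
  then show ?thesis
    unfolding decomposable_def using A(1,3) B(1,3) h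
    by (intro exI[of _ "A \<union> B"] exI[of _ "\<lambda>\<kappa>. a' \<kappa> + b' \<kappa>"] exI[of _ "\<lambda>\<kappa>. F' \<kappa> + H' \<kappa>"]) auto
qed

lemma decomposable_sum: "(\<And>x. x \<in> A \<Longrightarrow> decomposable w (f x)) \<Longrightarrow> decomposable w (\<Sum>x\<in>A. f x)"
  by (induction A rule: infinite_finite_induct) (auto simp: decomposable_zero decomposable_add)

lemma decomposable:
  fixes f :: "('f::field_char_0, 'n::finite) upoly"
  assumes card: "CARD('n) \<ge> 2"
  shows "decomposable w f"
proof (induction f rule: upoly_induct)
  case (xvar i u)
  obtain b :: "'n \<times> 'n \<Rightarrow> ('f, 'n) sqmat" and c where b: "\<And>s. b s \<in> sl"
    "xvar i u = (\<Sum>s\<in>UNIV - {(w, w)}. xsl i (slot s) (b s)) + upoly_scale c (xscalar i)"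
    using xvar_expand[OF card, of i u w] by blast
  have "decomposable w (xsl i (slot s) (b s))" if "s \<noteq> (w, w)" for s
    using decomposable_homog[OF homog.xsl[OF that b(1)]] by simp
  moreover have "decomposable w (upoly_scale c (xscalar i))"
    using decomposable_homog[OF homog.scale[OF homog.xscalar]] by simp
  ultimately show ?case
    unfolding b(2) by (intro decomposable_add decomposable_sum) auto
next
  case (mult f h)
  obtain A a F where A: "finite A" "\<And>\<kappa>. homog w \<kappa> (a \<kappa>) (F \<kappa>)" "{#} \<notin> A" "f = (\<Sum>\<kappa>\<in>A. F \<kappa>)"
    using mult(1) unfolding decomposable_def by blast
  obtain B b H where B: "finite B" "\<And>\<kappa>. homog w \<kappa> (b \<kappa>) (H \<kappa>)" "{#} \<notin> B" "h = (\<Sum>\<kappa>\<in>B. H \<kappa>)"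
    using mult(2) unfolding decomposable_def by blast
  have "decomposable w (F \<kappa> * H \<mu>)" if "\<kappa> \<in> A" "\<mu> \<in> B" for \<kappa> \<mu>
    using decomposable_homog[OF homog_mult[OF A(2) B(2), of \<kappa> \<mu>]] that A(3) B(3) by auto
  then show ?case
    unfolding A(4) B(4) sum_product by (intro decomposable_sum) auto
next
  case (scale c f)
  obtain A a F where A: "finite A" "\<And>\<kappa>. homog w \<kappa> (a \<kappa>) (F \<kappa>)" "{#} \<notin> A" "f = (\<Sum>\<kappa>\<in>A. F \<kappa>)"
    using scale unfolding decomposable_def by blast
  have "decomposable w (upoly_scale c (F \<kappa>))" if "\<kappa> \<in> A" for \<kappa>
    by (rule decomposable_homog[OF homog.scale[OF A(2)]]) (use that A(3) in auto)
  then show ?case unfolding A(4) by (simp add: uvs.scale_sum_right decomposable_sum)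
qed (rule decomposable_add)

text \<open>
  Dedekind's argument: if two monomials differ in the exponent of \<open>v\<close>, then doubling the variable \<open>v\<close>
  multiplies them by different powers of \<open>2\<close>, so that one of them can be eliminated from the relation.
\<close>

lemma monomials_independent:
  fixes c :: "'x multiset \<Rightarrow> 'f::field_char_0"
  assumes "finite A" and "\<And>t. (\<Sum>\<kappa>\<in>A. c \<kappa> * (\<Prod>x\<in>#\<kappa>. t x)) = 0" and "\<kappa> \<in> A"
  shows "c \<kappa> = 0"
  using assms
proof (induction A arbitrary: c \<kappa> rule: finite_induct)
  case (insert \<kappa>\<^sub>0 A)
  have A: "c \<kappa> = 0" if \<kappa>: "\<kappa> \<in> A" for \<kappa>
  proof -
    have "\<kappa> \<noteq> \<kappa>\<^sub>0" using insert.hyps \<kappa> by blast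
    then obtain v where v: "count \<kappa> v \<noteq> count \<kappa>\<^sub>0 v" by (auto simp: multiset_eq_iff)
    define d where "d \<mu> = c \<mu> * (2 ^ count \<mu> v - 2 ^ count \<kappa>\<^sub>0 v)" for \<mu>
    have double: "(\<Prod>x\<in>#\<mu>. (t(v := 2 * t v)) x) = 2 ^ count \<mu> v * (\<Prod>x\<in>#\<mu>. t x)"
      for \<mu> and t :: "'x \<Rightarrow> 'f"
      by (induction \<mu>) (auto simp: mult_ac)
    have "(\<Sum>\<mu>\<in>A. d \<mu> * (\<Prod>x\<in>#\<mu>. t x)) = 0" for t
    proof -
      have "(\<Sum>\<mu>\<in>insert \<kappa>\<^sub>0 A. d \<mu> * (\<Prod>x\<in>#\<mu>. t x))
          = (\<Sum>\<mu>\<in>insert \<kappa>\<^sub>0 A. c \<mu> * (\<Prod>x\<in>#\<mu>. (t(v := 2 * t v)) x))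
          - 2 ^ count \<kappa>\<^sub>0 v * (\<Sum>\<mu>\<in>insert \<kappa>\<^sub>0 A. c \<mu> * (\<Prod>x\<in>#\<mu>. t x))"
        unfolding sum_distrib_left sum_subtractf[symmetric] double
        by (intro sum.cong) (auto simp: d_def algebra_simps)
      then show ?thesis
        using insert.prems(1) insert.hyps by (simp add: d_def)
    qed
    then have "d \<kappa> = 0" using insert.IH \<kappa> by blast
    moreover have "(2::'f) ^ count \<kappa> v \<noteq> 2 ^ count \<kappa>\<^sub>0 v"
    proof -
      have "(2::nat) ^ count \<kappa> v \<noteq> 2 ^ count \<kappa>\<^sub>0 v" using v by simp
      then have "of_nat (2 ^ count \<kappa> v) \<noteq> (of_nat (2 ^ count \<kappa>\<^sub>0 v) :: 'f)"
        by (simp only: of_nat_eq_iff not_False_eq_True)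
      then show ?thesis by simp
    qed
    ultimately show ?thesis by (simp add: d_def)
  qed
  have "(\<Sum>\<mu>\<in>insert \<kappa>\<^sub>0 A. c \<mu> * (\<Prod>x\<in>#\<mu>. (1::'f))) = 0"
    by (rule insert.prems(1))
  then have "c \<kappa>\<^sub>0 = 0" using insert.hyps A by simp
  then show ?case using A insert.prems(2) by blast
qed simp

text \<open>
  The coordinates of generic matrices can be prescribed independently.
\<close>

lemma coord_surj:
  fixes t :: "nat \<times> 'n::finite \<times> 'n \<Rightarrow> 'f::field_char_0"
  shows "\<exists>m. coord w m = t"
proof -
  define m where "m i = mscale (t (i, w, w)) (mat 1)
    + (\<Sum>s\<in>UNIV - {(w, w)}. mscale (t (i, s)) (sl_vec w s))" for i
  have "mvs.subspace (sl :: ('f, 'n) sqmat set)" by (rule subspace_sl)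
  then have S: "(\<Sum>s\<in>UNIV - {(w, w)}. mscale (t (i, s)) (sl_vec w s)) \<in> sl" for i
    by (rule mvs.subspace_sum) (simp add: sl_def trace_simps sl_vec_in_sl[unfolded sl_def, simplified])
  have tr: "trace (m i) = of_nat CARD('n) * t (i, w, w)" for i
    using S[of i] by (simp add: m_def trace_simps trace_I sl_def mult.commute)
  then have slm: "sl_part (m i) = (\<Sum>s\<in>UNIV - {(w, w)}. mscale (t (i, s)) (sl_vec w s))" for i
    unfolding sl_part_def scalar_part_def tr by (simp add: m_def)
  have "sl_part (m i) $ p $ q = t (i, p, q)" if "(p, q) \<noteq> (w, w)" for i p q
  proof -
    have "sl_part (m i) $ p $ q = (\<Sum>s\<in>UNIV - {(w, w)}. if s = (p, q) then t (i, p, q) else 0)"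
      unfolding slm sum_component using that
      by (intro sum.cong) (auto simp: sl_vec_def E_nth)
    then show ?thesis using that by simp
  qed
  then have "coord w m x = t x" for x
    by (cases x) (auto simp: coord_def tr trace_slot)
  then show ?thesis by blast
qed

section \<open>Quotients by ideals that contain the generators\<close>

lemma mset_eq_invariant:
  fixes F :: "'a list \<Rightarrow> 'b"
  assumes swap: "\<And>x y xs. F (x # y # xs) = F (y # x # xs)"
    and cong: "\<And>x xs ys. F xs = F ys \<Longrightarrow> length xs = length ys \<Longrightarrow> F (x # xs) = F (x # ys)"
    and "mset xs = mset ys"
  shows "F xs = F ys"
  using assms(3)
proof (induction xs arbitrary: ys)
  case (Cons x xs)
  have front: "F (A @ x # B) = F (x # A @ B)" for A B
  proof (induction A)
    case (Cons a A)
    have "F (a # A @ x # B) = F (a # x # A @ B)" by (rule cong[OF Cons]) simp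
    also have "\<dots> = F (x # a # A @ B)" by (rule swap)
    finally show ?case by simp
  qed simp
  have "x \<in> set ys" using mset_eq_setD[OF Cons.prems] by auto
  then obtain A B where ys: "ys = A @ x # B" by (auto dest: split_list)
  then have eq: "mset xs = mset (A @ B)" using Cons.prems by simp
  then have "F (x # xs) = F (x # A @ B)"
    using cong[OF Cons.IH[OF eq] mset_eq_length[OF eq]] by blast
  then show ?case by (simp add: ys front)
qed simp

lemma ex_projection:
  assumes "vector_space s" "module.subspace s I"
  shows "\<exists>\<pi>. Vector_Spaces.linear s s \<pi> \<and> (\<forall>v. v - \<pi> v \<in> I) \<and> (\<forall>v\<in>I. \<pi> v = 0)"
proof -
  interpret vector_space s by fact
  interpret pair: vector_space_pair s s by unfold_locales
  obtain B where B: "B \<subseteq> I" "independent B" "I \<subseteq> span B"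
    using maximal_independent_subset[of I] .
  have span: "span B = I" by (rule subset_antisym[OF span_minimal[OF B(1) assms(2)] B(3)])
  obtain \<pi> where \<pi>: "Vector_Spaces.linear s s \<pi>"
    "\<forall>x\<in>extend_basis B. \<pi> x = (if x \<in> B then 0 else x)"
    using pair.linear_independent_extend[OF independent_extend_basis[OF B(2)],
        of "\<lambda>x. if x \<in> B then 0 else x"] by (elim exE conjE)
  interpret l: Vector_Spaces.linear s s \<pi> by (rule \<pi>(1))
  have sub: "B \<subseteq> extend_basis B" by (rule extend_basis_superset[OF B(2)])
  have "v - \<pi> v \<in> I" for v
  proof -
    have "v \<in> span (extend_basis B)" using span_extend_basis[OF B(2)] by simp
    then have "v - \<pi> v \<in> span B"
    proof (induction rule: span_induct_alt)
      case base
      then show ?case by (simp add: l.zero span_zero)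
    next
      case (step c x y)
      have "x - \<pi> x \<in> span B" using step(1) \<pi>(2) by (auto simp: span_base span_zero)
      then have "s c (x - \<pi> x) + (y - \<pi> y) \<in> span B"
        using step by (intro span_add span_scale) auto
      then show ?case by (simp add: l.add l.scale scale_right_diff_distrib algebra_simps)
    qed
    then show ?thesis by (simp add: span)
  qed
  moreover have "\<pi> v = 0" if "v \<in> I" for v
  proof -
    have "v \<in> span B" using that span by simp
    then show ?thesis
      by (induction rule: span_induct_alt) (use \<pi>(2) sub in \<open>auto simp: l.zero l.add l.scale\<close>)
  qed
  ultimately show ?thesis using \<pi>(1) by blast
qed

text \<open>
  The generators for arbitrary distinct indices \<open>a1, a2, a3\<close> in place of \<open>1, 2, 3\<close>.  The matrix \<open>E a2 a1\<close>
  in \<open>xsl i (E a2 a1) b\<close> reads off the coordinate of \<open>E a1 a2\<close>.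
\<close>

locale TU_quotient =
  fixes I :: "('f::field_char_0, 'n::finite) upoly set" and a1 a2 :: 'n and i0 j0 :: nat
  assumes TU: "TU_ideal I" and card: "CARD('n) \<ge> 2" and a12: "a1 \<noteq> a2" and ij0: "i0 \<noteq> j0"
    and gen1: "CARD('n) = 2 \<Longrightarrow> xsl i0 (E a2 a1) (E a1 a2) * xsl j0 (E a2 a1) (E a1 a2) \<in> I"
      "CARD('n) \<noteq> 2 \<Longrightarrow> \<exists>a3. a3 \<notin> {a1, a2} \<and>
        xsl i0 (E a2 a1) (E a1 a2) * xsl j0 (E a2 a1) (E a3 a1) \<in> I"
    and gen2: "xsl i0 (E a2 a1) (E a1 a2) * xsl j0 (E a2 a1) (E a2 a1)
      - xsl j0 (E a2 a1) (E a1 a2) * xsl i0 (E a2 a1) (E a2 a1) \<in> I"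
    and gen3: "xscalar i0 * xscalar j0 - xscalar j0 * xscalar i0 \<in> I"
    and gen4: "xscalar i0 * xsl j0 (E a2 a1) (E a1 a2) - xsl j0 (E a2 a1) (E a1 a2) * xscalar i0 \<in> I"
begin

lemma subspace: "uvs.subspace I"
  using TU unfolding TU_ideal_def by (elim conjE)

lemma I_mult: "f \<in> I \<Longrightarrow> f * h \<in> I" "f \<in> I \<Longrightarrow> h * f \<in> I"
  using TU unfolding TU_ideal_def by (elim conjE, blast)+

lemma I_lact: "f \<in> I \<Longrightarrow> lact \<delta> f \<in> I"
  using TU unfolding TU_ideal_def by (elim conjE) (meson image_subset_iff)

lemma I_usub: "p \<in> I \<Longrightarrow> usub f v p \<in> I"
proof -
  have "upoly_endomorphism (usub f v) \<and> (\<forall>\<delta> p. usub f v (lact \<delta> p) = lact \<delta> (usub f v p))"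
    by (simp add: usub_endomorphism usub_lact)
  then have "usub f v ` I \<subseteq> I"
    using TU unfolding TU_ideal_def by (elim conjE) (meson)
  then show "p \<in> I \<Longrightarrow> usub f v p \<in> I" by blast
qed

text \<open>
  A linear projection along \<open>I\<close>.  It turns congruences modulo \<open>I\<close> into equations between elements of a
  vector space, to which the lemmas on equivariant forms apply.
\<close>

definition nf :: "('f, 'n) upoly \<Rightarrow> ('f, 'n) upoly" where
  "nf = (SOME \<pi>. Vector_Spaces.linear upoly_scale upoly_scale \<pi> \<and> (\<forall>v. v - \<pi> v \<in> I) \<and> (\<forall>v\<in>I. \<pi> v = 0))"

lemma nf: "Vector_Spaces.linear upoly_scale upoly_scale nf" "v - nf v \<in> I" "v \<in> I \<Longrightarrow> nf v = 0"
proof -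
  have *: "Vector_Spaces.linear upoly_scale upoly_scale nf \<and> (\<forall>v. v - nf v \<in> I) \<and> (\<forall>v\<in>I. nf v = 0)"
    unfolding nf_def by (rule someI_ex[OF ex_projection[OF vector_space_upoly subspace]])
  show "Vector_Spaces.linear upoly_scale upoly_scale nf" using * by (elim conjE)
  show "v - nf v \<in> I" using * by simp
  show "v \<in> I \<Longrightarrow> nf v = 0" using * by simp
qed

lemma nf_linear:
  "nf (f + h) = nf f + nf h" "nf (f - h) = nf f - nf h" "nf (upoly_scale c f) = upoly_scale c (nf f)" "nf 0 = 0"
  "nf (\<Sum>x\<in>A. k x) = (\<Sum>x\<in>A. nf (k x))"
proof -
  interpret l: Vector_Spaces.linear upoly_scale upoly_scale nf by (rule nf(1))
  show "nf (f + h) = nf f + nf h" "nf (f - h) = nf f - nf h" "nf (upoly_scale c f) = upoly_scale c (nf f)" "nf 0 = 0"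
  "nf (\<Sum>x\<in>A. k x) = (\<Sum>x\<in>A. nf (k x))"
    by (rule l.add l.diff l.scale l.zero l.sum)+
qed

lemma nf_eq_0_iff: "nf f = 0 \<longleftrightarrow> f \<in> I"
proof
  show "nf f = 0 \<Longrightarrow> f \<in> I" using nf(2)[of f] by simp
qed (rule nf(3))

lemma nf_eq_iff: "nf f = nf h \<longleftrightarrow> f - h \<in> I"
  using nf_eq_0_iff[of "f - h"] by (simp add: nf_linear)

lemma nf_nf: "nf (nf f) = nf f"
  by (rule sym) (simp only: nf_eq_iff nf(2))

lemma nf_mult_cong:
  assumes "nf f = nf f'" "nf h = nf h'"
  shows "nf (f * h) = nf (f' * h')"
proof -
  have "(f - f') * h \<in> I" "f' * (h - h') \<in> I"
    using assms I_mult by (simp_all add: nf_eq_iff)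
  then have "(f - f') * h + f' * (h - h') \<in> I"
    by (rule uvs.subspace_add[OF subspace])
  then show ?thesis by (simp add: nf_eq_iff algebra_simps)
qed

lemma nf_lact_cong: "nf f = nf h \<Longrightarrow> nf (lact \<delta> f) = nf (lact \<delta> h)"
proof -
  assume "nf f = nf h"
  then have "lact \<delta> (f - h) \<in> I" by (simp add: nf_eq_iff I_lact)
  moreover have "lact \<delta> (f - h) = lact \<delta> f - lact \<delta> h"
    using lact_linear(1)[of \<delta> "f - h" h] by simp
  ultimately show ?thesis by (simp add: nf_eq_iff)
qed

abbreviation act :: "('f, 'n) sqmat \<Rightarrow> ('f, 'n) upoly \<Rightarrow> ('f, 'n) upoly" where
  "act c f \<equiv> nf (lact (ad_der c) f)"

lemma trace_dual_units: "trace (sl_part (E p q) ** sl_part (E q p)) = (1 :: 'f)" if "p \<noteq> q"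
  using that by (simp add: sl_part_sl E_in_sl E_mult_E trace_E)

text \<open>
  Substituting \<open>x_i^v\<close> with \<open>v = rank_one w (E a1 a2)\<close> turns the coordinate matrix \<open>E a2 a1\<close> into \<open>w\<close>.
\<close>

lemma generator_instance:
  fixes w w' :: "('f, 'n) sqmat"
  shows "\<exists>f v. \<forall>b. usub f v (xsl i0 (E a2 a1) b) = xsl i w b \<and> usub f v (xsl j0 (E a2 a1) b) = xsl j w' b"
proof -
  let ?r = "\<lambda>w. Abs_uop (rank_one (sl_part w) (sl_part (E a1 a2 :: ('f, 'n) sqmat)))"
  show ?thesis
    using ij0 a12
    by (intro exI[of _ "(\<lambda>_. i)(j0 := j)"] exI[of _ "(\<lambda>_. ?r w)(j0 := ?r w')"])
      (simp add: usub_xsl[OF card, of _ _ w "E a1 a2"] usub_xsl[OF card, of _ _ w' "E a1 a2"] trace_dual_units)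
qed

lemma equivariant_product:
  "equivariant_form upoly_scale act (\<lambda>b d. nf (xsl i w b * xsl j w' d))"
proof -
  interpret vector_space "upoly_scale :: 'f \<Rightarrow> ('f, 'n) upoly \<Rightarrow> _" by (rule vector_space_upoly)
  show ?thesis
  proof unfold_locales
    show "act c (nf (xsl i w a * xsl j w' b))
        = nf (xsl i w (bracket c a) * xsl j w' b) + nf (xsl i w a * xsl j w' (bracket c b))" for c a b
      using nf_lact_cong[OF nf_nf, of "ad_der c" "xsl i w a * xsl j w' b"]
      by (simp add: lact_mult lact_xsl[OF card] nf_linear)
  qed (simp_all add: lact_linear nf_linear xsl_linear[OF card] distrib_left distrib_right
      upoly_scale_mult_left upoly_scale_mult_right)
qed

text \<open>
  The first generator, with the coordinate matrices changed to \<open>w\<close> and \<open>w'\<close> by a substitution, is the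
  relation from which the equivariant forms above are computed.
\<close>

lemma product_factors:
  "\<exists>G. (\<forall>a b. G (a + b) = G a + G b) \<and> (\<forall>t a. G (mscale t a) = upoly_scale t (G a)) \<and>
    (\<forall>a\<in>sl. \<forall>b\<in>sl. nf (xsl i w a * xsl j w' b) = G (a ** b))"
proof -
  obtain f v where fv: "usub f v (xsl i0 (E a2 a1) b) = xsl i w b"
    "usub f v (xsl j0 (E a2 a1) b) = xsl j w' b" for b
    using generator_instance[of i w j w'] by blast
  interpret B: equivariant_form upoly_scale act "\<lambda>b d. nf (xsl i w b * xsl j w' d)"
    by (rule equivariant_product)
  show ?thesis
  proof (cases "CARD('n) = 2")
    case True
    then have "nf (xsl i w (E a1 a2) * xsl j w' (E a1 a2)) = 0"
      using I_usub[OF gen1(1), of f v] by (simp add: usub_mult fv nf_eq_0_iff)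
    moreover have "UNIV = {a1, a2}"
      using True a12 card_subset_eq[of UNIV "{a1, a2}"] by simp
    ultimately interpret B2: equivariant_form_2 upoly_scale act "\<lambda>b d. nf (xsl i w b * xsl j w' d)" a1 a2
      by unfold_locales (use a12 in auto)
    show ?thesis by (rule B2.factors_through_product)
  next
    case False
    obtain a3 where a3: "a3 \<notin> {a1, a2}" "xsl i0 (E a2 a1) (E a1 a2) * xsl j0 (E a2 a1) (E a3 a1) \<in> I"
      using gen1(2)[OF False] by blast
    then have "nf (xsl i w (E a1 a2) * xsl j w' (E a3 a1)) = 0"
      using I_usub[OF a3(2), of f v] by (simp add: usub_mult fv nf_eq_0_iff)
    then interpret B3: equivariant_form_3 upoly_scale act "\<lambda>b d. nf (xsl i w b * xsl j w' d)" a1 a2 a3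
      by unfold_locales (use a12 a3 in auto)
    show ?thesis by (rule B3.factors_through_product)
  qed
qed

text \<open>
  The difference of the two sides is again an equivariant form that factors through the product.  It
  vanishes at \<open>E a1 a2\<close>, \<open>E a2 a1\<close>, so the map through which it factors vanishes at \<open>E a1 a1\<close>.
\<close>

lemma swap_slots:
  assumes "b \<in> sl" "d \<in> sl"
  shows "nf (xsl i w b * xsl j w' d) = nf (xsl j w' b * xsl i w d)"
proof -
  obtain f v where fv: "usub f v (xsl i0 (E a2 a1) b) = xsl i w b"
    "usub f v (xsl j0 (E a2 a1) b) = xsl j w' b" for b
    using generator_instance[of i w j w'] by blast
  interpret B: equivariant_form upoly_scale act "\<lambda>b d. nf (xsl i w b * xsl j w' d)"
    by (rule equivariant_product)
  interpret B': equivariant_form upoly_scale act "\<lambda>b d. nf (xsl j w' b * xsl i w d)"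
    by (rule equivariant_product)
  let ?C = "\<lambda>b d. nf (xsl i w b * xsl j w' d) - nf (xsl j w' b * xsl i w d)"
  interpret C: equivariant_form upoly_scale act ?C
    by unfold_locales (simp_all only: B.act_add B.act_scale B.B_add B'.B_add B.B_scale B'.B_scale
        B.act_diff B.act_B B'.act_B uvs.scale_right_diff_distrib, simp_all add: algebra_simps)
  obtain G where G: "\<And>a b. G (a + b) = G a + G b" "\<And>t a. G (mscale t a) = upoly_scale t (G a)"
    "\<And>a b. a \<in> sl \<Longrightarrow> b \<in> sl \<Longrightarrow> nf (xsl i w a * xsl j w' b) = G (a ** b)"
    using product_factors[of i w j w'] by blast
  obtain H where H: "\<And>a b. H (a + b) = H a + H b" "\<And>t a. H (mscale t a) = upoly_scale t (H a)"
    "\<And>a b. a \<in> sl \<Longrightarrow> b \<in> sl \<Longrightarrow> nf (xsl j w' a * xsl i w b) = H (a ** b)"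
    using product_factors[of j w' i w] by blast
  have start: "?C (E a1 a2) (E a2 a1) = 0"
    using I_usub[OF gen2, of f v] by (simp add: usub_mult usub_diff fv nf_eq_iff)
  have "G m - H m = 0" for m
    by (rule C.vanishes_if_at_unit[OF card _ _ _ a12 start, of "\<lambda>m. G m - H m"])
      (simp_all add: G H uvs.scale_right_diff_distrib)
  then show ?thesis using G(3)[OF assms] H(3)[OF assms] by (metis eq_iff_diff_eq_0)
qed

lemma xscalar_commute: "nf (xscalar i * xscalar j) = nf (xscalar j * xscalar i)"
  using I_usub[OF gen3, of "(\<lambda>_. i)(j0 := j)" "\<lambda>_. Abs_uop id"] ij0
  by (simp add: usub_mult usub_diff usub_xscalar[OF card] nf_eq_iff)

text \<open>
  The scalar letters are constants for the Lie algebra, so the matrices \<open>b\<close> for which this holds form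
  a submodule, and the last generator puts \<open>E a1 a2\<close> into it.
\<close>

lemma xscalar_xsl_commute: "nf (xscalar i * xsl j w b) = nf (xsl j w b * xscalar i)"
proof -
  define S where "S = {b. nf (xscalar i * xsl j w b) = nf (xsl j w b * xscalar i)}"
  have "sl \<subseteq> S"
  proof (rule sl_generated[OF _ _ _ a12])
    have "xsl j w 0 = 0" using xsl_linear(1)[OF card, of j w 0 0] by simp
    then show "mvs.subspace S"
      by (auto simp: mvs.subspace_def S_def xsl_linear[OF card] distrib_left distrib_right nf_linear
          upoly_scale_mult_left upoly_scale_mult_right)
    show "bracket c m \<in> S" if "m \<in> S" for c m
      using nf_lact_cong[of "xscalar i * xsl j w m" "xsl j w m * xscalar i" "ad_der c"] that
      by (simp add: S_def lact_mult lact_xscalar[OF card] lact_xsl[OF card])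
    let ?v = "(\<lambda>_. Abs_uop id)(j0 := Abs_uop (rank_one (sl_part w) (sl_part (E a1 a2 :: ('f, 'n) sqmat))))"
    show "E a1 a2 \<in> S"
      using I_usub[OF gen4, of "(\<lambda>_. i)(j0 := j)" ?v] ij0 a12
      by (simp add: usub_mult usub_diff usub_xscalar[OF card] usub_xsl[OF card, of _ _ w "E a1 a2"]
          trace_dual_units S_def nf_eq_iff)
  qed
  then have "sl_part b \<in> S" using sl_part_in_sl by blast
  then show ?thesis by (simp add: S_def xsl_sl_part)
qed

end

section \<open>Normal forms of products\<close>

text \<open>
  A representative of the class of words \<open>xsl i1 w1 b1 * xsl i2 w2 b2 * \<dots>\<close> with \<open>(i1, w1), (i2, w2), \<dots>\<close> given
  by the list and with \<open>b1 ** b2 ** \<dots> = m\<close>.  To be linear in \<open>m\<close> it is defined on matrix units, which are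
  factored as \<open>E p q = E p a ** row_unit a q\<close> with \<open>a = other p\<close>; both factors are traceless.
\<close>

fun slword :: "(nat \<times> ('f::field, 'n::finite) sqmat) list \<Rightarrow> ('f, 'n) sqmat \<Rightarrow> ('f, 'n) upoly" where
  "slword [] m = 0"
| "slword [x] m = xsl (fst x) (snd x) m"
| "slword (x # y # L) m = (\<Sum>(p, q)\<in>UNIV. upoly_scale (m $ p $ q)
     (xsl (fst x) (snd x) (E p (other p)) * slword (y # L) (row_unit (other p) q)))"

lemma slword_linear:
  fixes m :: "('f::field_char_0, 'n::finite) sqmat"
  assumes "CARD('n) \<ge> 2"
  shows "slword L (m + m') = slword L m + slword L m'"
    "slword L (mscale c m) = upoly_scale c (slword L m)"
  by (cases "(L, m)" rule: slword.cases; simp add: xsl_linear[OF assms] case_prod_unfold sum.distrib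
      uvs.scale_left_distrib uvs.scale_sum_right)+

text \<open>
  With scalar letters in front.  A word of scalar letters alone has a scalar product \<open>m\<close>, recovered as
  \<open>tr m / k\<close>.
\<close>

fun uword :: "nat list \<Rightarrow> (nat \<times> ('f::field, 'n::finite) sqmat) list \<Rightarrow> ('f, 'n) sqmat \<Rightarrow> ('f, 'n) upoly" where
  "uword [] L m = slword L m"
| "uword (i # zs) L m = (if zs = [] \<and> L = [] then upoly_scale (trace m / of_nat CARD('n)) (xscalar i)
     else xscalar i * uword zs L m)"

lemma uword_linear:
  fixes m :: "('f::field_char_0, 'n::finite) sqmat"
  assumes "CARD('n) \<ge> 2"
  shows "uword zs L (m + m') = uword zs L m + uword zs L m'"
    "uword zs L (mscale c m) = upoly_scale c (uword zs L m)"
  by (induction zs) (simp_all add: slword_linear[OF assms] trace_simps add_divide_distrib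
      uvs.scale_left_distrib distrib_left upoly_scale_mult_right)

context TU_quotient
begin

text \<open>
  It suffices to compare with the products of a letter and a shorter word, because the definition of
  \<open>slword\<close> only uses such products with traceless matrices.
\<close>

lemma slword_eqI:
  assumes G: "\<And>a b. G (a + b) = G a + G b" "\<And>t a. G (mscale t a) = upoly_scale t (G a)"
    and eq: "\<And>a b. a \<in> sl \<Longrightarrow> b \<in> sl \<Longrightarrow> nf (xsl (fst x) (snd x) a * slword (y # L) b) = G (a ** b)"
  shows "nf (slword (x # y # L) m) = G m"
proof -
  have "G 0 = 0" using G(1)[of 0 0] by simp
  have "m \<in> {m. nf (slword (x # y # L) m) = G m}"
  proof (rule matrix_induct)
    show "mvs.subspace {m. nf (slword (x # y # L) m) = G m}"
      using slword_linear(2)[OF card, of "x # y # L" 0 0]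
      by (simp add: mvs.subspace_def slword_linear[OF card] G nf_linear \<open>G 0 = 0\<close> del: slword.simps)
    fix p q :: 'n
    have "slword (x # y # L) (E p q) = (\<Sum>s\<in>UNIV. if s = (p, q)
        then xsl (fst x) (snd x) (E p (other p)) * slword (y # L) (row_unit (other p) q) else 0)"
      unfolding slword.simps by (rule sum.cong) (auto simp: E_nth split: if_splits)
    then have "slword (x # y # L) (E p q)
        = xsl (fst x) (snd x) (E p (other p)) * slword (y # L) (row_unit (other p) q)"
      by simp
    moreover have "nf (xsl (fst x) (snd x) (E p (other p)) * slword (y # L) (row_unit (other p) q))
        = G (E p (other p) ** row_unit (other p) q)"
      by (rule eq) (simp_all add: E_in_sl other[OF card, of p, symmetric] row_unit[OF card])
    ultimately show "E p q \<in> {m. nf (slword (x # y # L) m) = G m}"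
      by (simp add: row_unit[OF card] del: slword.simps)
  qed
  then show ?thesis by simp
qed

text \<open>
  Two letters: \<open>product_factors\<close>.  More letters: by induction \<open>slword (y # L) (q ** z)\<close> is congruent to
  \<open>xsl y q * slword L z\<close>, so the first two letters can be combined, and \<open>associative_factor\<close> applies.
\<close>

lemma xsl_slword:
  assumes "L \<noteq> []" "b \<in> sl" "length L = 1 \<Longrightarrow> u \<in> sl"
  shows "nf (xsl (fst x) (snd x) b * slword L u) = nf (slword (x # L) (b ** u))"
  using assms
proof (induction L arbitrary: x b u)
  case (Cons y L)
  show ?case
  proof (cases L)
    case Nil
    obtain G where G: "\<And>a b. G (a + b) = G a + G b" "\<And>t a. G (mscale t a) = upoly_scale t (G a)"
      "\<And>a b. a \<in> sl \<Longrightarrow> b \<in> sl \<Longrightarrow> nf (xsl (fst x) (snd x) a * xsl (fst y) (snd y) b) = G (a ** b)"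
      using product_factors[of "fst x" "snd x" "fst y" "snd y"] by blast
    have "nf (slword (x # y # L) (b ** u)) = G (b ** u)"
      by (rule slword_eqI) (simp_all add: G Nil)
    then show ?thesis using Cons.prems G(3)[of b u] by (simp add: Nil del: slword.simps(3))
  next
    case (Cons l L')
    note L = Cons
    have IH1: "nf (xsl (fst y) (snd y) q * slword L z) = nf (slword (y # L) (q ** z))"
      if "q \<in> sl" "z \<in> sl" for q z
      using that Cons.IH[of q z y] L by simp
    have IH2: "nf (xsl (fst x) (snd x) a * xsl (fst y) (snd y) q) = nf (slword [x, y] (a ** q))"
      if "a \<in> sl" "q \<in> sl" for a q
    proof -
      obtain G where G: "\<And>a b. G (a + b) = G a + G b" "\<And>t a. G (mscale t a) = upoly_scale t (G a)"
        "\<And>a b. a \<in> sl \<Longrightarrow> b \<in> sl \<Longrightarrow> nf (xsl (fst x) (snd x) a * xsl (fst y) (snd y) b) = G (a ** b)"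
        using product_factors[of "fst x" "snd x" "fst y" "snd y"] by blast
      have "nf (slword [x, y] (a ** q)) = G (a ** q)"
        by (rule slword_eqI) (simp_all add: G)
      then show ?thesis using that G(3) by simp
    qed
    have assoc: "nf (xsl (fst x) (snd x) a * slword (y # L) (q ** z)) = nf (slword [x, y] (a ** q) * slword L z)"
      if "a \<in> sl" "q \<in> sl" "z \<in> sl" for a q z
    proof -
      have "nf (xsl (fst x) (snd x) a * slword (y # L) (q ** z))
          = nf (xsl (fst x) (snd x) a * (xsl (fst y) (snd y) q * slword L z))"
        by (rule nf_mult_cong) (simp_all add: IH1 that del: slword.simps)
      also have "\<dots> = nf (slword [x, y] (a ** q) * slword L z)"
        unfolding mult.assoc[symmetric] by (rule nf_mult_cong) (simp_all only: IH2 that)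
      finally show ?thesis .
    qed
    obtain G where G: "\<And>a b. G (a + b) = G a + G b" "\<And>t a. G (mscale t a) = upoly_scale t (G a)"
      "\<And>a u. a \<in> sl \<Longrightarrow> nf (xsl (fst x) (snd x) a * slword (y # L) u) = G (a ** u)"
    proof -
      have "\<exists>G. (\<forall>m m'. G (m + m') = G m + G m') \<and> (\<forall>t m. G (mscale t m) = upoly_scale t (G m)) \<and>
          (\<forall>b\<in>sl. \<forall>u. nf (xsl (fst x) (snd x) b * slword (y # L) u) = G (b ** u))"
        by (rule uvs.associative_factor[where g = "\<lambda>z m. nf (slword [x, y] m * slword L z)", OF card])
          (simp_all add: assoc slword_linear[OF card] nf_linear distrib_left distrib_right
            upoly_scale_mult_left upoly_scale_mult_right del: slword.simps)
      then show thesis using that by blast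
    qed
    have "nf (slword (x # y # L) (b ** u)) = G (b ** u)"
      by (rule slword_eqI) (simp_all only: G)
    then show ?thesis using Cons.prems G(3)[of b u] by (simp only:)
  qed
qed simp

text \<open>
  Matrix units are products of two traceless matrices, and of three if further letters follow; so the
  first two letters can be split off and \<open>swap_slots\<close> applies.
\<close>

lemma slword_swap: "nf (slword (x # y # L) m) = nf (slword (y # x # L) m)"
proof -
  have "m \<in> {m. nf (slword (x # y # L) m) = nf (slword (y # x # L) m)}"
  proof (rule matrix_induct)
    show "mvs.subspace {m. nf (slword (x # y # L) m) = nf (slword (y # x # L) m)}"
      using slword_linear(2)[OF card, of "x # y # L" 0 0] slword_linear(2)[OF card, of "y # x # L" 0 0]
      by (simp add: mvs.subspace_def slword_linear[OF card] nf_linear del: slword.simps)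
    fix p q :: 'n
    let ?a = "E p (other p) :: ('f, 'n) sqmat" and ?b = "row_unit (other p) (other p) :: ('f, 'n) sqmat"
      and ?c = "row_unit (other p) q :: ('f, 'n) sqmat"
    have sl: "?a \<in> sl" "?b \<in> sl" "?c \<in> sl"
      using other[OF card, of p] by (simp_all add: E_in_sl row_unit[OF card])
    have ac: "?a ** ?c = E p q" and abc: "?a ** (?b ** ?c) = E p q"
      by (simp_all add: row_unit[OF card] matrix_mul_assoc)
    have "nf (slword (x # y # L) (E p q)) = nf (slword (y # x # L) (E p q))"
    proof (cases "L = []")
      case True
      have *: "nf (slword [x, y] (?a ** ?c)) = nf (xsl (fst x) (snd x) ?a * xsl (fst y) (snd y) ?c)" for x y
        using xsl_slword[of "[y]" ?a ?c x] sl by (simp del: slword.simps(3))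
      show ?thesis
        unfolding True ac[symmetric] * by (rule swap_slots[OF sl(1,3)])
    next
      case False
      have *: "nf (slword (x # y # L) (?a ** (?b ** ?c)))
          = nf (xsl (fst x) (snd x) ?a * xsl (fst y) (snd y) ?b * slword L ?c)" for x y
      proof -
        have "nf (slword (x # y # L) (?a ** (?b ** ?c)))
            = nf (xsl (fst x) (snd x) ?a * slword (y # L) (?b ** ?c))"
          by (rule xsl_slword[symmetric]) (use sl False in auto)
        also have "\<dots> = nf (xsl (fst x) (snd x) ?a * (xsl (fst y) (snd y) ?b * slword L ?c))"
          by (rule nf_mult_cong[OF refl xsl_slword[symmetric]]) (use sl False in auto)
        finally show ?thesis by (simp add: mult.assoc)
      qed
      show ?thesis
        unfolding abc[symmetric] * by (rule nf_mult_cong[OF swap_slots[OF sl(1,2)] refl])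
    qed
    then show "E p q \<in> {m. nf (slword (x # y # L) m) = nf (slword (y # x # L) m)}" by simp
  qed
  then show ?thesis by simp
qed

lemma slword_perm:
  assumes "mset L = mset L'"
  shows "nf (slword L m) = nf (slword L' m)"
proof -
  have "(\<lambda>m. nf (slword L m)) = (\<lambda>m. nf (slword L' m))"
  proof (rule mset_eq_invariant[OF _ _ assms])
    show "(\<lambda>m. nf (slword (x # y # xs) m)) = (\<lambda>m. nf (slword (y # x # xs) m))" for x y xs
      by (simp only: slword_swap)
    fix x and xs ys :: "(nat \<times> ('f, 'n) sqmat) list"
    assume eq: "(\<lambda>m. nf (slword xs m)) = (\<lambda>m. nf (slword ys m))" and len: "length xs = length ys"
    show "(\<lambda>m. nf (slword (x # xs) m)) = (\<lambda>m. nf (slword (x # ys) m))"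
    proof (cases xs)
      case Nil
      then show ?thesis using len by simp
    next
      case (Cons a xs')
      then obtain b ys' where ys: "ys = b # ys'" using len by (cases ys) auto
      have "nf (xsl (fst x) (snd x) c * slword xs d) = nf (xsl (fst x) (snd x) c * slword ys d)" for c d
        by (rule nf_mult_cong[OF refl]) (rule fun_cong[OF eq])
      then show ?thesis
        by (simp add: Cons ys nf_linear case_prod_unfold)
    qed
  qed
  then show ?thesis by (rule fun_cong)
qed

lemma xscalar_left_commute: "nf (xscalar i * (xscalar j * f)) = nf (xscalar j * (xscalar i * f))"
  using nf_mult_cong[OF xscalar_commute refl] by (simp add: mult.assoc)

lemma uword_perm:
  assumes "mset zs = mset zs'" "mset L = mset L'"
  shows "nf (uword zs L m) = nf (uword zs' L' m)"
proof -
  have empty: "L = [] \<longleftrightarrow> L' = []" using assms(2) by auto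
  have "nf (uword zs L m) = nf (uword zs L' m)"
    by (induction zs) (auto simp: empty slword_perm[OF assms(2)] intro: nf_mult_cong)
  also have "\<dots> = nf (uword zs' L' m)"
  proof (rule mset_eq_invariant[OF _ _ assms(1)])
    show "nf (uword (i # j # zs) L' m) = nf (uword (j # i # zs) L' m)" for i j zs
      by (simp add: xscalar_left_commute upoly_scale_mult_right nf_linear xscalar_commute[of i j])
  qed (auto intro: nf_mult_cong)
  finally show ?thesis .
qed

text \<open>
  The span of the products of \<open>length L\<close> traceless matrices, where the empty product is scalar.
\<close>

definition product_range :: "'a list \<Rightarrow> ('f, 'n) sqmat set" where
  "product_range L = (if L = [] then range (\<lambda>c. mscale c (mat 1)) else if length L = 1 then sl else UNIV)"

lemma xsl_uword:
  assumes "zs \<noteq> [] \<or> L \<noteq> []" "b \<in> sl" "u \<in> product_range L"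
  shows "nf (xsl (fst x) (snd x) b * uword zs L u) = nf (uword zs (x # L) (b ** u))"
  using assms(1)
proof (induction zs)
  case Nil
  then have "length L = 1 \<Longrightarrow> u \<in> sl" using assms(3) by (auto simp: product_range_def)
  then show ?case using xsl_slword[of L b u x] Nil assms(2) by simp
next
  case (Cons i zs)
  show ?case
  proof (cases "zs = [] \<and> L = []")
    case True
    then obtain c where c: "u = mscale c (mat 1)" using assms(3) by (auto simp: product_range_def)
    then show ?thesis
      using True by (simp add: trace_simps trace_I upoly_scale_mult_right nf_linear xsl_linear[OF card]
          xscalar_xsl_commute)
  next
    case False
    have "nf (xsl (fst x) (snd x) b * (xscalar i * uword zs L u)) = nf (xscalar i * (xsl (fst x) (snd x) b * uword zs L u))"
      using nf_mult_cong[OF xscalar_xsl_commute refl, of i "fst x" "snd x" b "uword zs L u"] by (simp add: mult.assoc)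
    also have "\<dots> = nf (xscalar i * uword zs (x # L) (b ** u))"
      by (rule nf_mult_cong[OF refl]) (rule Cons.IH, use False in auto)
    finally show ?thesis using False by auto
  qed
qed

lemma subspace_product_range: "mvs.subspace (product_range L)"
proof -
  have "mvs.subspace (range (\<lambda>c. mscale c (mat 1 :: ('f, 'n) sqmat)))"
    unfolding mvs.subspace_def
    by (auto simp: mscale_distrib(3)[symmetric] intro: range_eqI[of _ _ 0])
  moreover have "mvs.subspace (UNIV :: ('f, 'n) sqmat set)" by (simp add: mvs.subspace_def)
  ultimately show ?thesis by (simp add: product_range_def subspace_sl)
qed

lemma partition_empty:
  "image_mset f {#x \<in># \<kappa>. P x#} = {#} \<Longrightarrow> image_mset h {#x \<in># \<kappa>. \<not> P x#} = {#} \<Longrightarrow> \<kappa> = {#}"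
  using multiset_partition[of \<kappa> P] by simp

text \<open>
  Modulo \<open>I\<close>, a homogeneous polynomial depends only on its multiset of coordinates and on its matrix.
\<close>

lemma homog_nf:
  assumes "homog w \<kappa> b f"
    and "mset zs = image_mset fst {#x \<in># \<kappa>. snd x = (w, w)#}"
    and "mset L = image_mset (apsnd slot) {#x \<in># \<kappa>. snd x \<noteq> (w, w)#}"
  shows "b \<in> product_range L \<and> nf f = nf (uword zs L b)"
  using assms
proof (induction arbitrary: zs L rule: homog.induct)
  case (zero \<kappa>)
  have "uword zs L 0 = 0" using uword_linear(2)[OF card, of zs L 0 0] by simp
  then show ?case using subspace_product_range[of L] by (simp add: mvs.subspace_def)
next
  case (add \<kappa> a f b h)
  show ?case
    using subspace_product_range[of L] add.IH(1)[OF add.prems] add.IH(2)[OF add.prems]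
    by (simp add: nf_linear uword_linear[OF card] mvs.subspace_def)
next
  case (scale \<kappa> a f c)
  show ?case
    using subspace_product_range[of L] scale.IH[OF scale.prems]
    by (simp add: nf_linear uword_linear[OF card] mvs.subspace_def)
next
  case (xscalar i)
  then have "zs = [i]" "L = []" by auto
  moreover have "(mat 1 :: ('f, 'n) sqmat) \<in> range (\<lambda>c. mscale c (mat 1))"
    by (rule range_eqI[of _ _ 1]) simp
  ultimately show ?case by (simp add: product_range_def trace_I)
next
  case (xsl s b i)
  then have "zs = []" "L = [(i, slot s)]" by auto
  then show ?case using xsl by (simp add: product_range_def)
next
  case (xscalar_mult \<kappa> a f i)
  obtain zs' where zs': "mset zs' = image_mset fst {#x \<in># \<kappa>. snd x = (w, w)#}" by (metis ex_mset)
  have L: "mset L = image_mset (apsnd slot) {#x \<in># \<kappa>. snd x \<noteq> (w, w)#}"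
    using xscalar_mult.prems by simp
  have ne: "\<not> (zs' = [] \<and> L = [])"
    using partition_empty[of fst "\<lambda>x. snd x = (w, w)" \<kappa> "apsnd slot"] xscalar_mult.hyps
    by (metis zs' L mset.simps(1))
  note IH = xscalar_mult.IH[OF zs' L]
  have "nf (xscalar i * f) = nf (xscalar i * uword zs' L a)"
    by (rule nf_mult_cong[OF refl]) (simp add: IH)
  also have "\<dots> = nf (uword (i # zs') L a)" using ne by auto
  also have "\<dots> = nf (uword zs L a)"
    by (rule uword_perm) (simp_all add: xscalar_mult.prems(1) zs')
  finally show ?case by (simp add: IH[THEN conjunct1])
next
  case (xsl_mult \<kappa> a f s b i)
  obtain L' :: "(nat \<times> ('f, 'n) sqmat) list"
    where L': "mset L' = image_mset (apsnd slot) {#x \<in># \<kappa>. snd x \<noteq> (w, w)#}" by (metis ex_mset)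
  have zs: "mset zs = image_mset fst {#x \<in># \<kappa>. snd x = (w, w)#}"
    using xsl_mult.prems xsl_mult.hyps by simp
  have ne: "zs \<noteq> [] \<or> L' \<noteq> []"
    using partition_empty[of fst "\<lambda>x. snd x = (w, w)" \<kappa> "apsnd slot"] xsl_mult.hyps
    by (metis zs L' mset.simps(1))
  have L: "mset L = add_mset (i, slot s) (mset L')"
    using xsl_mult.prems xsl_mult.hyps L' by simp
  then have len: "length L = Suc (length L')" by (metis size_mset size_add_mset)
  note IH = xsl_mult.IH[OF zs L']
  have "nf (xsl i (slot s) b * f) = nf (xsl i (slot s) b * uword zs L' a)"
    by (rule nf_mult_cong[OF refl]) (simp add: IH)
  also have "\<dots> = nf (uword zs ((i, slot s) # L') (b ** a))"
    using xsl_uword[OF ne, of b a "(i, slot s)"] IH xsl_mult.hyps by simp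
  also have "\<dots> = nf (uword zs L (b ** a))"
    by (rule uword_perm) (simp_all add: L)
  finally have "nf (xsl i (slot s) b * f) = nf (uword zs L (b ** a))" .
  moreover have "b ** a \<in> product_range L"
    using IH xsl_mult.hyps len subspace_sl
    by (auto simp: product_range_def mvs.subspace_def split: if_splits)
  ultimately show ?case by simp
qed

lemma homog_zero_in: "homog w \<kappa> 0 f \<Longrightarrow> f \<in> I"
proof -
  assume f: "homog w \<kappa> 0 f"
  obtain zs where zs: "mset zs = image_mset fst {#x \<in># \<kappa>. snd x = (w, w)#}" by (metis ex_mset)
  obtain L :: "(nat \<times> ('f, 'n) sqmat) list"
    where L: "mset L = image_mset (apsnd slot) {#x \<in># \<kappa>. snd x \<noteq> (w, w)#}" by (metis ex_mset)
  have "uword zs L 0 = 0" using uword_linear(2)[OF card, of zs L 0 0] by simp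
  then show ?thesis using homog_nf[OF f zs L] by (simp add: nf_linear nf_eq_0_iff)
qed

lemma identities_subset: "U_identities \<subseteq> I"
proof
  fix f :: "('f, 'n) upoly" assume f: "f \<in> U_identities"
  obtain A b F where A: "finite A" "\<And>\<kappa>. homog a1 \<kappa> (b \<kappa>) (F \<kappa>)" "f = (\<Sum>\<kappa>\<in>A. F \<kappa>)"
    using decomposable[OF card, of a1 f] unfolding decomposable_def by blast
  have "b \<kappa> = 0" if "\<kappa> \<in> A" for \<kappa>
  proof -
    have "b \<kappa> $ p $ q = 0" for p q
    proof (rule monomials_independent[OF A(1) _ that])
      fix t :: "nat \<times> 'n \<times> 'n \<Rightarrow> 'f"
      obtain m where m: "coord a1 m = t" using coord_surj by blast
      have sum: "ueval m (\<Sum>\<kappa>\<in>A. F \<kappa>) = (\<Sum>\<kappa>\<in>A. ueval m (F \<kappa>))"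
        by (induction A rule: infinite_finite_induct) (simp_all add: ueval_zero ueval_linear)
      have "0 = ueval m f $ p $ q" using f by (simp add: U_identities_def)
      also have "\<dots> = (\<Sum>\<kappa>\<in>A. b \<kappa> $ p $ q * (\<Prod>x\<in>#\<kappa>. t x))"
        unfolding A(3) sum by (simp add: ueval_homog[OF card A(2)] m mult.commute)
      finally show "(\<Sum>\<kappa>\<in>A. b \<kappa> $ p $ q * (\<Prod>x\<in>#\<kappa>. t x)) = 0" by simp
    qed
    then show ?thesis by (simp add: vec_eq_iff)
  qed
  then have "F \<kappa> \<in> I" if "\<kappa> \<in> A" for \<kappa>
    using homog_zero_in[of a1 \<kappa> "F \<kappa>"] A(2)[of \<kappa>] that by simp
  then show "f \<in> I"
    unfolding A(3) by (rule uvs.subspace_sum[OF subspace])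
qed

end

section \<open>The generators in terms of matrix units\<close>

lemma munit_eq: "munit \<iota> i j = E (\<iota> i) (\<iota> j)"
  by (simp add: munit_def E_def)

text \<open>
  The difference \<open>D\<close> of the two maps vanishes at \<open>E p q\<close> for \<open>p \<noteq> q\<close> and takes the same value \<open>d\<close> at all
  \<open>E p p\<close>, so \<open>0 = D (mat 1) = k d\<close>, whence \<open>d = 0\<close> in characteristic zero.
\<close>

lemma linear_eq_on_gl_basis:
  fixes u v :: "('f::field_char_0, 'n::finite) sqmat \<Rightarrow> ('f, 'n) sqmat"
  assumes bij: "bij_betw \<iota> {1..CARD('n)} UNIV" and u: "mlinear u" and v: "mlinear v"
    and eq: "\<And>c. c \<in> gl_basis \<iota> \<Longrightarrow> u c = v c"
  shows "u = v"
proof -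
  define D where "D m = u m - v m" for m
  have D: "D (a + b) = D a + D b" "D (mscale t a) = mscale t (D a)" for a b t
    using u v by (auto simp: D_def mlinear_iff mscale_distrib)
  have D_diff: "D (a - b) = D a - D b" for a b using D(1)[of "a - b" b] by simp
  have D0: "D 0 = 0" using D(2)[of 0 0] by simp
  have basis: "D c = 0" if "c \<in> gl_basis \<iota>" for c using eq[OF that] by (simp add: D_def)
  have index: "\<exists>i\<in>{1..CARD('n)}. p = \<iota> i" for p
    using bij unfolding bij_betw_def by blast
  have off: "D (E p q) = 0" if "p \<noteq> q" for p q
  proof -
    obtain i j where "i \<in> {1..CARD('n)}" "j \<in> {1..CARD('n)}" "p = \<iota> i" "q = \<iota> j"
      using index by blast
    then have "E p q \<in> gl_basis \<iota>"
      using that unfolding gl_basis_def sl_basis_def munit_eq by blast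
    then show ?thesis by (rule basis)
  qed
  have diag: "D (E (\<iota> (Suc i)) (\<iota> (Suc i))) = D (E (\<iota> 1) (\<iota> 1))" if "i < CARD('n)" for i
    using that
  proof (induction i)
    case (Suc i)
    have "E (\<iota> (Suc i)) (\<iota> (Suc i)) - E (\<iota> (Suc i + 1)) (\<iota> (Suc i + 1)) \<in> gl_basis \<iota>"
      using Suc.prems unfolding gl_basis_def sl_basis_def munit_eq by auto
    then have "D (E (\<iota> (Suc i)) (\<iota> (Suc i)) - E (\<iota> (Suc i + 1)) (\<iota> (Suc i + 1))) = 0" by (rule basis)
    then show ?case using Suc by (simp add: D_diff)
  qed simp
  define d where "d = D (E (\<iota> 1) (\<iota> 1))"
  have d: "D (E p p) = d" for p
  proof -
    obtain i where "i \<in> {1..CARD('n)}" "p = \<iota> i" using index by blast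
    then show ?thesis using diag[of "i - 1"] by (cases i) (auto simp: d_def)
  qed
  have "(mat 1 :: ('f, 'n) sqmat) = (\<Sum>p\<in>UNIV. E p p)"
  proof -
    have "(\<Sum>p\<in>UNIV. E p p $ i $ j) = (\<Sum>p\<in>UNIV. if p = i then (if i = j then 1 else 0) else (0 :: 'f))" for i j :: 'n
      by (rule sum.cong) (auto simp: E_nth)
    then show ?thesis by (simp add: vec_eq_iff mat_def)
  qed
  moreover have "D (\<Sum>p\<in>A. E p p) = mscale (of_nat (card A)) d" for A :: "'n set"
    by (induction A rule: infinite_finite_induct) (simp_all add: D0 D d mscale_distrib)
  ultimately have "mscale (of_nat CARD('n)) d = D (mat 1)" by simp
  also have "\<dots> = 0" by (rule basis) (simp add: gl_basis_def)
  finally have "d = 0" by (simp add: vec_eq_iff)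
  then have all: "D (E p q) = 0" for p q using off d by (cases "p = q") auto
  have "m \<in> {m. D m = 0}" for m
    by (rule matrix_induct) (simp_all add: mvs.subspace_def D D0 all)
  then show ?thesis by (simp add: fun_eq_iff D_def)
qed

lemma basis_map_eqI:
  fixes u :: "('f::field_char_0, 'n::finite) sqmat \<Rightarrow> ('f, 'n) sqmat"
  assumes bij: "bij_betw \<iota> {1..CARD('n)} UNIV" and u: "mlinear u" "u a = b"
    "\<And>c. c \<in> gl_basis \<iota> \<Longrightarrow> c \<noteq> a \<Longrightarrow> u c = 0"
  shows "basis_map \<iota> a b = u"
  unfolding basis_map_def
proof (rule the_equality)
  show "mlinear u \<and> u a = b \<and> (\<forall>c\<in>gl_basis \<iota> - {a}. u c = 0)" using u by auto
  fix v assume v: "mlinear v \<and> v a = b \<and> (\<forall>c\<in>gl_basis \<iota> - {a}. v c = 0)"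
  then have "v c = u c" if "c \<in> gl_basis \<iota>" for c
    using u that by (cases "c = a") auto
  then show "v = u" using linear_eq_on_gl_basis[OF bij] v u(1) by blast
qed

lemma Uset_mlinear: "\<phi> \<in> Uset \<Longrightarrow> mlinear \<phi>"
  by (simp add: mlinear_iff Uset_linear)

context
  fixes \<iota> :: "nat \<Rightarrow> 'n::finite"
  assumes card: "CARD('n) \<ge> 2" and bij: "bij_betw \<iota> {1..CARD('n)} UNIV"
begin

lemma \<iota>_eq_iff: "i \<in> {1..CARD('n)} \<Longrightarrow> j \<in> {1..CARD('n)} \<Longrightarrow> \<iota> i = \<iota> j \<longleftrightarrow> i = j"
  using bij by (meson bij_betw_imp_inj_on inj_on_eq_iff)

lemma xbasis_off_diagonal:
  assumes b: "b \<in> sl"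
  shows "xbasis \<iota> i (munit \<iota> 1 2) (b :: ('f::field_char_0, 'n) sqmat) = xsl i (E (\<iota> 2) (\<iota> 1)) b"
proof -
  have 12: "\<iota> 1 \<noteq> \<iota> 2" using \<iota>_eq_iff[of 1 2] card by simp
  have sl: "E (\<iota> 2) (\<iota> 1) \<in> (sl :: ('f, 'n) sqmat set)" using 12 by (simp add: E_in_sl)
  have "basis_map \<iota> (munit \<iota> 1 2) b = rank_one (E (\<iota> 2) (\<iota> 1)) b"
  proof (rule basis_map_eqI[OF bij])
    show "mlinear (rank_one (E (\<iota> 2) (\<iota> 1)) b)" by (intro Uset_mlinear rank_one_in_Uset card sl b)
    show "rank_one (E (\<iota> 2) (\<iota> 1)) b (munit \<iota> 1 2) = b"
      by (simp add: rank_one_def munit_eq E_mult_E trace_E)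
    fix c :: "('f, 'n) sqmat" assume c: "c \<in> gl_basis \<iota>" "c \<noteq> munit \<iota> 1 2"
    have "c $ \<iota> 1 $ \<iota> 2 = 0"
      using c(1) unfolding gl_basis_def sl_basis_def
    proof (elim insertE UnE CollectE exE conjE)
      fix i j assume ij: "c = munit \<iota> i j" "i \<in> {1..CARD('n)}" "j \<in> {1..CARD('n)}" "i \<noteq> j"
      then have "\<not> (i = 1 \<and> j = 2)" using c(2) by blast
      then show ?thesis
        using \<iota>_eq_iff[of i 1] \<iota>_eq_iff[of j 2] ij card by (auto simp: munit_eq E_nth)
    qed (use 12 in \<open>auto simp: mat_def munit_eq E_nth\<close>)
    then show "rank_one (E (\<iota> 2) (\<iota> 1)) b c = 0" by (simp add: rank_one_def trace_mult_E)
  qed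
  then show ?thesis by (simp only: xbasis_def xsl_def xop_def sl_part_sl[OF sl] sl_part_sl[OF b])
qed

lemma xbasis_scalar: "xbasis \<iota> i (mat 1) (mat 1) = (xscalar i :: ('f::field_char_0, 'n) upoly)"
proof -
  have "basis_map \<iota> (mat 1) (mat 1 :: ('f, 'n) sqmat) = scalar_part"
  proof (rule basis_map_eqI[OF bij])
    show "mlinear (scalar_part :: ('f, 'n) sqmat \<Rightarrow> _)"
      by (intro Uset_mlinear scalar_part_in_Uset card)
    show "scalar_part (mat 1 :: ('f, 'n) sqmat) = mat 1" by (simp add: scalar_part_def trace_I)
    fix c :: "('f, 'n) sqmat" assume c: "c \<in> gl_basis \<iota>" "c \<noteq> mat 1"
    then have "c \<in> sl_basis \<iota>" by (simp add: gl_basis_def)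
    then have "trace c = 0"
      unfolding sl_basis_def munit_eq using \<iota>_eq_iff by (auto simp: trace_E trace_simps)
    then show "scalar_part c = 0" by (simp add: scalar_part_def)
  qed
  then show ?thesis by (simp add: xbasis_def xscalar_def xop_def)
qed

end

theorem theorem4p1p8:
  fixes \<iota> :: "nat \<Rightarrow> 'n::finite"
    and e :: "nat \<Rightarrow> nat \<Rightarrow> ('f::field_char_0, 'n) sqmat"
    and g :: "('f, 'n) sqmat"
    and x y :: "('f, 'n) sqmat \<Rightarrow> ('f, 'n) sqmat \<Rightarrow> ('f, 'n) upoly"
    and i j :: nat
  assumes "CARD('n) \<ge> 2"
    and "bij_betw \<iota> {1..CARD('n)} UNIV"
    and "i \<noteq> j"
  defines "e \<equiv> munit \<iota>" and "g \<equiv> mat 1"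
    and "x \<equiv> xbasis \<iota> i" and "y \<equiv> xbasis \<iota> j"
  shows "(U_identities :: ('f, 'n) upoly set) =
    TU_ideal hull
      {if CARD('n) = 2 then x (e 1 2) (e 1 2) * y (e 1 2) (e 1 2)
         else x (e 1 2) (e 1 2) * y (e 1 2) (e 3 1),
       x (e 1 2) (e 1 2) * y (e 1 2) (e 2 1) - y (e 1 2) (e 1 2) * x (e 1 2) (e 2 1),
       commutator (x g g) (y g g),
       commutator (x g g) (y (e 1 2) (e 1 2))}"
proof -
  let ?R = "{if CARD('n) = 2 then x (e 1 2) (e 1 2) * y (e 1 2) (e 1 2)
         else x (e 1 2) (e 1 2) * y (e 1 2) (e 3 1),
       x (e 1 2) (e 1 2) * y (e 1 2) (e 2 1) - y (e 1 2) (e 1 2) * x (e 1 2) (e 2 1),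
       commutator (x g g) (y g g),
       commutator (x g g) (y (e 1 2) (e 1 2))}"
  note card = assms(1) and bij = assms(2) and ij = assms(3)
  define a1 a2 a3 where "a1 = \<iota> 1" and "a2 = \<iota> 2" and "a3 = \<iota> 3"
  have a12: "a1 \<noteq> a2" using \<iota>_eq_iff[OF card bij, of 1 2] card by (simp add: a1_def a2_def)
  have a3: "a3 \<noteq> a1" "a3 \<noteq> a2" if "CARD('n) \<noteq> 2"
    using \<iota>_eq_iff[OF card bij, of 3 1] \<iota>_eq_iff[OF card bij, of 3 2] card that
    by (simp_all add: a1_def a2_def a3_def)
  have e: "e 1 2 = E a1 a2" "e 2 1 = E a2 a1" "e 3 1 = E a3 a1"
    by (simp_all add: e_def munit_eq a1_def a2_def a3_def)
  have x: "x (E a1 a2) b = xsl i (E a2 a1) b" "y (E a1 a2) b = xsl j (E a2 a1) b" if "b \<in> sl" for b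
    using xbasis_off_diagonal[OF card bij that] by (simp_all add: x_def y_def munit_eq a1_def a2_def)
  have g: "x g g = xscalar i" "y g g = xscalar j"
    using xbasis_scalar[OF card bij] by (simp_all add: x_def y_def g_def)
  define r1 where "r1 = (if CARD('n) = 2 then xsl i (E a2 a1) (E a1 a2) * xsl j (E a2 a1) (E a1 a2)
    else xsl i (E a2 a1) (E a1 a2) * (xsl j (E a2 a1) (E a3 a1) :: ('f, 'n) upoly))"
  define r2 where "r2 = xsl i (E a2 a1) (E a1 a2) * xsl j (E a2 a1) (E a2 a1)
    - xsl j (E a2 a1) (E a1 a2) * (xsl i (E a2 a1) (E a2 a1) :: ('f, 'n) upoly)"
  define r3 where "r3 = (xscalar i * xscalar j - xscalar j * xscalar i :: ('f, 'n) upoly)"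
  define r4 where "r4 = xscalar i * xsl j (E a2 a1) (E a1 a2)
    - xsl j (E a2 a1) (E a1 a2) * (xscalar i :: ('f, 'n) upoly)"
  have sl: "E a1 a2 \<in> (sl :: ('f, 'n) sqmat set)" "E a2 a1 \<in> (sl :: ('f, 'n) sqmat set)"
    using a12 by (simp_all add: E_in_sl)
  have R: "?R = {r1, r2, r3, r4}"
  proof -
    have "x (E a1 a2) (E a1 a2) * y (E a1 a2) (E a3 a1)
        = xsl i (E a2 a1) (E a1 a2) * xsl j (E a2 a1) (E a3 a1)" if "CARD('n) \<noteq> 2"
      unfolding x(1)[OF sl(1)] x(2)[OF E_in_sl(1)[OF a3(1)[OF that]]] ..
    then show ?thesis
      unfolding e g commutator_def r1_def r2_def r3_def r4_def x(1)[OF sl(1)] x(2)[OF sl(1)]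
        x(1)[OF sl(2)] x(2)[OF sl(2)] by (cases "CARD('n) = 2") simp_all
  qed
  show ?thesis
    unfolding R
  proof
    show "U_identities \<subseteq> TU_ideal hull {r1, r2, r3, r4}"
      unfolding hull_def
    proof (rule Inter_greatest, elim CollectE conjE)
      fix I assume I: "TU_ideal I" "{r1, r2, r3, r4} \<subseteq> I"
      interpret TU_quotient I a1 a2 i j
      proof
        show "CARD('n) \<noteq> 2 \<Longrightarrow> \<exists>a3. a3 \<notin> {a1, a2} \<and>
            xsl i (E a2 a1) (E a1 a2) * xsl j (E a2 a1) (E a3 a1) \<in> I"
          using I(2) a3 by (intro exI[of _ a3]) (simp add: r1_def)
      qed (use I card ij a12 in \<open>simp_all add: r1_def r2_def r3_def r4_def\<close>)
      show "U_identities \<subseteq> I" by (rule identities_subset)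
    qed
    have ev: "ueval m (xsl l (E a2 a1) (E p q)) = mscale (m l $ a1 $ a2) (E p q)" if "p \<noteq> q"
      for m :: "nat \<Rightarrow> ('f, 'n) sqmat" and l p q
      using that a12 by (simp add: ueval_xsl[OF card] sl_part_sl E_in_sl trace_mult_E)
    have "ueval m r1 = 0" for m
      using a12 a3 by (auto simp: r1_def ueval_mult ev mscale_mult_left mscale_mult_right E_mult_E)
    moreover have "ueval m r2 = 0" for m
      using a12 by (simp add: r2_def ueval_diff ueval_mult ev mscale_mult_left mscale_mult_right
          E_mult_E mult.commute)
    moreover have "ueval m r3 = 0" "ueval m r4 = 0" for m
      using a12 by (simp_all add: r3_def r4_def ueval_diff ueval_mult ev ueval_xscalar[OF card]
          scalar_part_def mult.commute)
    ultimately have "{r1, r2, r3, r4} \<subseteq> U_identities" by (simp add: U_identities_def)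
    then show "TU_ideal hull {r1, r2, r3, r4} \<subseteq> U_identities"
      by (rule hull_minimal) (rule TU_ideal_identities)
  qed
qed

end
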